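(* The process $\tilde W$ is an $(\tilde{\mathscr{F}}_t)$-cylindrical Wiener process, i.e. there exists a collection of mutually independent real-valued $(\tilde{\mathscr{F}}_t)$-Wiener processes $\{\tilde\beta_k\}_{k\ge1}$ such that $\tilde W=\sum_{k\ge1}\tilde\beta_ke_k$.
   Context: **Setting.** $T>0$; $\mathbb{T}^N$ is the $N$-dimensional torus (periodic boundary conditions on $[0,1]^N$). $B=(B_1,\dots,B_N):\mathbb{R}\to\mathbb{R}^N$ is of class $C^1$ and its derivative $b=(b_1,\dots,b_N)$ has polynomial growth. $A=(A_{ij}):\mathbb{T}^N\to\mathbb{R}^{N\times N}$ is $C^\infty$, symmetric and positive semidefinite. $(\Omega,\mathscr{F},(\mathscr{F}_t)_{t\ge0},\mathbb{P})$ is a stochastic basis with complete, right-continuous filtration; $W(t)=\sum_{k\ge1}\beta_k(t)e_k$ is a cylindrical Wiener process, where $(\beta_k)$ are mutually independent real standard Wiener processes relative to $(\mathscr{F}_t)$ and $(e_k)$ is a complete orthonormal system of a separable Hilbert space $\mathfrak{U}$. For $z\in L^2(\mathbb{T}^N)$, $\varPhi(z):\mathfrak{U}\to L^2(\mathbb{T}^N)$ is given by $\varPhi(z)e_k=g_k(\cdot,z(\cdot))$, where $g_k\in C(\mathbb{T}^N\times\mathbb{R})$ satisfy, for some constant $L$ and all $x,y\in\mathbb{T}^N$, $\xi,\zeta\in\mathbb{R}$, $$G^2(x,\xi):=\sum_{k\ge1}|g_k(x,\xi)|^2\le L(1+|\xi|^2),\qquad \sum_{k\ge1}|g_k(x,\xi)-g_k(y,\zeta)|^2\le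 L\big(|x-y|^2+|\xi-\zeta|\,h(|\xi-\zeta|)\big),$$ with $h$ continuous nondecreasing on $\mathbb{R}_+$ and $h(\delta)\le C\delta^\alpha$ for $\delta<1$, for some $\alpha>0$. The initial datum $u_0$ is $\mathscr{F}_0$-measurable and $u_0\in L^p(\Omega;C^\infty(\mathbb{T}^N))$ for all $p\in[1,\infty)$. The space $\mathfrak{U}_0\supset\mathfrak{U}$ consists of $v=\sum_k\alpha_ke_k$ with $\|v\|_{\mathfrak{U}_0}^2=\sum_k\alpha_k^2/k^2<\infty$; trajectories of $W$ are a.s. in $C([0,T];\mathfrak{U}_0)$. **Approximations.** Let $(\varphi_\varepsilon)$, $(\psi_\varepsilon)$ be approximations to the identity on $\mathbb{T}^N\times\mathbb{R}$ and $\mathbb{R}$, and $\chi_\varepsilon(\xi)=\chi(\varepsilon\xi)$ with $\chi$ smooth, $0\le\chi\le1$, $\chi=1$ for $|\xi|\le\frac12$, $\chi=0$ for $|\xi|\ge1$. Set $B_i^\varepsilon=(B_i*\psi_\varepsilon)\chi_\varepsilon$, $b^\varepsilon=(B^\varepsilon)'$; $g_k^\varepsilon=(g_k*\varphi_\varepsilon)\chi_\varepsilon$ if $k\le\lfloor1/\varepsilon\rfloor$ and $g_k^\varepsilon=0$ otherwise; $\varPhi^\varepsilon(z)e_k=g_k^\varepsilon(\cdot,z(\cdot))$; $G_\varepsilon^2=\sum_k|g_k^\varepsilon|^2$; $A^\varepsilon=A+\varepsilon I$. For $\varepsilon\in(0,1)$, $u^\varepsilon$ is the predictable $C^\infty(\mathbb{T}^N)$-valued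 process solving $$du^\varepsilon+\operatorname{div}(B^\varepsilon(u^\varepsilon))\,dt=\operatorname{div}(A^\varepsilon(x)\nabla u^\varepsilon)\,dt+\varPhi^\varepsilon(u^\varepsilon)\,dW,\qquad u^\varepsilon(0)=u_0 .$$ **Skorokhod representation.** Let $\mathcal{X}=\mathcal{X}_u\times\mathcal{X}_W$ with $\mathcal{X}_u=L^1(0,T;L^1(\mathbb{T}^N))\cap C([0,T];H^{-1}(\mathbb{T}^N))$ and $\mathcal{X}_W=C([0,T];\mathfrak{U}_0)$. Let $\mu^\varepsilon$ be the joint law of $(u^\varepsilon,W)$ on $\mathcal{X}$. The family $\{\mu^\varepsilon\}$ is tight; fix $\varepsilon_n\to0$ such that $\mu^n=\mu^{\varepsilon_n}$ converges weakly to some $\mu$. A superscript or subscript $n$ means $\varepsilon=\varepsilon_n$. By the Skorokhod theorem fix a probability space $(\tilde\Omega,\tilde{\mathscr{F}},\tilde{\mathbb{P}})$ and $\mathcal{X}$-valued random variables $(\tilde u^n,\tilde W^n)$, $n\in\mathbb{N}$, and $(\tilde u,\tilde W)$ with laws $\mu^n$ and $\mu$ respectively, such that $(\tilde u^n,\tilde W^n)\to(\tilde u,\tilde W)$ in $\mathcal{X}$, $\tilde{\mathbb{P}}$-a.s. The filtration $(\tilde{\mathscr{F}}_t)$ is the $\tilde{\mathbb{P}}$-augmented canonical filtration of $(\tilde u,\tilde W)$: $$\tilde{\mathscr{F}}_t=\sigma\big(\sigma(\varrho_t\tilde u,\varrho_t\tilde W)\cup\{N\in\tilde{\mathscr{F}}:\tilde{\mathbb{P}}(N)=0\}\big),\quad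 t\in[0,T],$$ with $\varrho_t$ the restriction to $[0,t]$. *)

theory Defs
  imports "HOL-Analysis.Analysis" "HOL-Probability.Probability"
begin

section \<open>Smooth functions on the torus\<close>

definition dderiv :: "'a::euclidean_space \<Rightarrow> ('a \<Rightarrow> real) \<Rightarrow> 'a \<Rightarrow> real" where
  "dderiv b f x = frechet_derivative f (at x) b"

definition dderivs :: "'a::euclidean_space list \<Rightarrow> ('a \<Rightarrow> real) \<Rightarrow> 'a \<Rightarrow> real" where
  "dderivs bs f = foldr dderiv bs f"

definition smooth :: "('a::euclidean_space \<Rightarrow> real) \<Rightarrow> bool" where
  "smooth f \<longleftrightarrow> (\<forall>bs x. set bs \<subseteq> Basis \<longrightarrow> dderivs bs f differentiable (at x))"

text \<open>Functions on the torus are the functions on \<^typ>\<open>real^'n\<close> with period 1 in every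
  coordinate; integrals over the torus are taken over the unit cell.\<close>

definition periodic :: "(real^'n \<Rightarrow> 'b) \<Rightarrow> bool" where
  "periodic f \<longleftrightarrow> (\<forall>x i. f (x + axis i 1) = f x)"

abbreviation cell :: "(real^'n) set" where
  "cell \<equiv> cbox 0 1"

definition Cinf :: "(real^'n \<Rightarrow> real) set" where
  "Cinf = {f. periodic f \<and> smooth f}"

definition Cinf_seminorm :: "(real^'n) list \<Rightarrow> (real^'n \<Rightarrow> real) \<Rightarrow> real" where
  "Cinf_seminorm bs f = (SUP x. \<bar>dderivs bs f x\<bar>)"

definition Cinf_topology :: "(real^'n \<Rightarrow> real) topology" where
  "Cinf_topology = topology_generated_by
     {{g \<in> Cinf. Cinf_seminorm bs (\<lambda>x. g x - f x) < r} | bs f r. set bs \<subseteq> Basis \<and> f \<in> Cinf}"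

definition partial :: "'n \<Rightarrow> (real^'n \<Rightarrow> real) \<Rightarrow> real^'n \<Rightarrow> real" where
  "partial i f = dderiv (axis i 1) f"

definition grad :: "(real^'n \<Rightarrow> real) \<Rightarrow> real^'n \<Rightarrow> real^'n" where
  "grad f x = (\<chi> i. partial i f x)"

definition divergence :: "(real^'n \<Rightarrow> real^'n) \<Rightarrow> real^'n \<Rightarrow> real" where
  "divergence V x = (\<Sum>i\<in>UNIV. partial i (\<lambda>y. V y $ i) x)"

section \<open>The space \<open>H\<^sup>-\<^sup>1\<close> on the torus\<close>

text \<open>An element of the dual of \<open>H\<^sup>1\<close> is recorded by its restriction to the dense subspace
  \<^term>\<open>Cinf\<close> of \<open>H\<^sup>1\<close>, i.e. as a periodic distribution bounded in the \<open>H\<^sup>1\<close> norm.\<close>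

definition H1_norm :: "(real^'n \<Rightarrow> real) \<Rightarrow> real" where
  "H1_norm f = sqrt ((LINT x:cell|lborel. (f x)\<^sup>2) + (LINT x:cell|lborel. (norm (grad f x))\<^sup>2))"

definition Hm1_set :: "((real^'n \<Rightarrow> real) \<Rightarrow> real) set" where
  "Hm1_set = {l \<in> extensional Cinf.
     (\<forall>f\<in>Cinf. \<forall>g\<in>Cinf. \<forall>a c. l (\<lambda>x. a * f x + c * g x) = a * l f + c * l g) \<and>
     (\<exists>K. \<forall>f\<in>Cinf. \<bar>l f\<bar> \<le> K * H1_norm f)}"

definition Hm1_norm :: "((real^'n \<Rightarrow> real) \<Rightarrow> real) \<Rightarrow> real" where
  "Hm1_norm l = (SUP f\<in>{f\<in>Cinf. H1_norm f \<le> 1}. \<bar>l f\<bar>)"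

text \<open>\<^const>\<open>Metric_space\<close> constrains the distance outside the carrier too, hence the guard.\<close>

definition Hm1_dist where
  "Hm1_dist l m = (if l \<in> Hm1_set \<and> m \<in> Hm1_set then Hm1_norm (\<lambda>f. l f - m f) else 0)"

definition Hm1 :: "((real^'n \<Rightarrow> real) \<Rightarrow> real) metric" where
  "Hm1 = metric (Hm1_set, Hm1_dist)"

definition distr_of :: "(real^'n \<Rightarrow> real) \<Rightarrow> (real^'n \<Rightarrow> real) \<Rightarrow> real" where
  "distr_of f = (\<lambda>g\<in>Cinf. LINT x:cell|lborel. f x * g x)"

section \<open>The path spaces\<close>

text \<open>\<open>L1_rep t u f\<close>: the distribution-valued path \<open>u\<close> is, as an element of
  \<open>L\<^sup>1(0,t;L\<^sup>1)\<close>, given by the integrable function \<open>f\<close> on \<open>[0,t] \<times> cell\<close>. Such an \<open>f\<close> is unique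
  up to null sets, so the infimum in \<open>L1_norm\<close> ranges over a single value.\<close>

definition L1_rep ::
  "real \<Rightarrow> (real \<Rightarrow> (real^'n \<Rightarrow> real) \<Rightarrow> real) \<Rightarrow> (real \<times> (real^'n) \<Rightarrow> real) \<Rightarrow> bool" where
  "L1_rep t u f \<longleftrightarrow> set_integrable lborel ({0..t} \<times> cell) f \<and>
     (AE s in lborel. s \<in> {0..t} \<longrightarrow> (\<forall>g\<in>Cinf. u s g = distr_of (\<lambda>x. f (s, x)) g))"

definition L1_norm :: "real \<Rightarrow> (real \<Rightarrow> (real^'n \<Rightarrow> real) \<Rightarrow> real) \<Rightarrow> real" where
  "L1_norm t u = Inf {LINT z:{0..t} \<times> cell|lborel. \<bar>f z\<bar> | f. L1_rep t u f}"

definition Xu_set :: "real \<Rightarrow> (real \<Rightarrow> (real^'n \<Rightarrow> real) \<Rightarrow> real) set" where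
  "Xu_set t = {u \<in> mspace (cfunspace (top_of_set {0..t}) Hm1). \<exists>f. L1_rep t u f}"

definition Xu_dist where
  "Xu_dist t u v = (if u \<in> Xu_set t \<and> v \<in> Xu_set t
     then L1_norm t (\<lambda>s g. u s g - v s g) + mdist (cfunspace (top_of_set {0..t}) Hm1) u v
     else 0)"

definition Xu :: "real \<Rightarrow> (real \<Rightarrow> (real^'n \<Rightarrow> real) \<Rightarrow> real) metric" where
  "Xu t = metric (Xu_set t, Xu_dist t)"

definition XW :: "real \<Rightarrow> (real \<Rightarrow> 'w::banach) metric" where
  "XW t = cfunspace (top_of_set {0..t}) euclidean_metric"

definition X_topology ::
  "real \<Rightarrow> ((real \<Rightarrow> (real^'n \<Rightarrow> real) \<Rightarrow> real) \<times> (real \<Rightarrow> 'w::banach)) topology" where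
  "X_topology t = prod_topology (mtopology_of (Xu t)) (mtopology_of (XW t))"

subsection \<open>\<^const>\<open>Hm1\<close> and \<^const>\<open>Xu\<close> are metric spaces\<close>

lemma dderivs_Nil [simp]: "dderivs [] f = f"
  and dderivs_Cons [simp]: "dderivs (b # bs) f = dderiv b (dderivs bs f)"
  by (simp_all add: dderivs_def)

lemma dderiv_cmult:
  assumes "f differentiable (at x)"
  shows "dderiv b (\<lambda>y. c * f y) x = c * dderiv b f x"
proof -
  have "(f has_derivative frechet_derivative f (at x)) (at x)"
    using assms by (simp add: frechet_derivative_works)
  then have "((\<lambda>y. c * f y) has_derivative (\<lambda>h. c * frechet_derivative f (at x) h)) (at x)"
    by (auto intro!: derivative_eq_intros)
  from frechet_derivative_at[OF this] show ?thesis
    by (metis dderiv_def)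
qed

lemma dderivs_cmult:
  assumes "smooth f" "set bs \<subseteq> Basis"
  shows "dderivs bs (\<lambda>y. c * f y) = (\<lambda>y. c * dderivs bs f y)"
  using assms(2)
proof (induction bs)
  case (Cons b bs)
  then have "dderivs bs f differentiable (at x)" for x
    using assms(1) by (simp add: smooth_def)
  with Cons show ?case by (auto simp: dderiv_cmult)
qed simp

lemma smooth_cmult: "smooth f \<Longrightarrow> smooth (\<lambda>x. c * f x)"
  unfolding smooth_def[of "\<lambda>x. c * f x"]
  by (auto simp: dderivs_cmult smooth_def intro!: differentiable_mult)

lemma Cinf_cmult: "f \<in> Cinf \<Longrightarrow> (\<lambda>x. c * f x) \<in> Cinf"
  by (auto simp: Cinf_def periodic_def smooth_cmult)

lemma zero_in_Cinf: "(\<lambda>x::real^'n. 0) \<in> Cinf"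
proof -
  have "dderivs bs (\<lambda>x::real^'n. 0) = (\<lambda>x. 0)" for bs
  proof (induction bs)
    case (Cons b bs)
    then show ?case by (simp add: dderiv_def[abs_def] frechet_derivative_const)
  qed simp
  then show ?thesis by (auto simp: Cinf_def periodic_def smooth_def)
qed

lemma H1_norm_nonneg: "0 \<le> H1_norm f"
  by (auto simp: H1_norm_def set_lebesgue_integral_def intro!: add_nonneg_nonneg integral_nonneg)

lemma H1_norm_cmult:
  assumes "f \<in> Cinf" shows "H1_norm (\<lambda>x. c * f x) = \<bar>c\<bar> * H1_norm f"
proof -
  have "f differentiable (at x)" for x
    using assms unfolding Cinf_def smooth_def
    by (metis (mono_tags, lifting) dderivs_Nil empty_set empty_subsetI mem_Collect_eq)
  then have "grad (\<lambda>x. c * f x) x = c *\<^sub>R grad f x" for x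
    by (simp add: grad_def partial_def dderiv_cmult vec_eq_iff)
  then have "(H1_norm (\<lambda>x. c * f x)) = sqrt (c\<^sup>2 *
      ((LINT x:cell|lborel. (f x)\<^sup>2) + (LINT x:cell|lborel. (norm (grad f x))\<^sup>2)))"
    by (simp add: H1_norm_def power_mult_distrib distrib_left)
  then show ?thesis by (simp add: real_sqrt_mult H1_norm_def)
qed

lemma Hm1_norm_bdd:
  assumes "\<exists>K. \<forall>f\<in>Cinf. \<bar>l f\<bar> \<le> K * H1_norm f"
  shows "bdd_above ((\<lambda>f. \<bar>l f\<bar>) ` {f\<in>Cinf. H1_norm f \<le> 1})"
proof -
  obtain K where K: "\<And>f. f \<in> Cinf \<Longrightarrow> \<bar>l f\<bar> \<le> K * H1_norm f" using assms by blast
  have "\<bar>l f\<bar> \<le> \<bar>K\<bar>" if "f \<in> Cinf" "H1_norm f \<le> 1" for f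
  proof -
    have "\<bar>l f\<bar> \<le> \<bar>K\<bar> * H1_norm f"
      using K[OF that(1)] mult_right_mono[OF abs_ge_self[of K] H1_norm_nonneg[of f]] by linarith
    also have "\<dots> \<le> \<bar>K\<bar> * 1" using that(2) by (intro mult_left_mono) auto
    finally show ?thesis by simp
  qed
  then show ?thesis by (auto simp: bdd_above_def)
qed

lemma Hm1_diff_bound:
  assumes "l \<in> Hm1_set" "m \<in> Hm1_set"
  shows "\<exists>K. \<forall>f\<in>Cinf. \<bar>l f - m f\<bar> \<le> K * H1_norm f"
proof -
  obtain K K' where "\<forall>f\<in>Cinf. \<bar>l f\<bar> \<le> K * H1_norm f" "\<forall>f\<in>Cinf. \<bar>m f\<bar> \<le> K' * H1_norm f"
    using assms by (auto simp: Hm1_set_def)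
  then have "\<forall>f\<in>Cinf. \<bar>l f - m f\<bar> \<le> (K + K') * H1_norm f"
    by (auto simp: distrib_right intro!: order_trans[OF abs_triangle_ineq4] add_mono)
  then show ?thesis by blast
qed

lemma zero_in_H1_ball: "(\<lambda>x::real^'n. 0) \<in> {f\<in>Cinf. H1_norm f \<le> 1}"
  using H1_norm_cmult[OF zero_in_Cinf[where 'n='n], of 0] by (auto simp: zero_in_Cinf)

lemma Hm1_norm_nonneg:
  assumes "\<exists>K. \<forall>f\<in>Cinf. \<bar>l f\<bar> \<le> K * H1_norm f" shows "0 \<le> Hm1_norm l"
  unfolding Hm1_norm_def
  by (rule cSUP_upper2[OF Hm1_norm_bdd[OF assms] zero_in_H1_ball]) auto

lemma Metric_space_Hm1: "Metric_space (Hm1_set :: ((real^'n \<Rightarrow> real) \<Rightarrow> real) set) Hm1_dist"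
proof
  fix l m :: "(real^'n \<Rightarrow> real) \<Rightarrow> real"
  show "0 \<le> Hm1_dist l m"
    by (auto simp: Hm1_dist_def intro!: Hm1_norm_nonneg Hm1_diff_bound)
  show "Hm1_dist l m = Hm1_dist m l"
    by (auto simp: Hm1_dist_def Hm1_norm_def abs_minus_commute)
next
  fix l m :: "(real^'n \<Rightarrow> real) \<Rightarrow> real"
  assume lm: "l \<in> Hm1_set" "m \<in> Hm1_set"
  show "(Hm1_dist l m = 0) = (l = m)"
  proof
    assume "Hm1_dist l m = 0"
    then have 0: "Hm1_norm (\<lambda>f. l f - m f) = 0" using lm by (simp add: Hm1_dist_def)
    have le: "l f = m f" if "f \<in> Cinf" "H1_norm f \<le> 1" for f
      using cSUP_upper[OF _ Hm1_norm_bdd[OF Hm1_diff_bound[OF lm]], of f] that 0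
      by (auto simp: Hm1_norm_def)
    have "l f = m f" if f: "f \<in> Cinf" for f
    proof -
      define c where "c = inverse (1 + H1_norm f)"
      have c: "c > 0" using H1_norm_nonneg[of f] by (simp add: c_def)
      have "H1_norm (\<lambda>x. c * f x) \<le> 1"
        using H1_norm_nonneg[of f] c by (simp add: H1_norm_cmult[OF f]) (simp add: c_def field_simps)
      then have eq: "l (\<lambda>x. c * f x) = m (\<lambda>x. c * f x)" using le Cinf_cmult[OF f] by blast
      have lin: "k (\<lambda>x. c * f x) = c * k f" if "k \<in> Hm1_set" for k
      proof -
        have "k (\<lambda>x. c * f x + 0 * f x) = c * k f + 0 * k f"
          using that f unfolding Hm1_set_def by blast
        then show ?thesis by simp
      qed
      show ?thesis using eq lin[OF lm(1)] lin[OF lm(2)] c by simp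
    qed
    then show "l = m" using lm by (auto simp: Hm1_set_def intro: extensionalityI)
  next
    assume "l = m"
    moreover have "(SUP f\<in>{f\<in>Cinf::(real^'n \<Rightarrow> real) set. H1_norm f \<le> 1}. \<bar>0\<bar>) = (0::real)"
      using zero_in_H1_ball by (subst cSUP_const) auto
    ultimately show "Hm1_dist l m = 0" by (simp add: Hm1_dist_def Hm1_norm_def)
  qed
next
  fix l m k :: "(real^'n \<Rightarrow> real) \<Rightarrow> real"
  assume *: "l \<in> Hm1_set" "m \<in> Hm1_set" "k \<in> Hm1_set"
  have "Hm1_norm (\<lambda>f. l f - k f) \<le> Hm1_norm (\<lambda>f. l f - m f) + Hm1_norm (\<lambda>f. m f - k f)"
    unfolding Hm1_norm_def[of "\<lambda>f. l f - k f"]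
  proof (rule cSUP_least)
    show "{f\<in>Cinf::(real^'n \<Rightarrow> real) set. H1_norm f \<le> 1} \<noteq> {}" using zero_in_H1_ball by blast
    fix f assume f: "f \<in> {f\<in>Cinf::(real^'n \<Rightarrow> real) set. H1_norm f \<le> 1}"
    have "\<bar>l f - m f\<bar> \<le> Hm1_norm (\<lambda>f. l f - m f)" "\<bar>m f - k f\<bar> \<le> Hm1_norm (\<lambda>f. m f - k f)"
      using cSUP_upper[OF f Hm1_norm_bdd[OF Hm1_diff_bound]] * by (auto simp: Hm1_norm_def)
    then show "\<bar>l f - k f\<bar> \<le> Hm1_norm (\<lambda>f. l f - m f) + Hm1_norm (\<lambda>f. m f - k f)" by linarith
  qed
  then show "Hm1_dist l k \<le> Hm1_dist l m + Hm1_dist m k" using * by (simp add: Hm1_dist_def)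
qed

lemma mspace_Hm1 [simp]: "mspace Hm1 = Hm1_set"
  and mdist_Hm1 [simp]: "mdist Hm1 = Hm1_dist"
  by (simp_all add: Hm1_def Metric_space.mspace_metric Metric_space.mdist_metric Metric_space_Hm1)

lemma L1_rep_integrable_slice:
  fixes f :: "real \<times> (real^'n) \<Rightarrow> real"
  assumes "set_integrable lborel ({0..t} \<times> cell) f"
  shows "AE s in lborel. s \<in> {0..t} \<longrightarrow> set_integrable lborel cell (\<lambda>x. f (s, x))"
proof -
  have "integrable (lborel \<Otimes>\<^sub>M lborel) (\<lambda>z. indicator ({0..t} \<times> cell) z *\<^sub>R f z)"
    using assms by (simp add: set_integrable_def lborel_prod)
  then have "AE s in lborel. integrable lborel (\<lambda>x. indicator ({0..t} \<times> cell) (s, x) *\<^sub>R f (s, x))"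
    by (rule lborel_pair.AE_integrable_fst')
  then show ?thesis
    by eventually_elim (auto simp: set_integrable_def indicator_def mem_Times_iff)
qed

lemma set_integrable_cell_mult:
  fixes f :: "real^'n \<Rightarrow> real"
  assumes "set_integrable lborel cell f" "g \<in> Cinf"
  shows "set_integrable lborel cell (\<lambda>x. f x * g x)"
proof -
  have "g differentiable (at x)" for x
    using assms(2) unfolding Cinf_def smooth_def
    by (metis (mono_tags, lifting) dderivs_Nil empty_set empty_subsetI mem_Collect_eq)
  then have c: "continuous_on UNIV g"
    by (simp add: continuous_at_imp_continuous_on differentiable_imp_continuous_within)
  then have gm: "g \<in> borel_measurable lborel" by (simp add: borel_measurable_continuous_onI)
  have "compact (g ` cell)"
    using c by (intro compact_continuous_image) (auto intro: continuous_on_subset)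
  then obtain K where K: "\<And>x. x \<in> cell \<Longrightarrow> \<bar>g x\<bar> \<le> K"
    by (meson compact_imp_bounded bounded_real image_eqI)
  have fi: "integrable lborel (\<lambda>x. indicator cell x *\<^sub>R f x)"
    using assms(1) by (simp add: set_integrable_def)
  show ?thesis
    unfolding set_integrable_def
  proof (rule Bochner_Integration.integrable_bound)
    show "integrable lborel (\<lambda>x. K * (indicator cell x *\<^sub>R f x))"
      using fi by (rule integrable_mult_right)
    have "(\<lambda>x. (indicator cell x *\<^sub>R f x) * g x) \<in> borel_measurable lborel"
      using fi gm by (intro borel_measurable_times) auto
    then show "(\<lambda>x. indicator cell x *\<^sub>R (f x * g x)) \<in> borel_measurable lborel"
      by (simp add: mult.assoc)
    show "AE x in lborel. norm (indicator cell x *\<^sub>R (f x * g x)) \<le> norm (K * (indicator cell x *\<^sub>R f x))"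
    proof (intro always_eventually allI)
      fix x :: "real^'n"
      show "norm (indicator cell x *\<^sub>R (f x * g x)) \<le> norm (K * (indicator cell x *\<^sub>R f x))"
      proof (cases "x \<in> cell")
        case True
        then have "\<bar>g x\<bar> \<le> \<bar>K\<bar>" using K[of x] by linarith
        then have "\<bar>f x\<bar> * \<bar>g x\<bar> \<le> \<bar>f x\<bar> * \<bar>K\<bar>"
          by (rule mult_left_mono) simp
        then show ?thesis using True
          by (simp add: abs_mult mult.commute)
      qed simp
    qed
  qed
qed

lemma L1_rep_lin:
  assumes f: "L1_rep t u f" and h: "L1_rep t v h"
  shows "L1_rep t (\<lambda>s g. a * u s g + c * v s g) (\<lambda>z. a * f z + c * h z)"
proof -
  have i: "set_integrable lborel ({0..t} \<times> cell) f" "set_integrable lborel ({0..t} \<times> cell) h"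
    using f h by (auto simp: L1_rep_def)
  have "AE s in lborel. s \<in> {0..t} \<longrightarrow>
      (\<forall>g\<in>Cinf. a * u s g + c * v s g = distr_of (\<lambda>x. a * f (s, x) + c * h (s, x)) g)"
    using L1_rep_integrable_slice[OF i(1)] L1_rep_integrable_slice[OF i(2)]
      f[unfolded L1_rep_def, THEN conjunct2] h[unfolded L1_rep_def, THEN conjunct2]
  proof eventually_elim
    case (elim s)
    have "a * u s g + c * v s g = distr_of (\<lambda>x. a * f (s, x) + c * h (s, x)) g"
      if "s \<in> {0..t}" "g \<in> Cinf" for g
    proof -
      have 1: "set_integrable lborel cell (\<lambda>x. f (s, x) * g x)"
        "set_integrable lborel cell (\<lambda>x. h (s, x) * g x)"
        using elim that set_integrable_cell_mult by blast+
      have "distr_of (\<lambda>x. a * f (s, x) + c * h (s, x)) g =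
        (LINT x:cell|lborel. a * (f (s, x) * g x) + c * (h (s, x) * g x))"
        using that by (simp add: distr_of_def algebra_simps)
      also have "\<dots> = a * (LINT x:cell|lborel. f (s, x) * g x) + c * (LINT x:cell|lborel. h (s, x) * g x)"
        using 1 by (subst set_integral_add) auto
      finally show ?thesis using elim that by (simp add: distr_of_def)
    qed
    then show ?case by blast
  qed
  moreover have "set_integrable lborel ({0..t} \<times> cell) (\<lambda>z. a * f z + c * h z)"
    using i by (intro set_integral_add) auto
  ultimately show ?thesis by (simp add: L1_rep_def)
qed

lemma L1_rep_diff: "L1_rep t u f \<Longrightarrow> L1_rep t v h \<Longrightarrow> L1_rep t (\<lambda>s g. u s g - v s g) (\<lambda>z. f z - h z)"
  using L1_rep_lin[of t u f v h 1 "-1"] by simp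

lemma L1_abs_nonneg: "0 \<le> (LINT z:S|lborel. \<bar>f z :: real\<bar>)"
  by (auto simp: set_lebesgue_integral_def intro!: integral_nonneg)

lemma L1_norm_nonneg: "L1_rep t u f \<Longrightarrow> 0 \<le> L1_norm t u"
  unfolding L1_norm_def by (rule cInf_greatest) (auto intro: L1_abs_nonneg)

lemma L1_norm_le: "L1_rep t u f \<Longrightarrow> L1_norm t u \<le> (LINT z:{0..t} \<times> cell|lborel. \<bar>f z\<bar>)"
  unfolding L1_norm_def by (rule cInf_lower) (auto intro!: bdd_belowI[of _ 0] L1_abs_nonneg)

lemma L1_norm_minus: "L1_norm t (\<lambda>s g. u s g - v s g) = L1_norm t (\<lambda>s g. v s g - u s g)"
proof -
  have sub: "{LINT z:{0..t} \<times> cell|lborel. \<bar>f z\<bar> | f. L1_rep t (\<lambda>s g. u s g - v s g) f} \<subseteq>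
        {LINT z:{0..t} \<times> cell|lborel. \<bar>f z\<bar> | f. L1_rep t (\<lambda>s g. v s g - u s g) f}" for u v
  proof clarify
    fix f assume "L1_rep t (\<lambda>s g. u s g - v s g) f"
    from L1_rep_lin[OF this this, of "-1" 0] have rep: "L1_rep t (\<lambda>s g. v s g - u s g) (\<lambda>z. - f z)"
      by simp
    show "\<exists>h. (LINT z:{0..t} \<times> cell|lborel. \<bar>f z\<bar>) = (LINT z:{0..t} \<times> cell|lborel. \<bar>h z\<bar>) \<and>
        L1_rep t (\<lambda>s g. v s g - u s g) h"
      by (rule exI[of _ "\<lambda>z. - f z"]) (use rep in simp)
  qed
  show ?thesis unfolding L1_norm_def by (intro arg_cong[where f=Inf] subset_antisym sub)
qed

lemma L1_norm_triangle:
  assumes "L1_rep t u f" "L1_rep t v h"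
  shows "L1_norm t (\<lambda>s g. u s g + v s g) \<le> L1_norm t u + L1_norm t v"
proof -
  have le: "L1_norm t (\<lambda>s g. u s g + v s g) \<le>
      (LINT z:{0..t} \<times> cell|lborel. \<bar>f z\<bar>) + (LINT z:{0..t} \<times> cell|lborel. \<bar>h z\<bar>)"
    if "L1_rep t u f" "L1_rep t v h" for f h
  proof -
    have i: "set_integrable lborel ({0..t} \<times> cell) f" "set_integrable lborel ({0..t} \<times> cell) h"
      using that by (auto simp: L1_rep_def)
    have "L1_norm t (\<lambda>s g. u s g + v s g) \<le> (LINT z:{0..t} \<times> cell|lborel. \<bar>f z + h z\<bar>)"
      using L1_norm_le[OF L1_rep_lin[OF that, of 1 1]] by simp
    also have "\<dots> \<le> (LINT z:{0..t} \<times> cell|lborel. \<bar>f z\<bar> + \<bar>h z\<bar>)"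
      using i by (intro set_integral_mono set_integrable_abs set_integral_add) auto
    also have "\<dots> = (LINT z:{0..t} \<times> cell|lborel. \<bar>f z\<bar>) + (LINT z:{0..t} \<times> cell|lborel. \<bar>h z\<bar>)"
      using i by (intro set_integral_add set_integrable_abs)
    finally show ?thesis .
  qed
  have "L1_norm t (\<lambda>s g. u s g + v s g) - (LINT z:{0..t} \<times> cell|lborel. \<bar>f z\<bar>) \<le> L1_norm t v"
    if "L1_rep t u f" for f
    unfolding L1_norm_def[of t v]
    by (rule cInf_greatest) (use assms le[OF that] in \<open>auto simp: algebra_simps\<close>)
  then have "L1_norm t (\<lambda>s g. u s g + v s g) - L1_norm t v \<le> L1_norm t u"
    unfolding L1_norm_def[of t u]
    by (intro cInf_greatest) (use assms in \<open>auto simp: algebra_simps\<close>)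
  then show ?thesis by simp
qed

lemma Metric_space_Xu: "Metric_space (Xu_set t :: (real \<Rightarrow> (real^'n \<Rightarrow> real) \<Rightarrow> real) set) (Xu_dist t)"
proof
  fix u v :: "real \<Rightarrow> (real^'n \<Rightarrow> real) \<Rightarrow> real"
  show "0 \<le> Xu_dist t u v"
  proof (cases "u \<in> Xu_set t \<and> v \<in> Xu_set t")
    case True
    then obtain f h where "L1_rep t u f" "L1_rep t v h" by (auto simp: Xu_set_def)
    from L1_norm_nonneg[OF L1_rep_diff[OF this]] show ?thesis by (simp add: Xu_dist_def)
  qed (auto simp: Xu_dist_def)
  show "Xu_dist t u v = Xu_dist t v u"
    unfolding Xu_dist_def by (simp add: L1_norm_minus[of t u v] mdist_commute conj_commute)
next
  fix u v :: "real \<Rightarrow> (real^'n \<Rightarrow> real) \<Rightarrow> real"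
  assume uv: "u \<in> Xu_set t" "v \<in> Xu_set t"
  then obtain f h where fh: "L1_rep t u f" "L1_rep t v h" by (auto simp: Xu_set_def)
  have sp: "u \<in> mspace (cfunspace (top_of_set {0..t}) Hm1)" "v \<in> mspace (cfunspace (top_of_set {0..t}) Hm1)"
    using uv unfolding Xu_set_def by blast+
  show "(Xu_dist t u v = 0) = (u = v)"
  proof
    assume "Xu_dist t u v = 0"
    then have "mdist (cfunspace (top_of_set {0..t}) Hm1) u v = 0"
      using uv L1_norm_nonneg[OF L1_rep_diff[OF fh]] mdist_nonneg[of "cfunspace (top_of_set {0..t}) Hm1" u v]
      unfolding Xu_dist_def by (smt (verit))
    then show "u = v" using mdist_zero[OF sp] by simp
  next
    assume eq: "u = v"
    have "L1_rep t (\<lambda>s g. u s g - v s g) (\<lambda>z. 0)"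
      using L1_rep_lin[OF fh(1) fh(1), of 0 0] eq by simp
    from L1_norm_le[OF this] L1_norm_nonneg[OF this] have "L1_norm t (\<lambda>s g. u s g - v s g) = 0"
      by (simp add: set_lebesgue_integral_def)
    then show "Xu_dist t u v = 0" using eq mdist_zero[OF sp] unfolding Xu_dist_def by simp
  qed
next
  fix u v w :: "real \<Rightarrow> (real^'n \<Rightarrow> real) \<Rightarrow> real"
  assume *: "u \<in> Xu_set t" "v \<in> Xu_set t" "w \<in> Xu_set t"
  then obtain f h k where r: "L1_rep t u f" "L1_rep t v h" "L1_rep t w k"
    by (auto simp: Xu_set_def)
  have "L1_norm t (\<lambda>s g. u s g - w s g) \<le>
      L1_norm t (\<lambda>s g. u s g - v s g) + L1_norm t (\<lambda>s g. v s g - w s g)"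
    using L1_norm_triangle[OF L1_rep_diff[OF r(1,2)] L1_rep_diff[OF r(2,3)]] by simp
  moreover have "mdist (cfunspace (top_of_set {0..t}) Hm1) u w \<le>
      mdist (cfunspace (top_of_set {0..t}) Hm1) u v + mdist (cfunspace (top_of_set {0..t}) Hm1) v w"
    using * unfolding Xu_set_def by (intro mdist_triangle) blast+
  ultimately show "Xu_dist t u w \<le> Xu_dist t u v + Xu_dist t v w"
    using * unfolding Xu_dist_def by simp
qed

lemma mspace_Xu [simp]: "mspace (Xu t) = Xu_set t"
  and mdist_Xu [simp]: "mdist (Xu t) = Xu_dist t"
  by (simp_all add: Xu_def Metric_space.mspace_metric Metric_space.mdist_metric Metric_space_Xu)

section \<open>Laws on topological spaces\<close>

definition borel_of :: "'a topology \<Rightarrow> 'a measure" where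
  "borel_of S = sigma (topspace S) {U. openin S U}"

text \<open>The map \<open>Y\<close> need only be \<open>S\<close>-valued almost surely.\<close>

definition has_law :: "'a measure \<Rightarrow> 'b topology \<Rightarrow> ('a \<Rightarrow> 'b) \<Rightarrow> 'b measure \<Rightarrow> bool" where
  "has_law M S Y \<mu> \<longleftrightarrow> prob_space \<mu> \<and> sets \<mu> = sets (borel_of S) \<and>
     (\<forall>E\<in>sets (borel_of S). {\<omega>\<in>space M. Y \<omega> \<in> E} \<in> sets M \<and>
        emeasure M {\<omega>\<in>space M. Y \<omega> \<in> E} = emeasure \<mu> E)"

definition weakly_converges :: "'b topology \<Rightarrow> (nat \<Rightarrow> 'b measure) \<Rightarrow> 'b measure \<Rightarrow> bool" where
  "weakly_converges S \<mu>n \<mu> \<longleftrightarrow>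
     (\<forall>f. continuous_map S euclideanreal f \<and> bounded (f ` topspace S) \<longrightarrow>
        (\<lambda>n. integral\<^sup>L (\<mu>n n) f) \<longlonglongrightarrow> integral\<^sup>L \<mu> f)"

section \<open>Stochastic bases and Wiener processes\<close>

definition stochastic_basis :: "'a measure \<Rightarrow> (real \<Rightarrow> 'a measure) \<Rightarrow> bool" where
  "stochastic_basis M F \<longleftrightarrow> prob_space M \<and> complete_measure M \<and>
     (\<forall>t\<ge>0. subalgebra M (F t)) \<and>
     (\<forall>s t. 0 \<le> s \<and> s \<le> t \<longrightarrow> sets (F s) \<subseteq> sets (F t)) \<and>
     null_sets M \<subseteq> sets (F 0) \<and>
     (\<forall>t\<ge>0. sets (F t) = (\<Inter>s\<in>{t<..}. sets (F s)))"

text \<open>\<open>I\<close> is the time set, either \<open>[0,\<infinity>)\<close> or \<open>[0,T]\<close>.\<close>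

definition wiener_process ::
  "'a measure \<Rightarrow> real set \<Rightarrow> (real \<Rightarrow> 'a measure) \<Rightarrow> (real \<Rightarrow> 'a \<Rightarrow> real) \<Rightarrow> bool" where
  "wiener_process M I F \<beta> \<longleftrightarrow>
     (\<forall>t\<in>I. \<beta> t \<in> borel_measurable (F t)) \<and>
     (AE \<omega> in M. \<beta> 0 \<omega> = 0) \<and>
     (AE \<omega> in M. continuous_on I (\<lambda>t. \<beta> t \<omega>)) \<and>
     (\<forall>s\<in>I. \<forall>t\<in>I. s < t \<longrightarrow>
        distributed M lborel (\<lambda>\<omega>. \<beta> t \<omega> - \<beta> s \<omega>) (normal_density 0 (sqrt (t - s))) \<and>
        prob_space.indep_set M (sets (F s))
          {(\<lambda>\<omega>. \<beta> t \<omega> - \<beta> s \<omega>) -` E \<inter> space M | E. E \<in> sets borel})"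

text \<open>Orthonormal systems and the associated series are indexed by \<open>k \<ge> 1\<close>; the value at index 0
  is irrelevant.\<close>

definition complete_orthonormal_system :: "(nat \<Rightarrow> 'u::{real_inner,complete_space}) \<Rightarrow> bool" where
  "complete_orthonormal_system e \<longleftrightarrow>
     (\<forall>i\<ge>1. \<forall>j\<ge>1. e i \<bullet> e j = (if i = j then 1 else 0)) \<and>
     closure (span (e ` {1..})) = UNIV"

text \<open>\<open>J\<close> is the inclusion of the Hilbert space spanned by \<open>e\<close> into the larger space of all
  series \<open>\<Sum>k\<ge>1. \<alpha> k e k\<close> with \<open>\<Sum>k\<ge>1. \<alpha> k\<^sup>2 / k\<^sup>2 < \<infinity>\<close>, the square root of this sum being the norm.\<close>

definition enlarged_space ::
  "(nat \<Rightarrow> 'u::{real_inner,complete_space}) \<Rightarrow> ('u \<Rightarrow> 'w::banach) \<Rightarrow> bool" where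
  "enlarged_space e J \<longleftrightarrow> bounded_linear J \<and>
     (\<forall>\<alpha>. (\<lambda>k. (\<alpha> k)\<^sup>2 / (real k)\<^sup>2) summable_on {1..} \<longrightarrow>
        (\<exists>v. (\<lambda>n. \<Sum>k=1..n. \<alpha> k *\<^sub>R J (e k)) \<longlonglongrightarrow> v \<and>
             (norm v)\<^sup>2 = (\<Sum>\<^sub>\<infinity>k\<in>{1..}. (\<alpha> k)\<^sup>2 / (real k)\<^sup>2))) \<and>
     (\<forall>v. \<exists>\<alpha>. (\<lambda>k. (\<alpha> k)\<^sup>2 / (real k)\<^sup>2) summable_on {1..} \<and>
        (\<lambda>n. \<Sum>k=1..n. \<alpha> k *\<^sub>R J (e k)) \<longlonglongrightarrow> v)"

definition cylindrical_wiener_process ::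
  "'a measure \<Rightarrow> real set \<Rightarrow> (real \<Rightarrow> 'a measure) \<Rightarrow> (nat \<Rightarrow> 'u) \<Rightarrow> ('u \<Rightarrow> 'w::banach) \<Rightarrow>
   (nat \<Rightarrow> real \<Rightarrow> 'a \<Rightarrow> real) \<Rightarrow> (real \<Rightarrow> 'a \<Rightarrow> 'w) \<Rightarrow> bool" where
  "cylindrical_wiener_process M I F e J \<beta> W \<longleftrightarrow>
     (\<forall>k\<ge>1. wiener_process M I F (\<beta> k)) \<and>
     prob_space.indep_vars M (\<lambda>_. PiM I (\<lambda>_. borel)) (\<lambda>k \<omega>. \<lambda>t\<in>I. \<beta> k t \<omega>) {1..} \<and>
     (AE \<omega> in M. \<forall>t\<in>I. (\<lambda>n. \<Sum>k=1..n. \<beta> k t \<omega> *\<^sub>R J (e k)) \<longlonglongrightarrow> W t \<omega>)"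

definition augmented_filtration ::
  "'b measure \<Rightarrow> ('b \<Rightarrow> real \<Rightarrow> (real^'n \<Rightarrow> real) \<Rightarrow> real) \<Rightarrow> ('b \<Rightarrow> real \<Rightarrow> 'w::banach) \<Rightarrow>
   real \<Rightarrow> 'b measure" where
  "augmented_filtration M u W t = sigma (space M)
     ({(\<lambda>\<omega>. (restrict (u \<omega>) {0..t}, restrict (W \<omega>) {0..t})) -` E \<inter> space M | E.
        E \<in> sets (borel_of (X_topology t))} \<union> null_sets M)"

section \<open>Stochastic integration\<close>

definition predictable_algebra ::
  "'a measure \<Rightarrow> (real \<Rightarrow> 'a measure) \<Rightarrow> real \<Rightarrow> (real \<times> 'a) measure" where
  "predictable_algebra M F T = sigma ({0..T} \<times> space M)
     ({{0} \<times> E | E. E \<in> sets (F 0)} \<union>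
      {{s<..t} \<times> E | s t E. 0 \<le> s \<and> s \<le> t \<and> t \<le> T \<and> E \<in> sets (F s)})"

text \<open>A triple \<open>(a, b, \<xi>)\<close> stands for the process \<open>\<xi>\<close> times the indicator of \<open>(a,b]\<close>.\<close>

definition elementary ::
  "(real \<Rightarrow> 'a measure) \<Rightarrow> real \<Rightarrow> (real \<times> real \<times> ('a \<Rightarrow> real)) list \<Rightarrow> bool" where
  "elementary F T ps \<longleftrightarrow> (\<forall>(a, b, \<xi>)\<in>set ps. 0 \<le> a \<and> a \<le> b \<and> b \<le> T \<and>
     \<xi> \<in> borel_measurable (F a) \<and> bounded (\<xi> ` space (F a)))"

definition elementary_val ::
  "(real \<times> real \<times> ('a \<Rightarrow> real)) list \<Rightarrow> real \<Rightarrow> 'a \<Rightarrow> real" where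
  "elementary_val ps t \<omega> = (\<Sum>(a, b, \<xi>)\<leftarrow>ps. \<xi> \<omega> * indicator {a<..b} t)"

definition elementary_int ::
  "(real \<Rightarrow> 'a \<Rightarrow> real) \<Rightarrow> (real \<times> real \<times> ('a \<Rightarrow> real)) list \<Rightarrow> real \<Rightarrow> 'a \<Rightarrow> real" where
  "elementary_int \<beta> ps t \<omega> = (\<Sum>(a, b, \<xi>)\<leftarrow>ps. \<xi> \<omega> * (\<beta> (min t b) \<omega> - \<beta> (min t a) \<omega>))"

text \<open>\<open>S\<close> is (a continuous version of) the Ito integral process \<open>\<integral>\<^sub>0\<^sup>t f d\<beta>\<close> of the square integrable
  predictable process \<open>f\<close>.\<close>

definition ito_integral ::
  "'a measure \<Rightarrow> (real \<Rightarrow> 'a measure) \<Rightarrow> real \<Rightarrow> (real \<Rightarrow> 'a \<Rightarrow> real) \<Rightarrow>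
   (real \<Rightarrow> 'a \<Rightarrow> real) \<Rightarrow> (real \<Rightarrow> 'a \<Rightarrow> real) \<Rightarrow> bool" where
  "ito_integral M F T \<beta> f S \<longleftrightarrow>
     (\<lambda>(t, \<omega>). f t \<omega>) \<in> borel_measurable (predictable_algebra M F T) \<and>
     (\<forall>t\<in>{0..T}. S t \<in> borel_measurable (F t)) \<and>
     (AE \<omega> in M. continuous_on {0..T} (\<lambda>t. S t \<omega>)) \<and>
     (\<exists>ps. (\<forall>n. elementary F T (ps n)) \<and>
       (\<lambda>n. \<integral>\<^sup>+\<omega>. (\<integral>\<^sup>+t\<in>{0..T}. ennreal ((elementary_val (ps n) t \<omega> - f t \<omega>)\<^sup>2) \<partial>lborel) \<partial>M)
          \<longlonglongrightarrow> 0 \<and>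
       (\<forall>t\<in>{0..T}. (\<lambda>n. \<integral>\<^sup>+\<omega>. ennreal ((elementary_int \<beta> (ps n) t \<omega> - S t \<omega>)\<^sup>2) \<partial>M)
          \<longlonglongrightarrow> 0))"

text \<open>\<open>S\<close> is the integral against \<open>W = \<Sum>k. \<beta> k e k\<close> of a process \<open>\<Psi>\<close> of linear functionals.\<close>

definition cylindrical_integral ::
  "'a measure \<Rightarrow> (real \<Rightarrow> 'a measure) \<Rightarrow> real \<Rightarrow> (nat \<Rightarrow> 'u) \<Rightarrow> (nat \<Rightarrow> real \<Rightarrow> 'a \<Rightarrow> real) \<Rightarrow>
   (real \<Rightarrow> 'a \<Rightarrow> 'u \<Rightarrow> real) \<Rightarrow> (real \<Rightarrow> 'a \<Rightarrow> real) \<Rightarrow> bool" where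
  "cylindrical_integral M F T e \<beta> \<Psi> S \<longleftrightarrow>
     (\<forall>t\<in>{0..T}. S t \<in> borel_measurable (F t)) \<and>
     (AE \<omega> in M. continuous_on {0..T} (\<lambda>t. S t \<omega>)) \<and>
     (\<exists>Sk. (\<forall>k\<ge>1. ito_integral M F T (\<beta> k) (\<lambda>t \<omega>. \<Psi> t \<omega> (e k)) (Sk k)) \<and>
       (\<forall>t\<in>{0..T}. (\<lambda>n. \<integral>\<^sup>+\<omega>. ennreal (((\<Sum>k=1..n. Sk k t \<omega>) - S t \<omega>)\<^sup>2) \<partial>M) \<longlonglongrightarrow> 0))"

section \<open>Coefficients and their approximations\<close>

definition polynomial_growth :: "(real \<Rightarrow> 'b::real_normed_vector) \<Rightarrow> bool" where
  "polynomial_growth b \<longleftrightarrow> (\<exists>K m. \<forall>\<xi>. norm (b \<xi>) \<le> K * (1 + \<bar>\<xi>\<bar> ^ m))"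

text \<open>For periodic \<open>g k\<close> the Lipschitz-type bound with the Euclidean distance of all lifts
  \<open>x\<close>, \<open>y\<close> is the bound with the distance of the torus.\<close>

definition noise_coefficients ::
  "(nat \<Rightarrow> real^'n \<Rightarrow> real \<Rightarrow> real) \<Rightarrow> real \<Rightarrow> (real \<Rightarrow> real) \<Rightarrow> bool" where
  "noise_coefficients g L h \<longleftrightarrow>
     (\<forall>k\<ge>1. continuous_on UNIV (\<lambda>(x, \<xi>). g k x \<xi>) \<and> (\<forall>\<xi>. periodic (\<lambda>x. g k x \<xi>))) \<and>
     (\<forall>x \<xi>. (\<lambda>k. \<bar>g k x \<xi>\<bar>\<^sup>2) summable_on {1..} \<and>
        (\<Sum>\<^sub>\<infinity>k\<in>{1..}. \<bar>g k x \<xi>\<bar>\<^sup>2) \<le> L * (1 + \<bar>\<xi>\<bar>\<^sup>2)) \<and>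
     (\<forall>x y \<xi> \<zeta>. (\<lambda>k. \<bar>g k x \<xi> - g k y \<zeta>\<bar>\<^sup>2) summable_on {1..} \<and>
        (\<Sum>\<^sub>\<infinity>k\<in>{1..}. \<bar>g k x \<xi> - g k y \<zeta>\<bar>\<^sup>2) \<le> L * ((norm (x - y))\<^sup>2 + \<bar>\<xi> - \<zeta>\<bar> * h \<bar>\<xi> - \<zeta>\<bar>)) \<and>
     continuous_on {0..} h \<and> mono_on {0..} h \<and>
     (\<exists>C. \<exists>\<alpha>>0. \<forall>\<delta>. 0 \<le> \<delta> \<and> \<delta> < 1 \<longrightarrow> h \<delta> \<le> C * \<delta> powr \<alpha>)"

definition noise_operator ::
  "(nat \<Rightarrow> 'u::{real_inner,complete_space}) \<Rightarrow> (nat \<Rightarrow> real^'n \<Rightarrow> real \<Rightarrow> real) \<Rightarrow>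
   (real^'n \<Rightarrow> real) \<Rightarrow> 'u \<Rightarrow> real^'n \<Rightarrow> real" where
  "noise_operator e g z v x = (\<Sum>\<^sub>\<infinity>k\<in>{1..}. (v \<bullet> e k) * g k x (z x))"

definition approx_identity_real :: "(real \<Rightarrow> real \<Rightarrow> real) \<Rightarrow> bool" where
  "approx_identity_real \<psi> \<longleftrightarrow>
     (\<forall>\<epsilon>\<in>{0<..<1}. smooth (\<psi> \<epsilon>) \<and> (\<forall>\<xi>. 0 \<le> \<psi> \<epsilon> \<xi>) \<and>
        (\<exists>R. \<forall>\<xi>. R < \<bar>\<xi>\<bar> \<longrightarrow> \<psi> \<epsilon> \<xi> = 0) \<and> (LINT \<xi>|lborel. \<psi> \<epsilon> \<xi>) = 1) \<and>
     (\<forall>\<delta>>0. ((\<lambda>\<epsilon>. LINT \<xi>:{\<xi>. \<delta> \<le> \<bar>\<xi>\<bar>}|lborel. \<psi> \<epsilon> \<xi>) \<longlongrightarrow> 0) (at_right 0))"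

text \<open>Concentration at the origin of the torus is expressed on the cell \<open>[-1/2,1/2]\<^sup>N\<close>, where the
  distance to the origin is the Euclidean norm.\<close>

definition approx_identity_torus :: "(real \<Rightarrow> (real^'n) \<times> real \<Rightarrow> real) \<Rightarrow> bool" where
  "approx_identity_torus \<phi> \<longleftrightarrow>
     (\<forall>\<epsilon>\<in>{0<..<1}. smooth (\<phi> \<epsilon>) \<and> (\<forall>\<xi>. periodic (\<lambda>x. \<phi> \<epsilon> (x, \<xi>))) \<and> (\<forall>z. 0 \<le> \<phi> \<epsilon> z) \<and>
        (\<exists>R. \<forall>x \<xi>. R < \<bar>\<xi>\<bar> \<longrightarrow> \<phi> \<epsilon> (x, \<xi>) = 0) \<and> (LINT z:cell \<times> UNIV|lborel. \<phi> \<epsilon> z) = 1) \<and>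
     (\<forall>\<delta>>0. ((\<lambda>\<epsilon>. LINT z:{z. fst z \<in> cbox ((- 1/2) *\<^sub>R 1) ((1/2) *\<^sub>R 1) \<and> \<delta> \<le> norm z}|lborel. \<phi> \<epsilon> z)
        \<longlongrightarrow> 0) (at_right 0))"

definition B_approx ::
  "(real \<Rightarrow> real) \<Rightarrow> (real \<Rightarrow> real \<Rightarrow> real) \<Rightarrow> (real \<Rightarrow> real^'n) \<Rightarrow> real \<Rightarrow> real \<Rightarrow> real^'n" where
  "B_approx \<kappa> \<psi> B \<epsilon> \<xi> = (\<chi> i. (LINT \<zeta>|lborel. B \<zeta> $ i * \<psi> \<epsilon> (\<xi> - \<zeta>)) * \<kappa> (\<epsilon> * \<xi>))"

definition g_approx ::
  "(real \<Rightarrow> real) \<Rightarrow> (real \<Rightarrow> (real^'n) \<times> real \<Rightarrow> real) \<Rightarrow> (nat \<Rightarrow> real^'n \<Rightarrow> real \<Rightarrow> real) \<Rightarrow>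
   real \<Rightarrow> nat \<Rightarrow> real^'n \<Rightarrow> real \<Rightarrow> real" where
  "g_approx \<kappa> \<phi> g \<epsilon> k x \<xi> =
     (if int k \<le> \<lfloor>1 / \<epsilon>\<rfloor>
      then (LINT (y, \<zeta>):cell \<times> UNIV|lborel. g k y \<zeta> * \<phi> \<epsilon> (x - y, \<xi> - \<zeta>)) * \<kappa> (\<epsilon> * \<xi>)
      else 0)"

definition A_approx :: "(real^'n \<Rightarrow> real^'n^'n) \<Rightarrow> real \<Rightarrow> real^'n \<Rightarrow> real^'n^'n" where
  "A_approx A \<epsilon> x = A x + \<epsilon> *\<^sub>R mat 1"

section \<open>The stochastic equation\<close>

text \<open>\<open>u t \<omega>\<close> is a smooth function on the torus, so the equation is imposed pointwise in the space
  variable; \<open>\<Phi> z v x\<close> is the value at \<open>x\<close> of the noise operator at state \<open>z\<close> applied to \<open>v\<close>.\<close>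

definition smooth_solution ::
  "'a measure \<Rightarrow> (real \<Rightarrow> 'a measure) \<Rightarrow> real \<Rightarrow> (nat \<Rightarrow> 'u) \<Rightarrow> (nat \<Rightarrow> real \<Rightarrow> 'a \<Rightarrow> real) \<Rightarrow>
   (real \<Rightarrow> real^'n) \<Rightarrow> (real^'n \<Rightarrow> real^'n^'n) \<Rightarrow>
   ((real^'n \<Rightarrow> real) \<Rightarrow> 'u \<Rightarrow> real^'n \<Rightarrow> real) \<Rightarrow> ('a \<Rightarrow> real^'n \<Rightarrow> real) \<Rightarrow>
   (real \<Rightarrow> 'a \<Rightarrow> real^'n \<Rightarrow> real) \<Rightarrow> bool" where
  "smooth_solution M F T e \<beta> B A \<Phi> u0 u \<longleftrightarrow>
     (\<lambda>(t, \<omega>). u t \<omega>) \<in> measurable (predictable_algebra M F T) (borel_of Cinf_topology) \<and>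
     (AE \<omega> in M. u 0 \<omega> = u0 \<omega>) \<and>
     (\<forall>x. \<exists>S. cylindrical_integral M F T e \<beta> (\<lambda>t \<omega> v. \<Phi> (u t \<omega>) v x) S \<and>
       (AE \<omega> in M.
          set_integrable lborel {0..T} (\<lambda>s. divergence (\<lambda>y. B (u s \<omega> y)) x) \<and>
          set_integrable lborel {0..T} (\<lambda>s. divergence (\<lambda>y. A y *v grad (u s \<omega>) y) x) \<and>
          (\<forall>t\<in>{0..T}.
             u t \<omega> x + (LINT s:{0..t}|lborel. divergence (\<lambda>y. B (u s \<omega> y)) x) =
             u0 \<omega> x + (LINT s:{0..t}|lborel. divergence (\<lambda>y. A y *v grad (u s \<omega>) y) x) + S t \<omega>)))"

text \<open>The path on \<open>[0,T]\<close> of a process of smooth functions, viewed in the space of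
  distribution-valued paths.\<close>

definition distr_path :: "real \<Rightarrow> (real \<Rightarrow> 'a \<Rightarrow> real^'n \<Rightarrow> real) \<Rightarrow> 'a \<Rightarrow>
    real \<Rightarrow> (real^'n \<Rightarrow> real) \<Rightarrow> real" where
  "distr_path T u \<omega> = (\<lambda>t\<in>{0..T}. distr_of (u t \<omega>))"

end

theory Submission
  imports Defs
begin

text \<open>The coordinates of \<open>W'\<close> in the series \<open>\<Sum>k. \<alpha> k e k\<close> are continuous functions of \<open>W'\<close>. The law of \<open>W'\<close> is
  the common law of the noise in all approximations, which gives the Gaussian increments and the mutual
  independence of the coordinates. For every approximation the past of the pair (solution, noise) up to
  time \<open>s\<close> is independent of the later increments of the noise, so expectations of products of bounded
  continuous functions of the past and of an increment factorize. The factorization survives weak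
  convergence and extends to closed sets, which generate the past up to null sets.
  The point that needs work is that the past of the approximate solution, as a random element of the path
  space, is adapted: since the path space is separable, it suffices to treat preimages of closed balls, and
  the distances to their centres are computed from countably many real random variables, the \<open>L\<^sup>1\<close> part being a double
  integral because a density is determined by its integrals against smooth functions.\<close>

section \<open>Separability by labelling\<close>

text \<open>The coordinates are continuous because the norm of the larger space is the weighted
  square sum of the coefficients: |\<alpha> k| \<le> k * norm v, which also makes them unique.
  Independence of an increment from the past of the pair is not visible in the law of the noise
  alone. It is a property of the joint law of the restricted pair and the increment, and both of
  these are continuous functions of the pair, so it can be stated for
  \<open>\<mu> (\<epsilon> n)\<close> and passed to \<open>\<mu>lim\<close>. The obstacle in the
  approximations is a mismatch of sigma-algebras: \<open>has_law\<close> gives measurability of the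
  path with respect to \<open>M\<close>, whereas the increment is known to be independent of
  \<open>F s\<close>. Predictability as a process of smooth functions has to become
  \<open>F s\<close>-measurability into a space whose Borel sets come from an L^1 plus H^-1 metric.
  As the path lies in that space only almost surely, the argument runs off a null set; completeness
  of \<open>M\<close> and the null sets contained in \<open>F 0\<close> then absorb the exceptional
  set.\<close>

text \<open>Countably many labels such that points with equal labels are close. For a metric this is
  separability, but it passes to subsets and to pull-backs without choosing new dense sets.\<close>

definition label_separable :: "'a set \<Rightarrow> ('a \<Rightarrow> 'a \<Rightarrow> real) \<Rightarrow> bool" where
  "label_separable P d \<longleftrightarrow>
     (\<forall>\<epsilon>>0. \<exists>\<phi>::'a \<Rightarrow> nat. \<forall>x\<in>P. \<forall>y\<in>P. \<phi> x = \<phi> y \<longrightarrow> d x y < \<epsilon>)"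

text \<open>Labels in any countable type can be encoded as numbers. This is convenient when a
  distance is a sum of two parts, each with its own label.\<close>

lemma label_separableI:
  assumes "\<And>\<epsilon>. \<epsilon> > 0 \<Longrightarrow> \<exists>\<phi>::'a \<Rightarrow> 'c::countable. \<forall>x\<in>P. \<forall>y\<in>P. \<phi> x = \<phi> y \<longrightarrow> d x y < \<epsilon>"
  shows "label_separable P d"
  unfolding label_separable_def
proof (intro allI impI)
  fix \<epsilon> :: real assume "\<epsilon> > 0"
  with assms obtain \<phi> :: "'a \<Rightarrow> 'c" where \<phi>: "\<forall>x\<in>P. \<forall>y\<in>P. \<phi> x = \<phi> y \<longrightarrow> d x y < \<epsilon>" by blast
  show "\<exists>\<phi>::'a \<Rightarrow> nat. \<forall>x\<in>P. \<forall>y\<in>P. \<phi> x = \<phi> y \<longrightarrow> d x y < \<epsilon>"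
    by (rule exI[of _ "\<lambda>x. to_nat (\<phi> x)"]) (use \<phi> in auto)
qed

lemma label_separableE:
  assumes "label_separable P d" "\<epsilon> > 0"
  obtains \<phi> :: "'a \<Rightarrow> nat" where "\<And>x y. x \<in> P \<Longrightarrow> y \<in> P \<Longrightarrow> \<phi> x = \<phi> y \<Longrightarrow> d x y < \<epsilon>"
  using assms unfolding label_separable_def by meson

text \<open>One representative is chosen for every label in use at every scale 1/(n+1). A point and
  the representative of its label are closer than that scale, and there are only countably many
  pairs of scale and label.\<close>

lemma label_separable_dense:
  assumes "label_separable P d"
  obtains D where "countable D" "D \<subseteq> P" "\<And>x \<epsilon>. x \<in> P \<Longrightarrow> \<epsilon> > 0 \<Longrightarrow> \<exists>y\<in>D. d x y < \<epsilon>"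
proof -
  have "\<forall>n. \<exists>\<phi>::'a \<Rightarrow> nat. \<forall>x\<in>P. \<forall>y\<in>P. \<phi> x = \<phi> y \<longrightarrow> d x y < inverse (real (Suc n))"
    using assms unfolding label_separable_def by simp
  then obtain \<phi> :: "nat \<Rightarrow> 'a \<Rightarrow> nat"
    where \<phi>: "\<And>n x y. x \<in> P \<Longrightarrow> y \<in> P \<Longrightarrow> \<phi> n x = \<phi> n y \<Longrightarrow> d x y < inverse (real (Suc n))"
    by metis
  define c where "c = (\<lambda>(n, k). SOME x. x \<in> P \<and> \<phi> n x = k)"
  define I where "I = {(n, k). \<exists>x\<in>P. \<phi> n x = k}"
  have c: "c (n, k) \<in> P \<and> \<phi> n (c (n, k)) = k" if "(n, k) \<in> I" for n k
    unfolding c_def using that someI_ex[of "\<lambda>x. x \<in> P \<and> \<phi> n x = k"] by (auto simp: I_def)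
  show thesis
  proof (rule that[of "c ` I"])
    show "c ` I \<subseteq> P" using c by auto
    fix x and \<epsilon> :: real assume x: "x \<in> P" "\<epsilon> > 0"
    obtain n where n: "inverse (real (Suc n)) < \<epsilon>" using reals_Archimedean[OF x(2)] by auto
    have I: "(n, \<phi> n x) \<in> I" using x by (auto simp: I_def)
    from c[OF this] x(1) have "d x (c (n, \<phi> n x)) < inverse (real (Suc n))" by (intro \<phi>) auto
    with n I show "\<exists>y\<in>c ` I. d x y < \<epsilon>"
      by (intro bexI[of _ "c (n, \<phi> n x)"]) auto
  qed simp
qed

text \<open>A point is labelled by the index of a reference point within \<epsilon>/2. The reference
  points may lie outside \<open>P\<close>; \<open>tri\<close> is the triangle inequality through
  such a point.\<close>

lemma label_separable_denseI:
  fixes d' :: "'a \<Rightarrow> 'b \<Rightarrow> real"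
  assumes D: "countable D" and dense: "\<And>x \<epsilon>. x \<in> P \<Longrightarrow> \<epsilon> > 0 \<Longrightarrow> \<exists>q\<in>D. d' x q < \<epsilon>"
    and tri: "\<And>x y q. x \<in> P \<Longrightarrow> y \<in> P \<Longrightarrow> q \<in> D \<Longrightarrow> d x y \<le> d' x q + d' y q"
  shows "label_separable P d"
proof (rule label_separableI)
  fix \<epsilon> :: real assume \<epsilon>: "\<epsilon> > 0"
  define c where "c x = (SOME q. q \<in> D \<and> d' x q < \<epsilon> / 2)" for x
  have c: "c x \<in> D" "d' x (c x) < \<epsilon> / 2" if "x \<in> P" for x
    using someI_ex[of "\<lambda>q. q \<in> D \<and> d' x q < \<epsilon> / 2"] dense[OF that, of "\<epsilon> / 2"] \<epsilon>
    by (auto simp: c_def)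
  show "\<exists>\<phi>::'a \<Rightarrow> nat. \<forall>x\<in>P. \<forall>y\<in>P. \<phi> x = \<phi> y \<longrightarrow> d x y < \<epsilon>"
  proof (intro exI ballI impI)
    fix x y assume xy: "x \<in> P" "y \<in> P" "to_nat_on D (c x) = to_nat_on D (c y)"
    then have "c x = c y" using c D by simp
    then show "d x y < \<epsilon>" using tri[OF xy(1,2) c(1)[OF xy(1)]] c(2)[OF xy(1)] c(2)[OF xy(2)] by simp
  qed
qed

text \<open>A path is labelled by a mesh fine enough for its modulus of continuity together with the labels
  of its values on the mesh.\<close>

lemma label_paths:
  fixes K :: "'k::metric_space set" and P :: "('k \<Rightarrow> 'b) set"
  assumes K: "compact K" and Q: "label_separable Q d"
    and PQ: "\<And>f x. f \<in> P \<Longrightarrow> x \<in> K \<Longrightarrow> f x \<in> Q"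
    and uc: "\<And>f \<epsilon>. f \<in> P \<Longrightarrow> \<epsilon> > 0 \<Longrightarrow> \<exists>\<delta>>0. \<forall>x\<in>K. \<forall>y\<in>K. dist x y < \<delta> \<longrightarrow> d (f x) (f y) < \<epsilon>"
    and tri: "\<And>x y z. x \<in> Q \<Longrightarrow> y \<in> Q \<Longrightarrow> z \<in> Q \<Longrightarrow> d x z \<le> d x y + d y z"
    and sym: "\<And>x y. x \<in> Q \<Longrightarrow> y \<in> Q \<Longrightarrow> d x y = d y x"
    and \<epsilon>: "\<epsilon> > 0"
  shows "\<exists>\<phi>::('k \<Rightarrow> 'b) \<Rightarrow> nat. \<forall>f\<in>P. \<forall>g\<in>P. \<phi> f = \<phi> g \<longrightarrow> (\<forall>x\<in>K. d (f x) (g x) < \<epsilon>)"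
proof -
  \<comment> \<open>Finite nets of mesh 1/(m+1), kept as lists so that the labels along a net form a
    list, hence an element of a countable type.\<close>
  have "\<exists>xs. set xs \<subseteq> K \<and> (\<forall>x\<in>K. \<exists>y\<in>set xs. dist x y < inverse (real (Suc m)))" for m
  proof -
    have "K \<subseteq> (\<Union>x\<in>K. ball x (inverse (real (Suc m))))" by auto
    then obtain C where C: "C \<subseteq> K" "finite C" "K \<subseteq> (\<Union>x\<in>C. ball x (inverse (real (Suc m))))"
      using compactE_image[OF K, of K "\<lambda>x. ball x (inverse (real (Suc m)))"] by (metis open_ball)
    obtain xs where "set xs = C" using finite_list[OF C(2)] by blast
    moreover have "\<exists>y\<in>C. dist x y < inverse (real (Suc m))" if "x \<in> K" for x
    proof -
      from that C(3) obtain y where "y \<in> C" "x \<in> ball y (inverse (real (Suc m)))" by blast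
      then show ?thesis by (intro bexI[of _ y]) (simp_all add: dist_commute)
    qed
    ultimately show ?thesis using C(1) by blast
  qed
  then obtain xs where xs: "\<And>m. set (xs m) \<subseteq> K"
    "\<And>m x. x \<in> K \<Longrightarrow> \<exists>y\<in>set (xs m). dist x y < inverse (real (Suc m))" by metis
  obtain \<phi> :: "'b \<Rightarrow> nat" where \<phi>: "\<And>x y. x \<in> Q \<Longrightarrow> y \<in> Q \<Longrightarrow> \<phi> x = \<phi> y \<Longrightarrow> d x y < \<epsilon> / 3"
    using label_separableE[OF Q, of "\<epsilon> / 3"] \<epsilon> by auto
  have "\<exists>m. \<forall>x\<in>K. \<forall>y\<in>K. dist x y < inverse (real (Suc m)) \<longrightarrow> d (f x) (f y) < \<epsilon> / 3" if f: "f \<in> P" for f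
  proof -
    obtain \<delta> where "\<delta> > 0" "\<forall>x\<in>K. \<forall>y\<in>K. dist x y < \<delta> \<longrightarrow> d (f x) (f y) < \<epsilon> / 3"
      using uc[OF f, of "\<epsilon> / 3"] \<epsilon> by auto
    moreover obtain m where "inverse (real (Suc m)) < \<delta>" using reals_Archimedean[OF \<open>\<delta> > 0\<close>] by auto
    ultimately show ?thesis by (meson less_trans)
  qed
  then obtain m where m: "\<And>f x y. f \<in> P \<Longrightarrow> x \<in> K \<Longrightarrow> y \<in> K \<Longrightarrow> dist x y < inverse (real (Suc (m f))) \<Longrightarrow>
      d (f x) (f y) < \<epsilon> / 3" by metis
  show ?thesis
  proof (intro exI ballI impI)
    fix f g x
    assume fg: "f \<in> P" "g \<in> P" "to_nat (m f, map (\<lambda>y. \<phi> (f y)) (xs (m f))) = to_nat (m g, map (\<lambda>y. \<phi> (g y)) (xs (m g)))"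
      and x: "x \<in> K"
    \<comment> \<open>Equal mesh indices make both label lists refer to the same net, so they can be
      compared entry by entry.\<close>
    then have eq: "m f = m g" "map (\<lambda>y. \<phi> (f y)) (xs (m f)) = map (\<lambda>y. \<phi> (g y)) (xs (m f))" by auto
    obtain y where y: "y \<in> set (xs (m f))" "dist x y < inverse (real (Suc (m f)))" using xs(2)[OF x] by blast
    then have yK: "y \<in> K" using xs(1) by blast
    have Qs: "f x \<in> Q" "f y \<in> Q" "g x \<in> Q" "g y \<in> Q" using PQ fg x yK by auto
    have "d (f x) (f y) < \<epsilon> / 3" using m[OF fg(1) x yK y(2)] .
    moreover have "d (f y) (g y) < \<epsilon> / 3" using eq(2) y(1) Qs by (intro \<phi>) auto
    moreover have "d (g y) (g x) < \<epsilon> / 3" using m[OF fg(2) x yK] y(2) eq(1) sym[OF Qs(3,4)] by simp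
    ultimately show "d (f x) (g x) < \<epsilon>"
      using tri[OF Qs(1,2,3)] tri[OF Qs(2,4,3)] by simp
  qed
qed

section \<open>Borel sets of topological spaces\<close>

lemma space_borel_of [simp]: "space (borel_of S) = topspace S"
  by (auto simp: borel_of_def space_measure_of_conv)

lemma sets_borel_of: "sets (borel_of S) = sigma_sets (topspace S) {U. openin S U}"
  unfolding borel_of_def by (rule sets_measure_of) (auto dest: openin_subset)

lemma openin_sets_borel_of: "openin S U \<Longrightarrow> U \<in> sets (borel_of S)"
  by (auto simp: sets_borel_of)

lemma closedin_sets_borel_of: "closedin S C \<Longrightarrow> C \<in> sets (borel_of S)"
  by (metis closedin_def Diff_Diff_Int inf.absorb_iff2 openin_sets_borel_of sets.compl_sets space_borel_of)

text \<open>Closed sets serve as the generator below: they are stable under intersection, and their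
  indicators are pointwise limits of bounded continuous functions.\<close>

lemma sets_borel_of_closed: "sets (borel_of S) = sigma_sets (topspace S) {C. closedin S C}"
proof
  show "sets (borel_of S) \<subseteq> sigma_sets (topspace S) {C. closedin S C}"
    unfolding sets_borel_of
  proof (rule sigma_sets_mono, rule subsetI)
    fix U assume "U \<in> {U. openin S U}"
    then have U: "openin S U" by simp
    have "topspace S - (topspace S - U) \<in> sigma_sets (topspace S) {C. closedin S C}"
      using U by (intro sigma_sets.Compl sigma_sets.Basic) (auto simp: openin_closedin_eq)
    moreover have "topspace S - (topspace S - U) = U" using openin_subset[OF U] by auto
    ultimately show "U \<in> sigma_sets (topspace S) {C. closedin S C}" by simp
  qed
  have "{C. closedin S C} \<subseteq> sets (borel_of S)" by (auto intro: closedin_sets_borel_of)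
  from sets.sigma_sets_subset[OF this]
  show "sigma_sets (topspace S) {C. closedin S C} \<subseteq> sets (borel_of S)" by simp
qed

lemma continuous_map_measurable:
  assumes "continuous_map S T f" shows "f \<in> measurable (borel_of S) (borel_of T)"
  unfolding borel_of_def[of T]
proof (rule measurable_measure_of)
  show "f \<in> space (borel_of S) \<rightarrow> topspace T"
    using assms by (auto simp: continuous_map_def)
  fix U assume "U \<in> {U. openin T U}"
  then have "openin S {x \<in> topspace S. f x \<in> U}" using assms by (auto simp: continuous_map_def)
  moreover have "f -` U \<inter> space (borel_of S) = {x \<in> topspace S. f x \<in> U}" by auto
  ultimately show "f -` U \<inter> space (borel_of S) \<in> sets (borel_of S)"
    by (simp add: openin_sets_borel_of)
qed (auto dest: openin_subset)

lemma borel_of_euclidean [simp]: "borel_of euclidean = borel"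
  by (simp add: borel_of_def borel_def)

text \<open>The functions are max 0 (1 - m * dist(x, C)). They equal 1 on \<open>C\<close>, and off
  \<open>C\<close> they vanish for large m because a point outside a closed set has positive
  distance from it. The bounds 0 and 1 hold at every point of the type, also outside the
  carrier.\<close>

lemma closedin_indicator_limit:
  assumes S: "metrizable_space S" and C: "closedin S C"
  obtains \<gamma> :: "nat \<Rightarrow> 'a \<Rightarrow> real" where "\<And>m. continuous_map S euclideanreal (\<gamma> m)"
    "\<And>m x. 0 \<le> \<gamma> m x" "\<And>m x. \<gamma> m x \<le> 1"
    "\<And>x. x \<in> topspace S \<Longrightarrow> (\<lambda>m. \<gamma> m x) \<longlonglongrightarrow> indicator C x"
proof (cases "C = {}")
  case True
  then show ?thesis by (intro that[of "\<lambda>_ _. 0"]) auto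
next
  case False
  obtain M d where M: "Metric_space M d" and SM: "S = Metric_space.mtopology M d"
    using S by (auto simp: metrizable_space_def)
  interpret Metric_space M d by fact
  have CM: "C \<subseteq> M" using closedin_subset[OF C] by (simp add: SM)
  \<comment> \<open>The distance to \<open>C\<close>. The empty set was treated apart because this
    infimum is meaningful only for nonempty \<open>C\<close>.\<close>
  define f where "f x = (INF c\<in>C. d x c)" for x
  have bdd: "bdd_below ((\<lambda>c. d x c) ` C)" for x by (auto intro!: bdd_belowI[of _ 0])
  have f0: "0 \<le> f x" for x unfolding f_def using False by (intro cINF_greatest) auto
  have f_le: "f x \<le> f y + d x y" if "x \<in> M" "y \<in> M" for x y
  proof -
    have "f x - d x y \<le> d y c" if "c \<in> C" for c
    proof -
      have "f x \<le> d x c" unfolding f_def using that bdd by (intro cINF_lower)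
      also have "\<dots> \<le> d x y + d y c" using \<open>x \<in> M\<close> \<open>y \<in> M\<close> that CM by (intro triangle) auto
      finally show ?thesis by simp
    qed
    then have "f x - d x y \<le> f y" unfolding f_def[of y] using False by (intro cINF_greatest) auto
    then show ?thesis by simp
  qed
  have cf: "continuous_map S euclideanreal f"
    unfolding SM mtopology_of_euclidean[symmetric] mtopology_of_def
  proof (subst metric_continuous_map)
    show "Metric_space (mspace euclidean_metric) (mdist euclidean_metric)" by (rule Metric_space_mspace_mdist)
    show "f ` M \<subseteq> mspace euclidean_metric \<and>
      (\<forall>a\<in>M. \<forall>\<epsilon>>0. \<exists>\<delta>>0. \<forall>x. x \<in> M \<and> d a x < \<delta> \<longrightarrow> mdist euclidean_metric (f a) (f x) < \<epsilon>)"
    proof (simp, intro ballI allI impI)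
      fix a and \<epsilon> :: real assume a: "a \<in> M" "0 < \<epsilon>"
      have "dist (f a) (f x) \<le> d a x" if "x \<in> M" for x
        using f_le[OF a(1) that] f_le[OF that a(1)] by (simp add: dist_real_def commute)
      then show "\<exists>\<delta>>0. \<forall>x. x \<in> M \<and> d a x < \<delta> \<longrightarrow> dist (f a) (f x) < \<epsilon>"
        using a(2) by (meson le_less_trans)
    qed
  qed
  show ?thesis
  proof (rule that[of "\<lambda>m x. max 0 (1 - real m * f x)"])
    fix m
    have "continuous_on UNIV (\<lambda>y. max 0 (1 - real m * y))" by (intro continuous_intros)
    then have "continuous_map euclideanreal euclideanreal (\<lambda>y. max 0 (1 - real m * y))" by simp
    from continuous_map_compose[OF cf this]
    show "continuous_map S euclideanreal (\<lambda>x. max 0 (1 - real m * f x))" by (simp add: o_def)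
  next
    fix x assume "x \<in> topspace S"
    then have x: "x \<in> M" by (simp add: SM)
    show "(\<lambda>m. max 0 (1 - real m * f x)) \<longlonglongrightarrow> indicator C x"
    proof (cases "x \<in> C")
      case True
      have "f x \<le> d x x" unfolding f_def by (intro cINF_lower bdd True)
      then have "f x = 0" using f0[of x] x by simp
      then show ?thesis using True by simp
    next
      case False
      have "openin S (topspace S - C)" using C by (simp add: closedin_def)
      then obtain r where r: "r > 0" "mball x r \<subseteq> topspace S - C"
        using x False unfolding SM openin_mtopology by auto
      have "r \<le> d x c" if "c \<in> C" for c
      proof (rule ccontr)
        assume "\<not> r \<le> d x c"
        then have "c \<in> mball x r" using x that CM by auto
        then show False using r(2) that by blast
      qed
      then have "r \<le> f x" unfolding f_def using \<open>C \<noteq> {}\<close> by (intro cINF_greatest) auto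
      then have fx: "f x > 0" using r by simp
      obtain n where n: "1 < real n * f x" using reals_Archimedean3[OF fx] by blast
      have "max 0 (1 - real m * f x) = 0" if "m \<ge> n" for m
      proof -
        have "real n * f x \<le> real m * f x" using that fx by (intro mult_right_mono) auto
        then show ?thesis using n by simp
      qed
      then have "\<forall>\<^sub>F m in sequentially. max 0 (1 - real m * f x) = 0"
        by (auto simp: eventually_sequentially)
      then show ?thesis using False by (simp add: tendsto_eventually)
    qed
  qed (auto simp: f0)
qed

lemma continuous_map_borel_measurable:
  fixes f :: "'a \<Rightarrow> real"
  assumes "continuous_map S euclideanreal f" "sets M = sets (borel_of S)"
  shows "f \<in> borel_measurable M"
  using continuous_map_measurable[OF assms(1)] measurable_cong_sets[OF assms(2) refl] by auto

text \<open>By dominated convergence the measure of a closed set is a limit of integrals of bounded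
  continuous functions, so the measures agree on an intersection-stable generator.\<close>

lemma prob_eqI_continuous:
  assumes S: "metrizable_space S" and \<mu>: "prob_space \<mu>" "sets \<mu> = sets (borel_of S)"
    and \<nu>: "prob_space \<nu>" "sets \<nu> = sets (borel_of S)"
    and eq: "\<And>f. continuous_map S euclideanreal f \<Longrightarrow> bounded (f ` topspace S) \<Longrightarrow>
      integral\<^sup>L \<mu> f = integral\<^sup>L \<nu> f"
  shows "\<mu> = \<nu>"
proof (rule measure_eqI_generator_eq[where E="{C. closedin S C}" and \<Omega>="topspace S" and A="\<lambda>_. topspace S"])
  interpret \<mu>: prob_space \<mu> by fact
  interpret \<nu>: prob_space \<nu> by fact
  have sp: "space \<mu> = topspace S" "space \<nu> = topspace S"
    using sets_eq_imp_space_eq[OF \<mu>(2)] sets_eq_imp_space_eq[OF \<nu>(2)] by auto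
  show "Int_stable {C. closedin S C}" by (auto simp: Int_stable_def)
  show "{C. closedin S C} \<subseteq> Pow (topspace S)" by (auto dest: closedin_subset)
  show "sets \<mu> = sigma_sets (topspace S) {C. closedin S C}" "sets \<nu> = sigma_sets (topspace S) {C. closedin S C}"
    using \<mu> \<nu> by (auto simp: sets_borel_of_closed)
  show "range (\<lambda>_. topspace S) \<subseteq> {C. closedin S C}" by auto
  fix C assume "C \<in> {C. closedin S C}"
  then have C: "closedin S C" by simp
  obtain \<gamma> :: "nat \<Rightarrow> 'a \<Rightarrow> real" where \<gamma>: "\<And>m. continuous_map S euclideanreal (\<gamma> m)"
    "\<And>m x. 0 \<le> \<gamma> m x" "\<And>m x. \<gamma> m x \<le> 1"
    "\<And>x. x \<in> topspace S \<Longrightarrow> (\<lambda>m. \<gamma> m x) \<longlonglongrightarrow> indicator C x"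
    using closedin_indicator_limit[OF S C] by blast
  have lim: "(\<lambda>m. integral\<^sup>L \<rho> (\<gamma> m)) \<longlonglongrightarrow> integral\<^sup>L \<rho> (indicator C)"
    if \<rho>: "prob_space \<rho>" "sets \<rho> = sets (borel_of S)" for \<rho>
  proof (rule integral_dominated_convergence[where w="\<lambda>_. 1"])
    interpret \<rho>: prob_space \<rho> by fact
    show "integrable \<rho> (\<lambda>_. 1 :: real)" by simp
    show "indicat_real C \<in> borel_measurable \<rho>" using closedin_sets_borel_of[OF C] \<rho>(2) by simp
    show "\<gamma> m \<in> borel_measurable \<rho>" for m by (rule continuous_map_borel_measurable[OF \<gamma>(1) \<rho>(2)])
    show "AE x in \<rho>. (\<lambda>m. \<gamma> m x) \<longlonglongrightarrow> indicat_real C x"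
      using \<gamma>(4) sets_eq_imp_space_eq[OF \<rho>(2)] by (intro AE_I2) auto
    show "AE x in \<rho>. norm (\<gamma> m x) \<le> 1" for m using \<gamma>(2,3) by simp
  qed
  have "integral\<^sup>L \<mu> (\<gamma> m) = integral\<^sup>L \<nu> (\<gamma> m)" for m
    using \<gamma>(1-3)[of m] by (intro eq) (auto simp: bounded_iff intro!: exI[of _ 1])
  then have "integral\<^sup>L \<mu> (indicator C) = integral\<^sup>L \<nu> (indicat_real C)"
    using lim[OF \<mu>] lim[OF \<nu>] by (metis (no_types, lifting) LIMSEQ_unique ext)
  then have "measure \<mu> C = measure \<nu> C"
    using closedin_subset[OF C] sp by (simp add: Int_absorb2)
  then show "emeasure \<mu> C = emeasure \<nu> C" by (simp add: \<mu>.emeasure_eq_measure \<nu>.emeasure_eq_measure)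
next
  interpret \<mu>: prob_space \<mu> by fact
  show "emeasure \<mu> (topspace S) \<noteq> \<infinity>" for i :: nat using \<mu>.emeasure_finite by simp
qed auto

section \<open>Coordinates in the enlarged space\<close>

text \<open>The last clause of \<open>enlarged_space\<close> supplies such a sequence. Its entries
  from index 1 on do not depend on the choice, by \<open>coord_unique\<close>; the entry at index 0
  is arbitrary.\<close>

definition coord :: "(nat \<Rightarrow> 'u::{real_inner,complete_space}) \<Rightarrow> ('u \<Rightarrow> 'w::banach) \<Rightarrow> 'w \<Rightarrow> nat \<Rightarrow> real" where
  "coord e J v = (SOME \<alpha>. (\<lambda>k. (\<alpha> k)\<^sup>2 / (real k)\<^sup>2) summable_on {1..} \<and>
     (\<lambda>n. \<Sum>k=1..n. \<alpha> k *\<^sub>R J (e k)) \<longlonglongrightarrow> v)"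

context
  fixes e :: "nat \<Rightarrow> 'u::{real_inner,complete_space}" and J :: "'u \<Rightarrow> 'w::banach"
  assumes J: "enlarged_space e J"
begin

lemma coord_summable: "(\<lambda>k. (coord e J v k)\<^sup>2 / (real k)\<^sup>2) summable_on {1..}"
  and coord_sums: "(\<lambda>n. \<Sum>k=1..n. coord e J v k *\<^sub>R J (e k)) \<longlonglongrightarrow> v"
proof -
  have "\<exists>\<alpha>. (\<lambda>k. (\<alpha> k)\<^sup>2 / (real k)\<^sup>2) summable_on {1..} \<and>
     (\<lambda>n. \<Sum>k=1..n. \<alpha> k *\<^sub>R J (e k)) \<longlonglongrightarrow> v"
    using J by (simp add: enlarged_space_def)
  from someI_ex[OF this]
  show "(\<lambda>k. (coord e J v k)\<^sup>2 / (real k)\<^sup>2) summable_on {1..}"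
    "(\<lambda>n. \<Sum>k=1..n. coord e J v k *\<^sub>R J (e k)) \<longlonglongrightarrow> v"
    by (auto simp: coord_def)
qed

lemma enlarged_norm:
  assumes "(\<lambda>k. (\<alpha> k)\<^sup>2 / (real k)\<^sup>2) summable_on {1..}" "(\<lambda>n. \<Sum>k=1..n. \<alpha> k *\<^sub>R J (e k)) \<longlonglongrightarrow> v"
  shows "(norm v)\<^sup>2 = (\<Sum>\<^sub>\<infinity>k\<in>{1..}. (\<alpha> k)\<^sup>2 / (real k)\<^sup>2)"
proof -
  obtain w where "(\<lambda>n. \<Sum>k=1..n. \<alpha> k *\<^sub>R J (e k)) \<longlonglongrightarrow> w"
    "(norm w)\<^sup>2 = (\<Sum>\<^sub>\<infinity>k\<in>{1..}. (\<alpha> k)\<^sup>2 / (real k)\<^sup>2)"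
    using J assms(1) unfolding enlarged_space_def by blast
  then show ?thesis using LIMSEQ_unique[OF assms(2)] by blast
qed

text \<open>The finite sum is the limit of the series of the truncated coefficients, whose partial
  sums are eventually constant, so the norm formula for series applies to it.\<close>

lemma enlarged_norm_sum: "(norm (\<Sum>k=1..n. \<alpha> k *\<^sub>R J (e k)))\<^sup>2 = (\<Sum>k=1..n. (\<alpha> k)\<^sup>2 / (real k)\<^sup>2)"
proof -
  define a where "a k = (if k \<le> n then \<alpha> k else 0)" for k
  have hs: "((\<lambda>k. (a k)\<^sup>2 / (real k)\<^sup>2) has_sum (\<Sum>k=1..n. (a k)\<^sup>2 / (real k)\<^sup>2)) {1..}"
    by (rule has_sum_finite_neutralI[of "{1..n}"]) (auto simp: a_def)
  have "(\<Sum>k=1..m. a k *\<^sub>R J (e k)) = (\<Sum>k=1..n. \<alpha> k *\<^sub>R J (e k))" if "m \<ge> n" for m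
    using that by (intro sum.mono_neutral_cong_right) (auto simp: a_def)
  then have "(\<lambda>m. \<Sum>k=1..m. a k *\<^sub>R J (e k)) \<longlonglongrightarrow> (\<Sum>k=1..n. \<alpha> k *\<^sub>R J (e k))"
    by (intro tendsto_eventually) (auto simp: eventually_sequentially)
  from enlarged_norm[OF has_sum_imp_summable[OF hs] this] infsumI[OF hs]
  have "(norm (\<Sum>k=1..n. \<alpha> k *\<^sub>R J (e k)))\<^sup>2 = (\<Sum>k=1..n. (a k)\<^sup>2 / (real k)\<^sup>2)"
    by (rule trans)
  then show ?thesis by (simp add: a_def)
qed

text \<open>Convergent partial sums are bounded, and their squared norms are exactly the partial
  sums of the weighted squares. Hence every convergent expansion has admissible coefficients, not
  only the one picked by \<open>coord\<close>.\<close>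

lemma enlarged_summable:
  assumes "(\<lambda>n. \<Sum>k=1..n. \<alpha> k *\<^sub>R J (e k)) \<longlonglongrightarrow> v"
  shows "(\<lambda>k. (\<alpha> k)\<^sup>2 / (real k)\<^sup>2) summable_on {1..}"
proof -
  have "Bseq (\<lambda>n. \<Sum>k=1..n. \<alpha> k *\<^sub>R J (e k))"
    using assms by (intro convergent_imp_Bseq convergentI)
  then obtain C where C: "\<And>n. norm (\<Sum>k=1..n. \<alpha> k *\<^sub>R J (e k)) \<le> C" by (auto simp: Bseq_def)
  show ?thesis
  proof (rule nonneg_bdd_above_summable_on)
    show "bdd_above (sum (\<lambda>k. (\<alpha> k)\<^sup>2 / (real k)\<^sup>2) ` {F. F \<subseteq> {1..} \<and> finite F})"
    proof (intro bdd_aboveI2)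
      fix F :: "nat set" assume F: "F \<in> {F. F \<subseteq> {1..} \<and> finite F}"
      have "(\<Sum>k\<in>F. (\<alpha> k)\<^sup>2 / (real k)\<^sup>2) \<le> (\<Sum>k=1..Max (insert 0 F). (\<alpha> k)\<^sup>2 / (real k)\<^sup>2)"
        using F by (intro sum_mono2) auto
      also have "\<dots> \<le> C\<^sup>2"
        unfolding enlarged_norm_sum[symmetric] using C by (intro power_mono) auto
      finally show "(\<Sum>k\<in>F. (\<alpha> k)\<^sup>2 / (real k)\<^sup>2) \<le> C\<^sup>2" .
    qed
  qed auto
qed

lemma norm_eq_coord:
  assumes "(\<lambda>n. \<Sum>k=1..n. \<alpha> k *\<^sub>R J (e k)) \<longlonglongrightarrow> v"
  shows "(norm v)\<^sup>2 = (\<Sum>\<^sub>\<infinity>k\<in>{1..}. (\<alpha> k)\<^sup>2 / (real k)\<^sup>2)"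
  by (rule enlarged_norm[OF enlarged_summable[OF assms] assms])

text \<open>A single term of the nonnegative series is at most its sum, the squared norm. Applied to
  differences this yields both uniqueness and Lipschitz continuity of the coordinates.\<close>

lemma abs_coefficient_le:
  assumes "(\<lambda>n. \<Sum>k=1..n. \<alpha> k *\<^sub>R J (e k)) \<longlonglongrightarrow> v" "1 \<le> k"
  shows "\<bar>\<alpha> k\<bar> \<le> real k * norm v"
proof -
  have "(\<Sum>\<^sub>\<infinity>k\<in>{k}. (\<alpha> k)\<^sup>2 / (real k)\<^sup>2) \<le> (\<Sum>\<^sub>\<infinity>k\<in>{1..}. (\<alpha> k)\<^sup>2 / (real k)\<^sup>2)"
    using assms(2) enlarged_summable[OF assms(1)] by (intro infsum_mono_neutral) auto
  then have "(\<alpha> k)\<^sup>2 / (real k)\<^sup>2 \<le> (norm v)\<^sup>2" using norm_eq_coord[OF assms(1)] by simp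
  then have "\<bar>\<alpha> k\<bar>\<^sup>2 \<le> (real k * norm v)\<^sup>2"
    using assms(2) by (simp add: field_simps power_mult_distrib)
  then show ?thesis by (rule power2_le_imp_le) simp
qed

text \<open>Membership in a closed ball becomes countably many conditions on finitely many
  coordinates each, which is the form needed to prove measurability.\<close>

lemma norm_le_iff_coord:
  assumes "(\<lambda>n. \<Sum>k=1..n. \<alpha> k *\<^sub>R J (e k)) \<longlonglongrightarrow> v" "0 \<le> r"
  shows "norm v \<le> r \<longleftrightarrow> (\<forall>n. (\<Sum>k=1..n. (\<alpha> k)\<^sup>2 / (real k)\<^sup>2) \<le> r\<^sup>2)"
proof
  assume r: "norm v \<le> r"
  show "\<forall>n. (\<Sum>k=1..n. (\<alpha> k)\<^sup>2 / (real k)\<^sup>2) \<le> r\<^sup>2"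
  proof
    fix n
    have "(\<Sum>k=1..n. (\<alpha> k)\<^sup>2 / (real k)\<^sup>2) \<le> (\<Sum>\<^sub>\<infinity>k\<in>{1..}. (\<alpha> k)\<^sup>2 / (real k)\<^sup>2)"
      using enlarged_summable[OF assms(1)] by (intro finite_sum_le_infsum) auto
    also have "\<dots> = (norm v)\<^sup>2" by (rule norm_eq_coord[OF assms(1), symmetric])
    also have "\<dots> \<le> r\<^sup>2" using r by (intro power_mono) auto
    finally show "(\<Sum>k=1..n. (\<alpha> k)\<^sup>2 / (real k)\<^sup>2) \<le> r\<^sup>2" .
  qed
next
  assume le: "\<forall>n. (\<Sum>k=1..n. (\<alpha> k)\<^sup>2 / (real k)\<^sup>2) \<le> r\<^sup>2"
  have "norm (\<Sum>k=1..n. \<alpha> k *\<^sub>R J (e k)) \<le> r" for n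
    by (rule power2_le_imp_le[OF _ assms(2)]) (simp only: enlarged_norm_sum le)
  then show "norm v \<le> r"
    using tendsto_norm[OF assms(1)] by (intro LIMSEQ_le_const2) auto
qed

lemma series_diff:
  fixes \<alpha> \<alpha>' :: "nat \<Rightarrow> real"
  assumes "(\<lambda>n. \<Sum>k=1..n. \<alpha> k *\<^sub>R J (e k)) \<longlonglongrightarrow> v" "(\<lambda>n. \<Sum>k=1..n. \<alpha>' k *\<^sub>R J (e k)) \<longlonglongrightarrow> w"
  shows "(\<lambda>n. \<Sum>k=1..n. (\<alpha> k - \<alpha>' k) *\<^sub>R J (e k)) \<longlonglongrightarrow> v - w"
  using tendsto_diff[OF assms] by (simp add: sum_subtractf scaleR_left_diff_distrib)

lemma coord_unique:
  assumes "(\<lambda>n. \<Sum>k=1..n. \<alpha> k *\<^sub>R J (e k)) \<longlonglongrightarrow> v" "1 \<le> k"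
  shows "coord e J v k = \<alpha> k"
  using abs_coefficient_le[OF series_diff[OF coord_sums[of v] assms(1)] assms(2)] by simp

lemma coord_diff: "1 \<le> k \<Longrightarrow> coord e J (v - w) k = coord e J v k - coord e J w k"
  by (rule coord_unique[OF series_diff[OF coord_sums coord_sums]])

lemma coord_Lipschitz: "1 \<le> k \<Longrightarrow> \<bar>coord e J v k - coord e J w k\<bar> \<le> real k * dist v w"
  using abs_coefficient_le[OF coord_sums, of k "v - w"] by (simp add: coord_diff dist_norm)

lemma continuous_on_coord: "1 \<le> k \<Longrightarrow> continuous_on UNIV (\<lambda>v. coord e J v k)"
  by (rule lipschitz_on_continuous_on[of "real k"])
     (auto simp: lipschitz_on_def dist_real_def coord_Lipschitz)

lemma label_separable_enlarged: "label_separable (UNIV :: 'w set) dist"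
proof (rule label_separable_denseI[where d'=dist])
  \<comment> \<open>A list of rationals encodes a finite combination; the coefficient of index k
    sits at position k - 1.\<close>
  define D where "D = (\<lambda>xs. \<Sum>k=1..length xs. real_of_rat (xs ! (k - 1)) *\<^sub>R J (e k)) ` (UNIV :: rat list set)"
  show "countable D" by (simp add: D_def)
  fix v :: 'w and \<epsilon> :: real assume \<epsilon>: "\<epsilon> > 0"
  obtain n where n: "dist (\<Sum>k=1..n. coord e J v k *\<^sub>R J (e k)) v < \<epsilon> / 2"
    using coord_sums[of v] \<epsilon> unfolding lim_sequentially by (meson half_gt_zero order_refl)
  \<comment> \<open>The summand 1 keeps \<open>c\<close> positive when all the norms vanish, and
    turns the error bound \<epsilon>/2 * (c - 1)/c into a strict one.\<close>
  define c where "c = (\<Sum>k=1..n. norm (J (e k))) + 1"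
  have c: "c > 0" by (auto simp: c_def intro!: add_nonneg_pos sum_nonneg)
  have "\<exists>q::rat. \<bar>coord e J v k - real_of_rat q\<bar> < \<epsilon> / 2 / c" for k
  proof -
    have "coord e J v k < coord e J v k + \<epsilon> / 2 / c" using \<epsilon> c by simp
    from of_rat_dense[OF this] obtain q where
      "coord e J v k < real_of_rat q" "real_of_rat q < coord e J v k + \<epsilon> / 2 / c" by blast
    then show ?thesis by (intro exI[of _ q]) (simp add: abs_if)
  qed
  then obtain q where q: "\<And>k. \<bar>coord e J v k - real_of_rat (q k)\<bar> < \<epsilon> / 2 / c" by metis
  define xs where "xs = map (\<lambda>k. q (Suc k)) [0..<n]"
  have "dist (\<Sum>k=1..n. coord e J v k *\<^sub>R J (e k)) (\<Sum>k=1..n. real_of_rat (q k) *\<^sub>R J (e k))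
      = norm (\<Sum>k=1..n. (coord e J v k - real_of_rat (q k)) *\<^sub>R J (e k))"
    by (simp add: dist_norm sum_subtractf scaleR_left_diff_distrib)
  also have "\<dots> \<le> (\<Sum>k=1..n. \<epsilon> / 2 / c * norm (J (e k)))"
    by (rule sum_norm_le) (use mult_right_mono[OF less_imp_le[OF q] norm_ge_zero] in simp)
  also have "\<dots> = \<epsilon> / 2 / c * (c - 1)" by (simp add: c_def sum_distrib_left)
  also have "\<dots> < \<epsilon> / 2" using \<epsilon> c by (simp add: field_simps)
  finally have "dist v (\<Sum>k=1..n. real_of_rat (q k) *\<^sub>R J (e k)) < \<epsilon>"
    using n dist_triangle_half_r by blast
  moreover have "(\<Sum>k=1..n. real_of_rat (q k) *\<^sub>R J (e k)) = (\<Sum>k=1..length xs. real_of_rat (xs ! (k - 1)) *\<^sub>R J (e k))"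
    by (auto simp: xs_def intro!: sum.cong)
  ultimately show "\<exists>q\<in>D. dist v q < \<epsilon>" by (auto simp: D_def)
qed (rule dist_triangle2)

end

section \<open>Smooth functions\<close>

lemma dderiv_eq: "(f has_derivative f') (at x) \<Longrightarrow> dderiv b f x = f' b"
  by (metis dderiv_def frechet_derivative_at)

lemma smooth_differentiable: "smooth f \<Longrightarrow> f differentiable (at x)"
  unfolding smooth_def by (metis dderivs_Nil empty_set empty_subsetI)

lemma smooth_dderiv: "smooth f \<Longrightarrow> b \<in> Basis \<Longrightarrow> dderiv b f differentiable (at x)"
  unfolding smooth_def by (metis dderivs_Nil dderivs_Cons empty_set empty_subsetI insert_subset list.simps(15))

lemma dderivs_add:
  assumes "smooth f" "smooth g" "set bs \<subseteq> Basis"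
  shows "dderivs bs (\<lambda>y. f y + g y) = (\<lambda>y. dderivs bs f y + dderivs bs g y)"
  using assms(3)
proof (induction bs)
  case (Cons b bs)
  then have "(dderivs bs f has_derivative frechet_derivative (dderivs bs f) (at x)) (at x)"
    "(dderivs bs g has_derivative frechet_derivative (dderivs bs g) (at x)) (at x)" for x
    using assms(1,2) by (simp_all add: smooth_def frechet_derivative_works)
  from dderiv_eq[OF has_derivative_add[OF this]] Cons show ?case
    by (auto simp: dderiv_def)
qed simp

lemma smooth_add: "smooth f \<Longrightarrow> smooth g \<Longrightarrow> smooth (\<lambda>x. f x + g x)"
  unfolding smooth_def[of "\<lambda>x. f x + g x"]
  by (auto simp: dderivs_add smooth_def intro!: differentiable_add)

lemma Cinf_lin: "f \<in> Cinf \<Longrightarrow> g \<in> Cinf \<Longrightarrow> (\<lambda>x. a * f x + c * g x) \<in> Cinf"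
  using Cinf_cmult[of f a] Cinf_cmult[of g c]
  by (auto simp: Cinf_def periodic_def intro!: smooth_add)

lemma Cinf_continuous: "f \<in> Cinf \<Longrightarrow> continuous_on S f"
  by (auto simp: Cinf_def intro!: continuous_at_imp_continuous_on differentiable_imp_continuous_within
      smooth_differentiable)

lemma Cinf_partial_continuous:
  fixes f :: "real^'n \<Rightarrow> real"
  assumes "f \<in> Cinf" shows "continuous_on S (partial i f)"
proof -
  have "axis i 1 \<in> (Basis :: (real^'n) set)" by simp
  then show ?thesis using assms
    by (auto simp: Cinf_def partial_def intro!: continuous_at_imp_continuous_on
        differentiable_imp_continuous_within smooth_dderiv)
qed

section \<open>Trigonometric polynomials as smooth test functions on the torus\<close>

inductive_set trig_polynomials :: "(real^'n \<Rightarrow> real) set" where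
  const: "(\<lambda>x. c) \<in> trig_polynomials"
| cos: "(\<lambda>x. cos (2 * pi * x $ i + c)) \<in> trig_polynomials"
| add: "f \<in> trig_polynomials \<Longrightarrow> g \<in> trig_polynomials \<Longrightarrow> (\<lambda>x. f x + g x) \<in> trig_polynomials"
| mult: "f \<in> trig_polynomials \<Longrightarrow> g \<in> trig_polynomials \<Longrightarrow> (\<lambda>x. f x * g x) \<in> trig_polynomials"

lemma trig_dderiv:
  fixes f :: "real^'n \<Rightarrow> real"
  shows "f \<in> trig_polynomials \<Longrightarrow> (\<forall>x. f differentiable (at x)) \<and> (\<forall>b. dderiv b f \<in> trig_polynomials)"
proof (induction rule: trig_polynomials.induct)
  case (const c)
  have "dderiv b (\<lambda>x::real^'n. c) = (\<lambda>x. 0)" for b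
    by (rule ext, rule dderiv_eq[of _ "\<lambda>_. 0", simplified]) simp
  then show ?case by (auto intro: trig_polynomials.const)
next
  case (cos i c)
  have der: "((\<lambda>x::real^'n. cos (2 * pi * x $ i + c)) has_derivative
      (\<lambda>h. - sin (2 * pi * x $ i + c) * (2 * pi * h $ i))) (at x)" for x
    by (auto intro!: derivative_eq_intros bounded_linear_imp_has_derivative bounded_linear_vec_nth)
  have "dderiv b (\<lambda>x::real^'n. cos (2 * pi * x $ i + c)) =
      (\<lambda>x. (2 * pi * b $ i) * cos (2 * pi * x $ i + (c + pi / 2)))" for b
    by (rule ext, subst dderiv_eq[OF der]) (simp add: add.assoc[symmetric] cos_add)
  then show ?case using der
    by (auto intro!: trig_polynomials.intros simp: differentiable_def simp del: mult.assoc)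
next
  case (add f g)
  then have "(f has_derivative frechet_derivative f (at x)) (at x)"
    "(g has_derivative frechet_derivative g (at x)) (at x)" for x
    by (simp_all add: frechet_derivative_works)
  from dderiv_eq[OF has_derivative_add[OF this]]
  have "dderiv b (\<lambda>x. f x + g x) = (\<lambda>x. dderiv b f x + dderiv b g x)" for b
    by (auto simp: dderiv_def)
  then show ?case using add by (auto intro!: trig_polynomials.add)
next
  case (mult f g)
  then have "(f has_derivative frechet_derivative f (at x)) (at x)"
    "(g has_derivative frechet_derivative g (at x)) (at x)" for x
    by (simp_all add: frechet_derivative_works)
  from dderiv_eq[OF has_derivative_mult[OF this]]
  have "dderiv b (\<lambda>x. f x * g x) = (\<lambda>x. f x * dderiv b g x + dderiv b f x * g x)" for b
    by (auto simp: dderiv_def)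
  then show ?case using mult by (auto intro!: trig_polynomials.add trig_polynomials.mult)
qed

lemma trig_periodic:
  fixes f :: "real^'n \<Rightarrow> real"
  shows "f \<in> trig_polynomials \<Longrightarrow> periodic f"
proof (induction rule: trig_polynomials.induct)
  case (cos i c)
  have "cos (2 * pi * (x + axis j 1) $ i + c) = cos (2 * pi * x $ i + c)" for x :: "real^'n" and j
  proof (cases "i = j")
    case True
    then have "2 * pi * (x + axis j 1) $ i + c = (2 * pi * x $ i + c) + 2 * pi"
      by (simp add: axis_def algebra_simps)
    then show ?thesis by (simp only: cos_periodic)
  qed (simp add: axis_def)
  then show ?case by (simp add: periodic_def)
qed (auto simp: periodic_def)

lemma trig_Cinf:
  assumes "f \<in> trig_polynomials" shows "f \<in> Cinf"
proof -
  have "dderivs bs f \<in> trig_polynomials" for bs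
    using assms by (induction bs) (auto simp: trig_dderiv)
  then have "smooth f" using trig_dderiv by (auto simp: smooth_def)
  then show ?thesis using trig_periodic[OF assms] by (simp add: Cinf_def)
qed

text \<open>Polynomial approximations of a function of \<open>s\<close>, as produced by the
  Weierstrass theorem, remain smooth and periodic in this way.\<close>

lemma trig_polynomial_comp:
  assumes "real_polynomial_function p" "s \<in> trig_polynomials"
  shows "(\<lambda>x. p (s x)) \<in> trig_polynomials"
  using assms(1)
proof (induction rule: real_polynomial_function.induct)
  case (linear h)
  then have "h y = h 1 * y" for y :: real
    using linear_scale[OF bounded_linear.linear[OF linear], of y 1] by (simp add: mult.commute)
  then have "(\<lambda>x. h (s x)) = (\<lambda>x. h 1 * s x)" by blast
  then show ?case
    using trig_polynomials.mult[OF trig_polynomials.const assms(2), of "h 1"] by simp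
qed (auto intro: trig_polynomials.intros)

lemma trig_prod:
  "finite I \<Longrightarrow> (\<And>i. i \<in> I \<Longrightarrow> s i \<in> trig_polynomials) \<Longrightarrow> (\<lambda>x. \<Prod>i\<in>I. s i x) \<in> trig_polynomials"
  by (induction I rule: finite_induct) (auto intro: trig_polynomials.intros)

section \<open>The fundamental lemma of the calculus of variations on the torus\<close>

text \<open>The cosine is shifted to have its peak at the midpoint of the interval and is lowered by
  its value at the endpoints. The result describes an interval in one period by positivity of a
  trigonometric polynomial.\<close>

lemma cos_interval:
  assumes y: "0 \<le> y" "y \<le> 1" and ab: "0 \<le> \<alpha>" "\<alpha> < \<beta>" "\<beta> \<le> 1"
  shows "0 < cos (2 * pi * y + (- pi * (\<alpha> + \<beta>))) + (- cos (pi * (\<beta> - \<alpha>))) \<longleftrightarrow> \<alpha> < y \<and> y < \<beta>"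
proof -
  define \<theta> where "\<theta> = \<bar>2 * y - \<alpha> - \<beta>\<bar>"
  define \<phi> where "\<phi> = \<beta> - \<alpha>"
  have \<phi>: "0 < \<phi>" "\<phi> \<le> 1" using ab by (auto simp: \<phi>_def)
  have in_iff: "\<alpha> < y \<and> y < \<beta> \<longleftrightarrow> \<theta> < \<phi>" by (auto simp: \<theta>_def \<phi>_def)
  have "2 * pi * y + (- pi * (\<alpha> + \<beta>)) = pi * (2 * y - \<alpha> - \<beta>)" by (simp add: algebra_simps)
  moreover have "cos (pi * (2 * y - \<alpha> - \<beta>)) = cos (pi * \<theta>)"
    unfolding \<theta>_def using cos_abs_real[of "pi * (2 * y - \<alpha> - \<beta>)"] by (simp add: abs_mult)
  ultimately have eq: "cos (2 * pi * y + (- pi * (\<alpha> + \<beta>))) = cos (pi * \<theta>)" by simp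
  have "cos (pi * \<phi>) < cos (pi * \<theta>) \<longleftrightarrow> \<theta> < \<phi>"
  proof (cases "\<theta> \<le> 1")
    case True
    then have "cos (pi * \<phi>) < cos (pi * \<theta>) \<longleftrightarrow> pi * \<theta> < pi * \<phi>"
      using \<phi> by (intro cos_mono_less_eq) (auto simp: \<theta>_def)
    then show ?thesis by simp
  next
    case False
    \<comment> \<open>Beyond half a period the cosine increases again. As y and both endpoints lie
      in [0,1], the angle reflected at pi is still at least pi * \<phi>, so the cosine has not risen
      above its endpoint value.\<close>
    have le: "\<phi> \<le> 2 - \<theta>" using y ab by (auto simp: \<theta>_def \<phi>_def)
    have "cos (pi * \<theta>) = cos (2 * pi - pi * \<theta>)" by (simp add: cos_diff)
    also have "\<dots> = cos (pi * (2 - \<theta>))" by (simp add: algebra_simps)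
    also have "\<dots> \<le> cos (pi * \<phi>)"
      using le \<phi> False by (intro cos_monotone_0_pi_le) auto
    finally show ?thesis using False \<phi> by auto
  qed
  then show ?thesis unfolding eq in_iff \<phi>_def[symmetric] by auto
qed

text \<open>Weierstrass approximations, with error below 1/(n+1), of the ramps that cut n * y off at
  0 and 1. The interval [-2,2] contains every difference of two cosines; the bound 2 is the height 1
  of the ramp plus an error of at most 1.\<close>

lemma polynomial_step:
  obtains p :: "nat \<Rightarrow> real \<Rightarrow> real" where "\<And>n. real_polynomial_function (p n)"
    "\<And>n y. \<bar>y\<bar> \<le> 2 \<Longrightarrow> \<bar>p n y\<bar> \<le> 2"
    "\<And>y. \<bar>y\<bar> \<le> 2 \<Longrightarrow> (\<lambda>n. p n y) \<longlonglongrightarrow> (if 0 < y then 1 else 0)"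
proof -
  define r where "r n y = max 0 (min 1 (real n * y))" for n y
  have "\<exists>p. real_polynomial_function p \<and> (\<forall>y\<in>{-2..2}. \<bar>r n y - p y\<bar> < inverse (real (Suc n)))" for n
    by (rule Stone_Weierstrass_real_polynomial_function[of "{-2..2}" "r n" "inverse (real (Suc n))"])
       (auto simp: r_def intro!: continuous_intros)
  then obtain p where p: "\<And>n. real_polynomial_function (p n)"
    "\<And>n y. y \<in> {-2..2} \<Longrightarrow> \<bar>r n y - p n y\<bar> < inverse (real (Suc n))" by metis
  show thesis
  proof (rule that[of p])
    show "\<bar>p n y\<bar> \<le> 2" if "\<bar>y\<bar> \<le> 2" for n y
    proof -
      have "inverse (real (Suc n)) \<le> 1" by (simp add: field_simps)
      moreover have "\<bar>r n y - p n y\<bar> < inverse (real (Suc n))" using that by (intro p) auto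
      moreover have "\<bar>r n y\<bar> \<le> 1" by (auto simp: r_def)
      ultimately show ?thesis by linarith
    qed
    fix y :: real assume y: "\<bar>y\<bar> \<le> 2"
    then have "y \<in> {-2..2}" by auto
    from less_imp_le[OF p(2)[OF this]] have "norm (r n y - p n y) \<le> inverse (real (Suc n))" for n
      by (simp only: real_norm_def)
    then have 1: "(\<lambda>n. r n y - p n y) \<longlonglongrightarrow> 0"
      by (intro Lim_null_comparison[OF _ LIMSEQ_inverse_real_of_nat] always_eventually allI)
    have 2: "(\<lambda>n. r n y) \<longlonglongrightarrow> (if 0 < y then 1 else 0)"
    proof (cases "0 < y")
      case True
      obtain N where N: "1 < real N * y" using reals_Archimedean3[OF True] by blast
      have "r n y = 1" if "n \<ge> N" for n
      proof -
        have "real N * y \<le> real n * y" using that True by (intro mult_right_mono) auto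
        then show ?thesis using N by (simp add: r_def)
      qed
      then have "\<forall>\<^sub>F n in sequentially. r n y = 1" unfolding eventually_sequentially by blast
      then show ?thesis using True by (simp add: tendsto_eventually)
    next
      case False
      then have "r n y = 0" for n
        using mult_nonneg_nonpos[of "real n" y] by (simp add: r_def)
      then show ?thesis using False by simp
    qed
    show "(\<lambda>n. p n y) \<longlonglongrightarrow> (if 0 < y then 1 else 0)" using tendsto_diff[OF 2 1] by simp
  qed (rule p(1))
qed

text \<open>Composing \<open>polynomial_step\<close> with the cosine differences of
  \<open>cos_interval\<close> and multiplying over the coordinates gives smooth periodic functions
  that converge on the cell to the indicator of the box. They are bounded by 2 to the power of the
  dimension, so the integrals converge by domination.\<close>

lemma integral_small_box_0:
  fixes f :: "real^'n \<Rightarrow> real"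
  assumes f: "set_integrable lborel cell f"
    and 0: "\<And>g. g \<in> Cinf \<Longrightarrow> (LINT x:cell|lborel. f x * g x) = 0"
    and ab: "\<And>i. 0 \<le> a $ i \<and> a $ i < b $ i \<and> b $ i \<le> 1"
  shows "(\<integral>x. (indicator cell x * f x) * indicator (box a b) x \<partial>lborel) = 0"
proof -
  obtain p :: "nat \<Rightarrow> real \<Rightarrow> real" where p: "\<And>n. real_polynomial_function (p n)"
    "\<And>n y. \<bar>y\<bar> \<le> 2 \<Longrightarrow> \<bar>p n y\<bar> \<le> 2"
    "\<And>y. \<bar>y\<bar> \<le> 2 \<Longrightarrow> (\<lambda>n. p n y) \<longlonglongrightarrow> (if 0 < y then 1 else 0)"
    using polynomial_step by blast
  define s :: "'n \<Rightarrow> real^'n \<Rightarrow> real" where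
    "s i x = cos (2 * pi * x $ i + (- pi * (a $ i + b $ i))) + (- cos (pi * (b $ i - a $ i)))" for i x
  have s2: "\<bar>s i x\<bar> \<le> 2" for i x
    using abs_cos_le_one[of "2 * pi * x $ i + (- pi * (a $ i + b $ i))"] abs_cos_le_one[of "pi * (b $ i - a $ i)"]
    unfolding s_def by linarith
  have st: "s i \<in> trig_polynomials" for i
    unfolding s_def[abs_def] by (intro trig_polynomials.intros)
  define h where "h n x = (\<Prod>i\<in>UNIV. p n (s i x))" for n x
  have hC: "h n \<in> Cinf" for n
    unfolding h_def[abs_def]
    by (rule trig_Cinf, rule trig_prod, simp, rule trig_polynomial_comp[OF p(1) st])
  have hb: "\<bar>h n x\<bar> \<le> 2 ^ CARD('n)" for n x
  proof -
    have "\<bar>h n x\<bar> = (\<Prod>i\<in>UNIV. \<bar>p n (s i x)\<bar>)" by (simp add: h_def abs_prod)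
    also have "\<dots> \<le> (\<Prod>i\<in>(UNIV::'n set). 2)" by (intro prod_mono) (auto intro!: p s2)
    finally show ?thesis by simp
  qed
  have hlim: "(\<lambda>n. h n x) \<longlonglongrightarrow> indicator (box a b) x" if "x \<in> cell" for x
  proof -
    have "(\<lambda>n. h n x) \<longlonglongrightarrow> (\<Prod>i\<in>UNIV. if 0 < s i x then 1 else 0)"
      unfolding h_def by (intro tendsto_prod p s2)
    also have "(\<Prod>i\<in>UNIV. if 0 < s i x then 1 else 0 :: real) = (\<Prod>i\<in>UNIV. if a $ i < x $ i \<and> x $ i < b $ i then 1 else 0)"
    proof (intro prod.cong refl)
      fix i
      have "0 \<le> x $ i" "x $ i \<le> 1" using that by (auto simp: mem_box_cart)
      from cos_interval[OF this] ab[of i]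
      show "(if 0 < s i x then 1 else 0 :: real) = (if a $ i < x $ i \<and> x $ i < b $ i then 1 else 0)"
        unfolding s_def by (metis)
    qed
    also have "\<dots> = indicator (box a b) x"
      by (auto simp: indicator_def mem_box_cart prod_zero_iff)
    finally show ?thesis .
  qed
  have fi: "integrable lborel (\<lambda>x. indicator cell x * f x)"
    using f by (simp add: set_integrable_def)
  have "(\<lambda>n. \<integral>x. (indicator cell x * f x) * h n x \<partial>lborel) \<longlonglongrightarrow>
      (\<integral>x. (indicator cell x * f x) * indicator (box a b) x \<partial>lborel)"
  proof (rule integral_dominated_convergence[where w="\<lambda>x. 2 ^ CARD('n) * \<bar>indicator cell x * f x\<bar>"])
    show "(\<lambda>x. (indicator cell x * f x) * indicator (box a b) x) \<in> borel_measurable lborel"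
      using fi by measurable
    have "h n \<in> borel_measurable borel" for n
      using Cinf_continuous[OF hC] by (rule borel_measurable_continuous_onI)
    then show "(\<lambda>x. (indicator cell x * f x) * h n x) \<in> borel_measurable lborel" for n
     
      by (intro borel_measurable_times[OF borel_measurable_integrable[OF fi]]) simp
    show "integrable lborel (\<lambda>x. 2 ^ CARD('n) * \<bar>indicator cell x * f x\<bar>)"
      using fi by (intro integrable_mult_right integrable_abs)
    show "AE x in lborel. (\<lambda>n. (indicator cell x * f x) * h n x) \<longlonglongrightarrow> (indicator cell x * f x) * indicator (box a b) x"
    proof (intro AE_I2)
      fix x :: "real^'n"
      show "(\<lambda>n. (indicator cell x * f x) * h n x) \<longlonglongrightarrow> (indicator cell x * f x) * indicator (box a b) x"
        by (cases "x \<in> cell") (auto intro!: tendsto_mult_left hlim)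
    qed
    show "AE x in lborel. norm ((indicator cell x * f x) * h n x) \<le> 2 ^ CARD('n) * \<bar>indicator cell x * f x\<bar>" for n
    proof (intro AE_I2)
      fix x
      show "norm ((indicator cell x * f x) * h n x) \<le> 2 ^ CARD('n) * \<bar>indicator cell x * f x\<bar>"
        using mult_right_mono[OF hb, of "\<bar>indicator cell x * f x\<bar>" n x]
        by (simp only: real_norm_def abs_mult[of _ "h n x"] mult.commute[of _ "\<bar>h n x\<bar>"])
    qed
  qed
  moreover have "(\<integral>x. (indicator cell x * f x) * h n x \<partial>lborel) = 0" for n
    using 0[OF hC] by (simp add: set_lebesgue_integral_def mult.assoc)
  ultimately show ?thesis by (simp add: LIMSEQ_const_iff)
qed

lemma integral_box_0:
  fixes f :: "real^'n \<Rightarrow> real"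
  assumes f: "set_integrable lborel cell f"
    and 0: "\<And>g. g \<in> Cinf \<Longrightarrow> (LINT x:cell|lborel. f x * g x) = 0"
  shows "(\<integral>x. (indicator cell x * f x) * indicator (box a b) x \<partial>lborel) = 0"
proof -
  define a' b' :: "real^'n" where "a' = (\<chi> i. max 0 (a $ i))" and "b' = (\<chi> i. min 1 (b $ i))"
  \<comment> \<open>The faces of the cell are null. Off them, membership in a box is the same as
    membership in the box clipped to the unit cube.\<close>
  have "(cell :: (real^'n) set) - box 0 1 \<in> null_sets lborel"
    by (rule null_setsI) (simp_all add: emeasure_lborel_cbox_eq emeasure_Diff emeasure_lborel_box_eq box_subset_cbox)
  then have N: "AE x in lborel. x \<notin> (cell :: (real^'n) set) - box 0 1" by (rule AE_not_in)
  have "AE x in lborel. (indicator cell x * f x) * indicator (box a b) x = (indicator cell x * f x) * indicator (box a' b') x"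
    using N
  proof eventually_elim
    case (elim x)
    show ?case
    proof (cases "x \<in> cell")
      case True
      with elim have "0 < x $ i \<and> x $ i < 1" for i by (auto simp: mem_box_cart)
      then have "x \<in> box a b \<longleftrightarrow> x \<in> box a' b'" by (auto simp: mem_box_cart a'_def b'_def)
      then show ?thesis by (simp add: indicator_def)
    qed simp
  qed
  then have eq: "(\<integral>x. (indicator cell x * f x) * indicator (box a b) x \<partial>lborel) =
      (\<integral>x. (indicator cell x * f x) * indicator (box a' b') x \<partial>lborel)"
    using f by (intro integral_cong_AE) (auto simp: set_integrable_def)
  show ?thesis
  proof (cases "\<forall>i. a' $ i < b' $ i")
    case True
    then show ?thesis unfolding eq by (intro integral_small_box_0[OF f 0]) (auto simp: a'_def b'_def)
  next
    case False
    then have "box a' b' = {}" by (auto simp: interval_eq_empty_cart not_less)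
    then show ?thesis unfolding eq by simp
  qed
qed

text \<open>The positive and the negative part of \<open>F\<close> are densities of two measures
  that agree on all boxes, hence are equal; uniqueness of densities then forces both parts to
  coincide almost everywhere, which leaves only the value 0.\<close>

lemma AE_zero_if_box_0:
  fixes F :: "'a::euclidean_space \<Rightarrow> real"
  assumes F: "integrable lborel F" and 0: "\<And>a b. (\<integral>x. F x * indicator (box a b) x \<partial>lborel) = 0"
  shows "AE x in lborel. F x = 0"
proof -
  have [measurable]: "F \<in> borel_measurable borel" using F by auto
  \<comment> \<open>\<open>ennreal\<close> sends negative numbers to 0, so s = 1 gives the positive
    part of \<open>F\<close> as density and s = -1 the negative part.\<close>
  define \<mu> where "\<mu> s = density lborel (\<lambda>x. ennreal (s * F x))" for s :: real
  have fin: "emeasure (\<mu> s) A \<noteq> \<infinity>" if "\<bar>s\<bar> = 1" "A \<in> sets borel" for s A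
  proof -
    have "s * F x \<le> norm (F x)" for x
      using that(1) abs_ge_self[of "s * F x"] by (simp add: abs_mult)
    then have "emeasure (\<mu> s) A \<le> (\<integral>\<^sup>+x. ennreal (norm (F x)) \<partial>lborel)"
      using that unfolding \<mu>_def by (subst emeasure_density) (auto intro!: nn_integral_mono simp: ennreal_leI split: split_indicator)
    also have "\<dots> < \<infinity>" using F by (simp add: integrable_iff_bounded)
    finally show ?thesis by simp
  qed
  have "\<mu> 1 = \<mu> (-1)"
  proof (rule measure_eqI_generator_eq[where E="range (\<lambda>(a, b). box a b)" and \<Omega>=UNIV and A="\<lambda>n. box (- (real n *\<^sub>R One)) (real n *\<^sub>R One)"])
    show "Int_stable (range (\<lambda>(a, b). box a b :: 'a set))"
      by (auto simp: Int_stable_def Int_interval box_Int_box)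
    show "sets (\<mu> 1) = sigma_sets UNIV (range (\<lambda>(a, b). box a b))" "sets (\<mu> (-1)) = sigma_sets UNIV (range (\<lambda>(a, b). box a b))"
      by (simp_all add: \<mu>_def borel_eq_box)
    show "(\<Union>n. box (- (real n *\<^sub>R One)) (real n *\<^sub>R One)) = (UNIV :: 'a set)" by (rule UN_box_eq_UNIV)
    show "emeasure (\<mu> 1) (box (- (real n *\<^sub>R One)) (real n *\<^sub>R One)) \<noteq> \<infinity>" for n by (rule fin) auto
    fix X assume "X \<in> range (\<lambda>(a, b). box a b :: 'a set)"
    then obtain a b where X: "X = box a b" by auto
    have int: "integrable lborel (\<lambda>x. F x * indicator X x)" unfolding X
      using F by (intro integrable_real_mult_indicator) auto
    have m: "emeasure (\<mu> s) X = (\<integral>\<^sup>+x. ennreal (s * (F x * indicator X x)) \<partial>lborel)" for s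
      unfolding \<mu>_def X by (subst emeasure_density) (auto intro!: nn_integral_cong split: split_indicator)
    have "(\<integral>x. F x * indicator X x \<partial>lborel) = enn2real (\<integral>\<^sup>+x. ennreal (F x * indicator X x) \<partial>lborel)
        - enn2real (\<integral>\<^sup>+x. ennreal (- (F x * indicator X x)) \<partial>lborel)"
      by (rule real_lebesgue_integral_def[OF int])
    then have "enn2real (emeasure (\<mu> 1) X) = enn2real (emeasure (\<mu> (-1)) X)"
      using 0[of a b] unfolding X[symmetric] by (simp add: m)
    moreover have "emeasure (\<mu> 1) X < top" "emeasure (\<mu> (-1)) X < top"
      using fin[of 1 X] fin[of "-1" X] by (auto simp: X less_top)
    ultimately show "emeasure (\<mu> 1) X = emeasure (\<mu> (-1)) X" by (metis ennreal_enn2real)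
  qed auto
  then have "AE x in lborel. ennreal (1 * F x) = ennreal (- 1 * F x)"
    unfolding \<mu>_def by (intro sigma_finite_measure.density_unique[OF sigma_finite_lborel]) auto
  then show ?thesis
  proof eventually_elim
    case (elim x)
    show ?case
    proof (cases "0 \<le> F x")
      case True
      then have "ennreal (F x) = 0" using elim by (simp add: ennreal_neg)
      then show ?thesis using True by (simp add: ennreal_eq_0_iff)
    next
      case False
      then have "ennreal (- F x) = 0" using elim by (simp add: ennreal_neg)
      then show ?thesis using False by (simp add: ennreal_eq_0_iff)
    qed
  qed
qed

lemma torus_fundamental_lemma:
  fixes f :: "real^'n \<Rightarrow> real"
  assumes "set_integrable lborel cell f"
    and "\<And>g. g \<in> Cinf \<Longrightarrow> (LINT x:cell|lborel. f x * g x) = 0"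
  shows "AE x in lborel. x \<in> cell \<longrightarrow> f x = 0"
proof -
  have "AE x in lborel. indicator cell x * f x = 0"
    using assms(1) by (intro AE_zero_if_box_0 integral_box_0 assms) (auto simp: set_integrable_def)
  then show ?thesis by eventually_elim auto
qed

text \<open>The fundamental lemma is applied in each time slice, and Fubini turns equality on almost
  every slice into equality almost everywhere. Joint measurability with integrable slices suffices,
  so \<open>clamped_rep\<close> can use this before joint integrability of the solution is
  known.\<close>

lemma AE_eq_if_slices_eq:
  fixes f f' :: "real \<times> (real^'n) \<Rightarrow> real"
  assumes m: "set_borel_measurable lborel ({0..t} \<times> cell) f" "set_borel_measurable lborel ({0..t} \<times> cell) f'"
    and slices: "AE s in lborel. s \<in> {0..t} \<longrightarrow> set_integrable lborel cell (\<lambda>x. f (s, x)) \<and>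
      set_integrable lborel cell (\<lambda>x. f' (s, x)) \<and>
      (\<forall>g\<in>Cinf. distr_of (\<lambda>x. f (s, x)) g = distr_of (\<lambda>x. f' (s, x)) g)"
  shows "AE z in lborel. z \<in> {0..t} \<times> cell \<longrightarrow> f z = f' z"
proof -
  define K :: "(real \<times> (real^'n)) set" where "K = {0..t} \<times> cell"
  have [measurable]: "(\<lambda>z. indicator K z *\<^sub>R f z) \<in> borel_measurable borel"
      "(\<lambda>z. indicator K z *\<^sub>R f' z) \<in> borel_measurable borel"
    using m by (auto simp: set_borel_measurable_def K_def)
  have "AE s in lborel. AE x in lborel. indicator K (s, x) *\<^sub>R f (s, x) = indicator K (s, x) *\<^sub>R f' (s, x)"
    using slices
  proof eventually_elim
    case (elim s)
    show ?case
    proof (cases "s \<in> {0..t}")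
      case True
      with elim have i: "set_integrable lborel cell (\<lambda>x. f (s, x))" "set_integrable lborel cell (\<lambda>x. f' (s, x))"
        and eq: "\<And>g. g \<in> Cinf \<Longrightarrow> distr_of (\<lambda>x. f (s, x)) g = distr_of (\<lambda>x. f' (s, x)) g" by auto
      have "AE x in lborel. x \<in> cell \<longrightarrow> f (s, x) - f' (s, x) = 0"
      proof (rule torus_fundamental_lemma)
        show "set_integrable lborel cell (\<lambda>x. f (s, x) - f' (s, x))" using i by (rule set_integral_diff)
        fix g :: "real^'n \<Rightarrow> real" assume g: "g \<in> Cinf"
        have "(LINT x:cell|lborel. (f (s, x) - f' (s, x)) * g x) =
            (LINT x:cell|lborel. f (s, x) * g x) - (LINT x:cell|lborel. f' (s, x) * g x)"
          unfolding left_diff_distrib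
          using set_integrable_cell_mult[OF i(1) g] set_integrable_cell_mult[OF i(2) g] by (rule set_integral_diff)
        then show "(LINT x:cell|lborel. (f (s, x) - f' (s, x)) * g x) = 0"
          using eq[OF g] g by (simp add: distr_of_def)
      qed
      then show ?thesis by eventually_elim (auto simp: K_def indicator_def)
    qed (auto simp: K_def indicator_def)
  qed
  then have "AE z in lborel \<Otimes>\<^sub>M lborel. indicator K z *\<^sub>R f z = indicator K z *\<^sub>R f' z"
  proof (rule lborel_pair.AE_pair_measure[rotated])
    show "{z \<in> space (lborel \<Otimes>\<^sub>M lborel). indicator K z *\<^sub>R f z = indicator K z *\<^sub>R f' z} \<in> sets (lborel \<Otimes>\<^sub>M lborel)"
      unfolding lborel_prod by measurable
  qed
  then show ?thesis unfolding lborel_prod by eventually_elim (auto simp: K_def)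
qed

lemma L1_rep_unique:
  assumes f: "L1_rep t u f" and f': "L1_rep t u f'"
  shows "AE z in lborel. z \<in> {0..t} \<times> cell \<longrightarrow> f z = f' z"
proof (rule AE_eq_if_slices_eq)
  have i: "set_integrable lborel ({0..t} \<times> cell) f" "set_integrable lborel ({0..t} \<times> cell) f'"
    using f f' by (auto simp: L1_rep_def)
  then show "set_borel_measurable lborel ({0..t} \<times> cell) f" "set_borel_measurable lborel ({0..t} \<times> cell) f'"
    by (auto simp: set_integrable_def set_borel_measurable_def)
  show "AE s in lborel. s \<in> {0..t} \<longrightarrow> set_integrable lborel cell (\<lambda>x. f (s, x)) \<and>
      set_integrable lborel cell (\<lambda>x. f' (s, x)) \<and>
      (\<forall>g\<in>Cinf. distr_of (\<lambda>x. f (s, x)) g = distr_of (\<lambda>x. f' (s, x)) g)"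
    using L1_rep_integrable_slice[OF i(1)] L1_rep_integrable_slice[OF i(2)]
      f[unfolded L1_rep_def, THEN conjunct2] f'[unfolded L1_rep_def, THEN conjunct2]
    by eventually_elim metis
qed

lemma L1_norm_eq:
  assumes f: "L1_rep t u f"
  shows "L1_norm t u = (LINT z:{0..t} \<times> cell|lborel. \<bar>f z\<bar>)"
proof -
  have eq: "(LINT z:{0..t} \<times> cell|lborel. \<bar>h z\<bar>) = (LINT z:{0..t} \<times> cell|lborel. \<bar>f z\<bar>)" if h: "L1_rep t u h" for h
  proof -
    have "(\<lambda>z. indicator ({0..t} \<times> cell) z *\<^sub>R f z) \<in> borel_measurable lborel"
      "(\<lambda>z. indicator ({0..t} \<times> cell) z *\<^sub>R h z) \<in> borel_measurable lborel"
      using f h by (auto simp: L1_rep_def set_integrable_def)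
    from this[THEN borel_measurable_abs]
    have "(\<lambda>z. indicator ({0..t} \<times> cell) z *\<^sub>R \<bar>f z\<bar>) \<in> borel_measurable lborel"
      "(\<lambda>z. indicator ({0..t} \<times> cell) z *\<^sub>R \<bar>h z\<bar>) \<in> borel_measurable lborel"
      by (simp_all add: abs_mult)
    then show ?thesis unfolding set_lebesgue_integral_def
      using L1_rep_unique[OF h f] by (intro integral_cong_AE) (auto elim!: eventually_mono simp: indicator_def)
  qed
  then have "{LINT z:{0..t} \<times> cell|lborel. \<bar>h z\<bar> | h. L1_rep t u h} = {LINT z:{0..t} \<times> cell|lborel. \<bar>f z\<bar>}"
    (is "?A = {?c}")
  proof (intro equalityI subsetI)
    fix y assume "y \<in> ?A"
    then obtain h where "L1_rep t u h" "y = (LINT z:{0..t} \<times> cell|lborel. \<bar>h z\<bar>)" by blast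
    then show "y \<in> {?c}" using eq by blast
  next
    fix y assume "y \<in> {?c}"
    then show "y \<in> ?A" using f by blast
  qed
  then show ?thesis by (simp add: L1_norm_def)
qed

section \<open>Separability of \<open>H\<^sup>1\<close> and of its dual\<close>

lemma grad_lin:
  assumes "f \<in> Cinf" "g \<in> Cinf"
  shows "grad (\<lambda>x. a * f x + c * g x) x = a *\<^sub>R grad f x + c *\<^sub>R grad g x"
proof -
  have "(f has_derivative frechet_derivative f (at x)) (at x)"
    "(g has_derivative frechet_derivative g (at x)) (at x)"
    using assms smooth_differentiable by (auto simp: Cinf_def frechet_derivative_works)
  then have "((\<lambda>x. a * f x + c * g x) has_derivative
      (\<lambda>h. a * frechet_derivative f (at x) h + c * frechet_derivative g (at x) h)) (at x)"
    by (auto intro!: derivative_eq_intros)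
  from dderiv_eq[OF this] show ?thesis
    by (simp add: grad_def partial_def vec_eq_iff dderiv_def)
qed

lemma grad_continuous: "f \<in> Cinf \<Longrightarrow> continuous_on S (grad f)"
  unfolding grad_def[abs_def] by (intro continuous_on_vec_lambda Cinf_partial_continuous)

lemma set_integrable_cell: "continuous_on UNIV F \<Longrightarrow> set_integrable lborel cell (F :: real^'n \<Rightarrow> real)"
  unfolding set_integrable_def
  using borel_integrable_compact[of "cell :: (real^'n) set" F] by (auto intro: continuous_on_subset)

lemma measure_cell [simp]: "measure lborel (cell :: (real^'n) set) = 1"
  and emeasure_cell [simp]: "emeasure lborel (cell :: (real^'n) set) = 1"
proof -
  have *: "(1 :: real^'n) \<bullet> b = 1" if "b \<in> Basis" for b
    using that by (auto simp: Basis_vec_def inner_axis)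
  then have "emeasure lborel (cell :: (real^'n) set) = ennreal (\<Prod>b\<in>(Basis :: (real^'n) set). 1)"
    by (subst emeasure_lborel_cbox) (auto intro!: prod.cong arg_cong[where f=ennreal])
  then show "emeasure lborel (cell :: (real^'n) set) = 1" by simp
  then show "measure lborel (cell :: (real^'n) set) = 1" by (simp add: measure_def)
qed

lemma cell_integral_le:
  fixes F :: "real^'n \<Rightarrow> real"
  assumes "continuous_on UNIV F" "\<And>x. x \<in> cell \<Longrightarrow> F x \<le> c"
  shows "(LINT x:cell|lborel. F x) \<le> c"
proof -
  have "(LINT x:cell|lborel. F x) \<le> (LINT x:(cell :: (real^'n) set)|lborel. c)"
    using assms by (intro set_integral_mono set_integrable_cell) auto
  then show ?thesis by (simp add: set_lebesgue_integral_def)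
qed

definition h1_inner :: "(real^'n \<Rightarrow> real) \<Rightarrow> (real^'n \<Rightarrow> real) \<Rightarrow> real" where
  "h1_inner f g = (LINT x:cell|lborel. f x * g x) + (LINT x:cell|lborel. grad f x \<bullet> grad g x)"

lemma h1_inner_commute: "h1_inner f g = h1_inner g f"
  by (simp add: h1_inner_def mult.commute inner_commute)

lemma H1_norm_power2: "(H1_norm f)\<^sup>2 = h1_inner f f"
proof -
  have "0 \<le> (LINT x:cell|lborel. (f x)\<^sup>2) + (LINT x:cell|lborel. (norm (grad f x))\<^sup>2)"
    by (auto simp: set_lebesgue_integral_def intro!: add_nonneg_nonneg integral_nonneg)
  then show ?thesis
    unfolding h1_inner_def H1_norm_def by (simp add: power2_eq_square[symmetric] power2_norm_eq_inner[symmetric])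
qed

lemma h1_inner_lin:
  assumes "f \<in> Cinf" "g \<in> Cinf" "h \<in> Cinf"
  shows "h1_inner (\<lambda>x. a * f x + c * g x) h = a * h1_inner f h + c * h1_inner g h"
proof -
  have 1: "set_integrable lborel cell (\<lambda>x. f x * h x)" "set_integrable lborel cell (\<lambda>x. g x * h x)"
    "set_integrable lborel cell (\<lambda>x. grad f x \<bullet> grad h x)" "set_integrable lborel cell (\<lambda>x. grad g x \<bullet> grad h x)"
    by (intro set_integrable_cell continuous_on_mult continuous_on_inner assms[THEN Cinf_continuous]
        assms[THEN grad_continuous])+
  have "(LINT x:cell|lborel. (a * f x + c * g x) * h x) = (LINT x:cell|lborel. a * (f x * h x) + c * (g x * h x))"
    by (simp add: algebra_simps)
  also have "\<dots> = a * (LINT x:cell|lborel. f x * h x) + c * (LINT x:cell|lborel. g x * h x)"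
    using 1 by (subst set_integral_add) auto
  finally have A: "(LINT x:cell|lborel. (a * f x + c * g x) * h x) =
    a * (LINT x:cell|lborel. f x * h x) + c * (LINT x:cell|lborel. g x * h x)" .
  have "(LINT x:cell|lborel. grad (\<lambda>x. a * f x + c * g x) x \<bullet> grad h x) =
      (LINT x:cell|lborel. a * (grad f x \<bullet> grad h x) + c * (grad g x \<bullet> grad h x))"
    using assms by (simp add: grad_lin inner_add_left)
  also have "\<dots> = a * (LINT x:cell|lborel. grad f x \<bullet> grad h x) + c * (LINT x:cell|lborel. grad g x \<bullet> grad h x)"
    using 1 by (subst set_integral_add) auto
  finally show ?thesis using A by (simp add: h1_inner_def algebra_simps)
qed

lemma H1_norm_lin_power2:
  assumes "f \<in> Cinf" "g \<in> Cinf"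
  shows "(H1_norm (\<lambda>x. a * f x + c * g x))\<^sup>2 =
    a\<^sup>2 * (H1_norm f)\<^sup>2 + 2 * a * c * h1_inner f g + c\<^sup>2 * (H1_norm g)\<^sup>2"
proof -
  have l: "(\<lambda>x. a * f x + c * g x) \<in> Cinf" by (rule Cinf_lin[OF assms])
  have "h1_inner (\<lambda>x. a * f x + c * g x) (\<lambda>x. a * f x + c * g x) =
      a * h1_inner (\<lambda>x. a * f x + c * g x) f + c * h1_inner (\<lambda>x. a * f x + c * g x) g"
    using h1_inner_lin[OF assms l] by (simp add: h1_inner_commute)
  also have "\<dots> = a * (a * h1_inner f f + c * h1_inner g f) + c * (a * h1_inner f g + c * h1_inner g g)"
    by (simp only: h1_inner_lin[OF assms assms(1)] h1_inner_lin[OF assms assms(2)])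
  finally show ?thesis unfolding H1_norm_power2
    by (simp add: h1_inner_commute[of g f] power2_eq_square algebra_simps)
qed

text \<open>Cauchy-Schwarz, from expanding the nonnegative squared norm of \<epsilon> * f - s * g
  for both signs s. Scaling by the bound \<epsilon> instead of the norm of \<open>g\<close> avoids
  dividing by a norm that may be 0.\<close>

lemma h1_inner_bound:
  assumes "f \<in> Cinf" "g \<in> Cinf" "H1_norm f \<le> 1" "H1_norm g \<le> \<epsilon>" "\<epsilon> > 0"
  shows "\<bar>h1_inner f g\<bar> \<le> \<epsilon>"
proof -
  have "s * h1_inner f g \<le> \<epsilon>" if s: "\<bar>s\<bar> = 1" for s
  proof -
    have s2: "s\<^sup>2 = 1" using s by (metis power2_abs one_power2)
    have "0 \<le> \<epsilon>\<^sup>2 * (H1_norm f)\<^sup>2 + 2 * \<epsilon> * (- s) * h1_inner f g + (- s)\<^sup>2 * (H1_norm g)\<^sup>2"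
      unfolding H1_norm_lin_power2[OF assms(1,2), symmetric] by simp
    then have "2 * \<epsilon> * (s * h1_inner f g) \<le> \<epsilon>\<^sup>2 * (H1_norm f)\<^sup>2 + (H1_norm g)\<^sup>2" using s2 by simp
    moreover have "(H1_norm f)\<^sup>2 \<le> 1" "(H1_norm g)\<^sup>2 \<le> \<epsilon>\<^sup>2"
      using power_mono[OF assms(3) H1_norm_nonneg, of 2] power_mono[OF assms(4) H1_norm_nonneg, of 2] by auto
    moreover have "\<epsilon>\<^sup>2 * (H1_norm f)\<^sup>2 \<le> \<epsilon>\<^sup>2 * 1" using power_mono[OF assms(3) H1_norm_nonneg, of 2] by (intro mult_left_mono) auto
    ultimately have "2 * \<epsilon> * (s * h1_inner f g) \<le> \<epsilon>\<^sup>2 + \<epsilon>\<^sup>2" by linarith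
    then have "2 * \<epsilon> * (s * h1_inner f g) \<le> 2 * \<epsilon> * \<epsilon>" by (simp add: power2_eq_square)
    then show ?thesis using assms(5) by simp
  qed
  from this[of 1] this[of "-1"] show ?thesis by (simp add: abs_le_iff)
qed

lemma label_separable_euclidean: "label_separable (UNIV :: 'a::{metric_space, second_countable_topology} set) dist"
proof -
  obtain D :: "'a set" where D: "countable D" "\<And>X. open X \<Longrightarrow> X \<noteq> {} \<Longrightarrow> \<exists>d\<in>D. d \<in> X"
    using countable_dense_setE by blast
  show ?thesis
  proof (rule label_separable_denseI[where d'=dist and D=D])
    fix x :: 'a and \<epsilon> :: real assume "\<epsilon> > 0"
    then show "\<exists>q\<in>D. dist x q < \<epsilon>" using D(2)[of "ball x \<epsilon>"] by (metis centre_in_ball emptyE mem_ball open_ball)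
  qed (auto simp: D dist_triangle2)
qed

text \<open>A smooth function together with its gradient is a continuous map on the compact cell, so
  \<open>label_paths\<close> labels these pairs in the uniform distance. The cell has measure 1,
  hence pairs within \<epsilon>/2 give a squared H^1 distance of at most \<epsilon>^2/2. The
  distance is written as a linear combination to match the linearity lemmas.\<close>

lemma label_separable_Cinf:
  "label_separable (Cinf :: (real^'n \<Rightarrow> real) set) (\<lambda>f g. H1_norm (\<lambda>x. 1 * f x + (-1) * g x))"
proof (rule label_separableI)
  fix \<epsilon> :: real assume \<epsilon>: "\<epsilon> > 0"
  define jet where "jet f x = (f x, grad f x)" for f and x :: "real^'n"
  have cont: "continuous_on S (jet f)" if "f \<in> Cinf" for f S
    unfolding jet_def[abs_def] using that by (intro continuous_intros Cinf_continuous grad_continuous)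
  obtain \<phi> :: "(real^'n \<Rightarrow> real \<times> (real^'n)) \<Rightarrow> nat" where
    \<phi>: "\<forall>f\<in>jet ` Cinf. \<forall>g\<in>jet ` Cinf. \<phi> f = \<phi> g \<longrightarrow> (\<forall>x\<in>cell. dist (f x) (g x) < \<epsilon> / 2)"
  proof -
    have "\<exists>\<phi>::(real^'n \<Rightarrow> real \<times> (real^'n)) \<Rightarrow> nat.
       \<forall>f\<in>jet ` Cinf. \<forall>g\<in>jet ` Cinf. \<phi> f = \<phi> g \<longrightarrow> (\<forall>x\<in>cell. dist (f x) (g x) < \<epsilon> / 2)"
    proof (rule label_paths[OF compact_cbox label_separable_euclidean])
      fix F and \<eta> :: real assume "F \<in> jet ` Cinf" "\<eta> > 0"
      then have "uniformly_continuous_on cell F" by (auto intro!: compact_uniformly_continuous cont)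
      with \<open>\<eta> > 0\<close> show "\<exists>\<delta>>0. \<forall>x\<in>cell. \<forall>y\<in>cell. dist x y < \<delta> \<longrightarrow> dist (F x) (F y) < \<eta>"
        unfolding uniformly_continuous_on_def by (metis dist_commute)
    qed (use \<epsilon> in \<open>auto simp: dist_triangle dist_commute\<close>)
    then show thesis using that by blast
  qed
  show "\<exists>\<phi>::(real^'n \<Rightarrow> real) \<Rightarrow> nat. \<forall>f\<in>Cinf. \<forall>g\<in>Cinf. \<phi> f = \<phi> g \<longrightarrow> H1_norm (\<lambda>x. 1 * f x + (-1) * g x) < \<epsilon>"
  proof (intro exI[of _ "\<lambda>f. \<phi> (jet f)"] ballI impI)
    fix f g :: "real^'n \<Rightarrow> real" assume fg: "f \<in> Cinf" "g \<in> Cinf" "\<phi> (jet f) = \<phi> (jet g)"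
    let ?h = "\<lambda>x. 1 * f x + (-1) * g x"
    have h: "?h \<in> Cinf" by (rule Cinf_lin[OF fg(1,2)])
    have le: "\<bar>?h x\<bar> \<le> \<epsilon> / 2" "norm (grad ?h x) \<le> \<epsilon> / 2" if "x \<in> cell" for x
    proof -
      have d: "dist (jet f x) (jet g x) < \<epsilon> / 2" using \<phi> fg that by auto
      show "\<bar>?h x\<bar> \<le> \<epsilon> / 2" using d dist_fst_le[of "jet f x" "jet g x"] by (simp add: jet_def dist_real_def)
      show "norm (grad ?h x) \<le> \<epsilon> / 2" unfolding grad_lin[OF fg(1,2)]
        using d dist_snd_le[of "jet f x" "jet g x"] by (simp add: jet_def dist_norm)
    qed
    have "(LINT x:cell|lborel. (?h x)\<^sup>2) \<le> (\<epsilon> / 2)\<^sup>2"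
    proof (rule cell_integral_le)
      show "continuous_on UNIV (\<lambda>x. (?h x)\<^sup>2)" by (intro continuous_on_power Cinf_continuous h)
      show "(?h x)\<^sup>2 \<le> (\<epsilon> / 2)\<^sup>2" if "x \<in> cell" for x
        using power_mono[OF le(1)[OF that], of 2] by simp
    qed
    moreover have "(LINT x:cell|lborel. (norm (grad ?h x))\<^sup>2) \<le> (\<epsilon> / 2)\<^sup>2"
    proof (rule cell_integral_le)
      show "continuous_on UNIV (\<lambda>x. (norm (grad ?h x))\<^sup>2)"
        by (intro continuous_on_power continuous_on_norm grad_continuous h)
      show "(norm (grad ?h x))\<^sup>2 \<le> (\<epsilon> / 2)\<^sup>2" if "x \<in> cell" for x
        using power_mono[OF le(2)[OF that], of 2] by simp
    qed
    moreover have "(\<epsilon> / 2)\<^sup>2 + (\<epsilon> / 2)\<^sup>2 < \<epsilon>\<^sup>2" using \<epsilon> by (simp add: power2_eq_square field_simps)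
    ultimately have "H1_norm ?h < sqrt (\<epsilon>\<^sup>2)" unfolding H1_norm_def by (intro real_sqrt_less_mono) linarith
    then show "H1_norm ?h < \<epsilon>" using \<epsilon> by simp
  qed
qed

section \<open>The dual norm and its approximation by the inner product\<close>

lemma Hm1_lin: "l \<in> Hm1_set \<Longrightarrow> f \<in> Cinf \<Longrightarrow> g \<in> Cinf \<Longrightarrow> l (\<lambda>x. a * f x + c * g x) = a * l f + c * l g"
  by (simp add: Hm1_set_def)

text \<open>\<open>f\<close> is scaled by the inverse of its norm plus a small \<eta>, which brings
  it into the unit ball even if its norm is 0; the extra term K * \<eta> is at most the prescribed
  error.\<close>

lemma Hm1_norm_bound:
  assumes "l \<in> Hm1_set" "f \<in> Cinf"
  shows "\<bar>l f\<bar> \<le> Hm1_norm l * H1_norm f"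
proof (rule field_le_epsilon)
  have ex: "\<exists>K. \<forall>f\<in>Cinf. \<bar>l f\<bar> \<le> K * H1_norm f" using assms(1) by (simp add: Hm1_set_def)
  fix \<epsilon> :: real assume \<epsilon>: "\<epsilon> > 0"
  define K where "K = Hm1_norm l"
  have K: "0 \<le> K" unfolding K_def by (rule Hm1_norm_nonneg[OF ex])
  define \<eta> where "\<eta> = \<epsilon> / (K + 1)"
  have \<eta>: "\<eta> > 0" "K * \<eta> \<le> \<epsilon>" using K \<epsilon> by (auto simp: \<eta>_def field_simps)
  define c where "c = inverse (H1_norm f + \<eta>)"
  have pos: "H1_norm f + \<eta> > 0" using H1_norm_nonneg[of f] \<eta> by simp
  then have c: "c > 0" by (simp add: c_def)
  have "H1_norm (\<lambda>x. c * f x) \<le> 1"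
    unfolding H1_norm_cmult[OF assms(2)] using pos c \<eta> by (simp add: c_def field_simps)
  then have "\<bar>l (\<lambda>x. c * f x)\<bar> \<le> K"
    unfolding K_def Hm1_norm_def using Cinf_cmult[OF assms(2)]
    by (intro cSUP_upper Hm1_norm_bdd[OF ex]) auto
  moreover have "l (\<lambda>x. c * f x) = c * l f"
    using Hm1_lin[OF assms(1) assms(2) assms(2), of c 0] by simp
  ultimately have "c * \<bar>l f\<bar> \<le> K" using c by (simp add: abs_mult)
  then have "\<bar>l f\<bar> \<le> K * (H1_norm f + \<eta>)" using pos by (simp add: c_def field_simps)
  then show "\<bar>l f\<bar> \<le> Hm1_norm l * H1_norm f + \<epsilon>" using \<eta>(2) by (simp add: K_def algebra_simps)
qed

text \<open>An approximate Riesz representation: a unit vector at which a functional almost attains its norm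
  \<open>K\<close> represents it, after scaling by \<open>K\<close>, up to a small error.\<close>

lemma Hm1_approx_representation:
  assumes l: "l \<in> Hm1_set" and \<epsilon>: "\<epsilon> > 0"
  shows "\<exists>G\<in>Cinf. \<forall>f\<in>Cinf. H1_norm f \<le> 1 \<longrightarrow> \<bar>l f - h1_inner f G\<bar> \<le> \<epsilon>"
proof -
  have ex: "\<exists>K. \<forall>f\<in>Cinf. \<bar>l f\<bar> \<le> K * H1_norm f" using l by (simp add: Hm1_set_def)
  define K where "K = Hm1_norm l"
  have K: "0 \<le> K" unfolding K_def by (rule Hm1_norm_nonneg[OF ex])
  \<comment> \<open>The size of the variation used below. The resulting error is t + K * t/2, which
    this value keeps below \<epsilon>.\<close>
  define t where "t = \<epsilon> / (1 + K)"
  have t: "t > 0" "t + K * t / 2 \<le> \<epsilon>"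
  proof -
    show t0: "t > 0" using K \<epsilon> by (simp add: t_def)
    have "t * (1 + K) = \<epsilon>" using K by (simp add: t_def)
    moreover have "0 \<le> K * t" using K t0 by simp
    ultimately show "t + K * t / 2 \<le> \<epsilon>" by (simp add: algebra_simps)
  qed
  have "K - t\<^sup>2 < (SUP f\<in>{f\<in>Cinf. H1_norm f \<le> 1}. \<bar>l f\<bar>)"
    using t(1) unfolding K_def Hm1_norm_def by simp
  \<comment> \<open>The supremum is missed by less than t^2, so that after division by t the defect
    is still of order t.\<close>
  then obtain g0 where g0: "g0 \<in> Cinf" "H1_norm g0 \<le> 1" "K - t\<^sup>2 < \<bar>l g0\<bar>"
    using less_cSUP_iff[OF _ Hm1_norm_bdd[OF ex]] zero_in_H1_ball by blast
  \<comment> \<open>The sign turns the value of \<open>l\<close> into its modulus; the summand with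
    factor 0 puts the scaling in the form of the linearity lemma.\<close>
  define g where "g = (\<lambda>x. sgn (l g0) * g0 x + 0 * g0 x)"
  have g: "g \<in> Cinf" unfolding g_def by (rule Cinf_lin[OF g0(1) g0(1)])
  have lg: "K - t\<^sup>2 < l g"
    unfolding g_def Hm1_lin[OF l g0(1) g0(1)] using g0(3) by (simp add: abs_sgn mult.commute)
  have "H1_norm g \<le> 1 * 1"
    unfolding g_def using H1_norm_cmult[OF g0(1), of "sgn (l g0)"] g0(2)
    by (auto simp: sgn_if)
  then have Hg: "(H1_norm g)\<^sup>2 \<le> 1" using power_mono[OF _ H1_norm_nonneg, of g 1 2] by simp
  define G where "G = (\<lambda>x. K * g x + 0 * g x)"
  have G: "G \<in> Cinf" unfolding G_def by (rule Cinf_lin[OF g g])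
  have "\<bar>l f - h1_inner f G\<bar> \<le> \<epsilon>" if f: "f \<in> Cinf" "H1_norm f \<le> 1" for f
  proof -
    define c where "c = h1_inner g f"
    have fG: "h1_inner f G = K * c"
      using h1_inner_lin[OF g g f(1), of K 0] by (simp add: G_def c_def h1_inner_commute[of f])
    have Hf: "(H1_norm f)\<^sup>2 \<le> 1" using power_mono[OF f(2) H1_norm_nonneg, of 2] by simp
    have "s * (l f - K * c) \<le> \<epsilon>" if s: "\<bar>s\<bar> = 1" for s
    proof -
      have s2: "s\<^sup>2 = 1" using s by (metis power2_abs one_power2)
      \<comment> \<open>First variation at the near-maximizer: the bound of \<open>l ?h\<close> by K
        times the norm of \<open>?h\<close> is expanded to first order in t and compared with
        \<open>l g\<close>. Both signs s are used to bound the modulus.\<close>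
      let ?h = "\<lambda>x. 1 * g x + (t * s) * f x"
      have h: "?h \<in> Cinf" by (rule Cinf_lin[OF g f(1)])
      have "(H1_norm ?h)\<^sup>2 = (H1_norm g)\<^sup>2 + 2 * (t * s) * c + t\<^sup>2 * (H1_norm f)\<^sup>2"
        unfolding H1_norm_lin_power2[OF g f(1)] using s2 by (simp add: c_def power_mult_distrib)
      also have "\<dots> \<le> 1 + 2 * (t * s) * c + t\<^sup>2 * 1"
        using Hg mult_left_mono[OF Hf, of "t\<^sup>2"] by simp
      finally have 1: "(H1_norm ?h)\<^sup>2 \<le> 1 + 2 * (t * s * c) + t\<^sup>2" by simp
      then have pos: "0 \<le> 1 + t * s * c + t\<^sup>2 / 2" using zero_le_power2[of "H1_norm ?h"] by linarith
      \<comment> \<open>The right side exceeds the left by the square of t * s * c + t^2/2; this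
        bounds the norm of \<open>?h\<close> linearly in c without taking a root.\<close>
      have "1 + 2 * (t * s * c) + t\<^sup>2 \<le> (1 + t * s * c + t\<^sup>2 / 2)\<^sup>2"
        using zero_le_power2[of "t * s * c + t\<^sup>2 / 2"] by (simp add: power2_eq_square algebra_simps)
      with 1 have "H1_norm ?h \<le> 1 + t * s * c + t\<^sup>2 / 2"
        by (intro power2_le_imp_le[OF _ pos]) linarith
      then have "K * H1_norm ?h \<le> K * (1 + t * s * c + t\<^sup>2 / 2)" using K by (intro mult_left_mono)
      moreover have "l ?h \<le> K * H1_norm ?h"
        using Hm1_norm_bound[OF l h] by (simp add: K_def abs_le_iff)
      moreover have "l ?h = l g + t * s * l f" by (subst Hm1_lin[OF l g f(1)]) simp
      ultimately have "t * (s * (l f - K * c)) \<le> t * (t + K * t / 2)"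
        using lg by (simp add: power2_eq_square algebra_simps)
      then show ?thesis using t by (metis mult_le_cancel_left_pos order_trans)
    qed
    from this[of 1] this[of "-1"] show ?thesis unfolding fG by (simp add: abs_le_iff)
  qed
  then show ?thesis using G by blast
qed

lemma Hm1_norm_le:
  fixes l :: "(real^'n \<Rightarrow> real) \<Rightarrow> real"
  assumes "\<And>f. f \<in> Cinf \<Longrightarrow> H1_norm f \<le> 1 \<Longrightarrow> \<bar>l f\<bar> \<le> c"
  shows "Hm1_norm l \<le> c"
proof -
  have ne: "{f \<in> Cinf :: (real^'n \<Rightarrow> real) set. H1_norm f \<le> 1} \<noteq> {}" using zero_in_H1_ball by blast
  show ?thesis unfolding Hm1_norm_def by (rule cSUP_least[OF ne]) (use assms in auto)
qed

text \<open>A functional inherits the label of a smooth function that approximately represents it.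
  Two representation errors and the distance of the representatives contribute \<epsilon>/4
  each.\<close>

lemma label_separable_Hm1: "label_separable (Hm1_set :: ((real^'n \<Rightarrow> real) \<Rightarrow> real) set) Hm1_dist"
proof (rule label_separableI)
  fix \<epsilon> :: real assume \<epsilon>: "\<epsilon> > 0"
  obtain \<phi> :: "(real^'n \<Rightarrow> real) \<Rightarrow> nat" where
    \<phi>: "\<And>f g. f \<in> Cinf \<Longrightarrow> g \<in> Cinf \<Longrightarrow> \<phi> f = \<phi> g \<Longrightarrow> H1_norm (\<lambda>x. 1 * f x + (-1) * g x) < \<epsilon> / 4"
    using label_separableE[OF label_separable_Cinf, of "\<epsilon> / 4"] \<epsilon> by auto
  have "\<forall>l\<in>Hm1_set. \<exists>G\<in>Cinf. \<forall>f\<in>Cinf. H1_norm f \<le> 1 \<longrightarrow> \<bar>l f - h1_inner f G\<bar> \<le> \<epsilon> / 4"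
    using \<epsilon> by (intro ballI Hm1_approx_representation) auto
  then obtain G :: "((real^'n \<Rightarrow> real) \<Rightarrow> real) \<Rightarrow> real^'n \<Rightarrow> real" where G: "\<And>l. l \<in> Hm1_set \<Longrightarrow> G l \<in> Cinf"
    "\<And>l f. l \<in> Hm1_set \<Longrightarrow> f \<in> Cinf \<Longrightarrow> H1_norm f \<le> 1 \<Longrightarrow> \<bar>l f - h1_inner f (G l)\<bar> \<le> \<epsilon> / 4"
    by metis
  show "\<exists>\<phi>::((real^'n \<Rightarrow> real) \<Rightarrow> real) \<Rightarrow> nat. \<forall>l\<in>Hm1_set. \<forall>m\<in>Hm1_set. \<phi> l = \<phi> m \<longrightarrow> Hm1_dist l m < \<epsilon>"
  proof (intro exI[of _ "\<lambda>l. \<phi> (G l)"] ballI impI)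
    fix l m :: "(real^'n \<Rightarrow> real) \<Rightarrow> real" assume lm: "l \<in> Hm1_set" "m \<in> Hm1_set" "\<phi> (G l) = \<phi> (G m)"
    let ?D = "\<lambda>x. 1 * G l x + (-1) * G m x"
    have D: "?D \<in> Cinf" "H1_norm ?D \<le> \<epsilon> / 4"
      using \<phi>[OF G(1)[OF lm(1)] G(1)[OF lm(2)] lm(3)] Cinf_lin[OF G(1)[OF lm(1)] G(1)[OF lm(2)], of 1 "-1"] by auto
    have "Hm1_norm (\<lambda>f. l f - m f) \<le> 3 * \<epsilon> / 4"
    proof (rule Hm1_norm_le)
      fix f :: "real^'n \<Rightarrow> real" assume f: "f \<in> Cinf" "H1_norm f \<le> 1"
      have "h1_inner f ?D = h1_inner f (G l) - h1_inner f (G m)"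
        using h1_inner_lin[OF G(1)[OF lm(1)] G(1)[OF lm(2)] f(1), of 1 "-1"]
        by (simp add: h1_inner_commute[of f])
      moreover have "\<bar>h1_inner f ?D\<bar> \<le> \<epsilon> / 4" using f D \<epsilon> by (intro h1_inner_bound) auto
      ultimately show "\<bar>l f - m f\<bar> \<le> 3 * \<epsilon> / 4"
        using G(2)[OF lm(1) f] G(2)[OF lm(2) f] by linarith
    qed
    then show "Hm1_dist l m < \<epsilon>" using lm \<epsilon> by (simp add: Hm1_dist_def)
  qed
qed

text \<open>A countable dense subset of the unit ball of smooth functions already determines the
  dual distance, because differences of functionals are bounded in the H^1 norm. The uncountable
  supremum in the norm thus becomes a countable condition.\<close>

lemma Hm1_countable_norming:
  obtains Q :: "(real^'n \<Rightarrow> real) set" where "countable Q" "Q \<subseteq> Cinf"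
    "\<And>l m c. l \<in> Hm1_set \<Longrightarrow> m \<in> Hm1_set \<Longrightarrow> Hm1_dist l m \<le> c \<longleftrightarrow> (\<forall>h\<in>Q. \<bar>l h - m h\<bar> \<le> c)"
proof -
  have "label_separable {f \<in> Cinf :: (real^'n \<Rightarrow> real) set. H1_norm f \<le> 1} (\<lambda>f g. H1_norm (\<lambda>x. 1 * f x + (-1) * g x))"
    using label_separable_Cinf unfolding label_separable_def by blast
  then obtain Q :: "(real^'n \<Rightarrow> real) set"
    where Q: "countable Q" "Q \<subseteq> {f \<in> Cinf. H1_norm f \<le> 1}"
      "\<And>f \<epsilon>. f \<in> {f \<in> Cinf. H1_norm f \<le> 1} \<Longrightarrow> \<epsilon> > 0 \<Longrightarrow> \<exists>h\<in>Q. H1_norm (\<lambda>x. 1 * f x + (-1) * h x) < \<epsilon>"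
    by (rule label_separable_dense) (rule that)
  show thesis
  proof (rule that[OF Q(1)])
    show "Q \<subseteq> Cinf" using Q(2) by blast
    fix l m :: "(real^'n \<Rightarrow> real) \<Rightarrow> real" and c assume lm: "l \<in> Hm1_set" "m \<in> Hm1_set"
    obtain K where K: "\<And>f. f \<in> Cinf \<Longrightarrow> \<bar>l f - m f\<bar> \<le> K * H1_norm f" using Hm1_diff_bound[OF lm] by blast
    show "Hm1_dist l m \<le> c \<longleftrightarrow> (\<forall>h\<in>Q. \<bar>l h - m h\<bar> \<le> c)"
    proof
      assume le: "Hm1_dist l m \<le> c"
      show "\<forall>h\<in>Q. \<bar>l h - m h\<bar> \<le> c"
      proof
        fix h assume "h \<in> Q"
        then have "h \<in> {f \<in> Cinf. H1_norm f \<le> 1}" using Q(2) by blast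
        from cSUP_upper[OF this Hm1_norm_bdd[OF Hm1_diff_bound[OF lm]]]
        show "\<bar>l h - m h\<bar> \<le> c" using le lm by (simp add: Hm1_dist_def Hm1_norm_def)
      qed
    next
      assume le: "\<forall>h\<in>Q. \<bar>l h - m h\<bar> \<le> c"
      have "Hm1_norm (\<lambda>f. l f - m f) \<le> c"
      proof (rule Hm1_norm_le)
        fix f :: "real^'n \<Rightarrow> real" assume f: "f \<in> Cinf" "H1_norm f \<le> 1"
        show "\<bar>l f - m f\<bar> \<le> c"
        proof (rule field_le_epsilon)
          fix \<epsilon> :: real assume \<epsilon>: "\<epsilon> > 0"
          obtain h where h: "h \<in> Q" "H1_norm (\<lambda>x. 1 * f x + (-1) * h x) < \<epsilon> / (\<bar>K\<bar> + 1)"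
          proof -
            have "0 < \<epsilon> / (\<bar>K\<bar> + 1)" using \<epsilon> by (simp add: add_nonneg_pos)
            then show thesis using Q(3)[of f "\<epsilon> / (\<bar>K\<bar> + 1)"] f that by blast
          qed
          then have hC: "h \<in> Cinf" using Q(2) by blast
          let ?d = "\<lambda>x. 1 * f x + (-1) * h x"
          have "\<bar>l ?d - m ?d\<bar> \<le> K * H1_norm ?d" by (rule K[OF Cinf_lin[OF f(1) hC]])
          also have "\<dots> \<le> (\<bar>K\<bar> + 1) * H1_norm ?d" using H1_norm_nonneg[of ?d] by (intro mult_right_mono) auto
          also have "\<dots> \<le> (\<bar>K\<bar> + 1) * (\<epsilon> / (\<bar>K\<bar> + 1))" using h(2) by (intro mult_left_mono) auto
          also have "\<dots> = \<epsilon>" by (simp add: field_simps add_nonneg_eq_0_iff)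
          finally have "\<bar>(l f - l h) - (m f - m h)\<bar> \<le> \<epsilon>"
            by (simp only: Hm1_lin[OF lm(1) f(1) hC] Hm1_lin[OF lm(2) f(1) hC])
          moreover have "\<bar>l h - m h\<bar> \<le> c" using le h(1) by blast
          ultimately show "\<bar>l f - m f\<bar> \<le> c + \<epsilon>" by linarith
        qed
      qed
      then show "Hm1_dist l m \<le> c" using lm by (simp add: Hm1_dist_def)
    qed
  qed
qed

section \<open>Separability of \<open>L\<^sup>1\<close>\<close>

text \<open>Rational combinations of indicators of finite unions of sets from one fixed countable
  basis, so the set is countable. Basis sets may have infinite measure, hence the intersection with
  the integrable functions.\<close>

definition step_functions :: "('a::euclidean_space \<Rightarrow> real) set" where
  "step_functions = {q. integrable lborel q} \<inter>
     (\<lambda>xs z. \<Sum>(c, Bs)\<leftarrow>xs. real_of_rat c * indicator (\<Union>(set Bs)) z) `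
       lists (UNIV \<times> lists (SOME B. countable B \<and> topological_basis B))"

lemma countable_step_functions: "countable (step_functions :: ('a::euclidean_space \<Rightarrow> real) set)"
proof -
  have "countable (SOME B :: 'a set set. countable B \<and> topological_basis B)"
    by (rule someI2_ex[OF ex_countable_basis]) simp
  then have "countable (lists ((UNIV :: rat set) \<times> lists (SOME B :: 'a set set. countable B \<and> topological_basis B)))"
    by (intro countable_lists countable_SIGMA) auto
  then show ?thesis unfolding step_functions_def by (intro countable_Int2 countable_image)
qed

definition step_approximable :: "('a::euclidean_space \<Rightarrow> real) \<Rightarrow> bool" where
  "step_approximable f \<longleftrightarrow> (\<forall>\<epsilon>>0. \<exists>q\<in>step_functions. (\<integral>x. \<bar>f x - q x\<bar> \<partial>lborel) < \<epsilon>)"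

lemma L1_triangle:
  fixes f g h :: "'a \<Rightarrow> real"
  assumes "integrable M f" "integrable M g" "integrable M h"
  shows "(\<integral>x. \<bar>f x - h x\<bar> \<partial>M) \<le> (\<integral>x. \<bar>f x - g x\<bar> \<partial>M) + (\<integral>x. \<bar>h x - g x\<bar> \<partial>M)"
proof -
  have "(\<integral>x. \<bar>f x - h x\<bar> \<partial>M) \<le> (\<integral>x. \<bar>f x - g x\<bar> + \<bar>h x - g x\<bar> \<partial>M)"
    using assms by (intro integral_mono) auto
  then show ?thesis using assms by (subst (asm) Bochner_Integration.integral_add) auto
qed

lemma step_functions_integrable: "q \<in> step_functions \<Longrightarrow> integrable lborel q"
  by (simp add: step_functions_def)

lemma step_approximable_closed:
  fixes f :: "'a::euclidean_space \<Rightarrow> real"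
  assumes f: "integrable lborel f"
    and g: "\<And>\<epsilon>. \<epsilon> > 0 \<Longrightarrow> \<exists>g. integrable lborel g \<and> step_approximable g \<and> (\<integral>x. \<bar>f x - g x\<bar> \<partial>lborel) < \<epsilon>"
  shows "step_approximable f"
  unfolding step_approximable_def
proof (intro allI impI)
  fix \<epsilon> :: real assume "\<epsilon> > 0"
  then obtain g where g: "integrable lborel g" "step_approximable g" "(\<integral>x. \<bar>f x - g x\<bar> \<partial>lborel) < \<epsilon> / 2"
    using g[of "\<epsilon> / 2"] by auto
  obtain q where q: "q \<in> step_functions" "(\<integral>x. \<bar>g x - q x\<bar> \<partial>lborel) < \<epsilon> / 2"
    using g(2) \<open>\<epsilon> > 0\<close> unfolding step_approximable_def by (meson half_gt_zero)
  have "(\<integral>x. \<bar>f x - q x\<bar> \<partial>lborel) \<le> (\<integral>x. \<bar>f x - g x\<bar> \<partial>lborel) + (\<integral>x. \<bar>q x - g x\<bar> \<partial>lborel)"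
    by (rule L1_triangle[OF f g(1) step_functions_integrable[OF q(1)]])
  also have "\<dots> < \<epsilon>" using g(3) q(2) by (simp add: abs_minus_commute)
  finally show "\<exists>q\<in>step_functions. (\<integral>x. \<bar>f x - q x\<bar> \<partial>lborel) < \<epsilon>" using q(1) by blast
qed

lemma step_approximable_lim:
  fixes f w :: "'a::euclidean_space \<Rightarrow> real" and s :: "nat \<Rightarrow> 'a \<Rightarrow> real"
  assumes f: "integrable lborel f" and s: "\<And>i. integrable lborel (s i)" "\<And>i. step_approximable (s i)"
    and lim: "\<And>x. (\<lambda>i. s i x) \<longlonglongrightarrow> f x" and w: "integrable lborel w" "\<And>i x. \<bar>s i x\<bar> \<le> w x"
  shows "step_approximable f"
proof (rule step_approximable_closed[OF f])
  fix \<epsilon> :: real assume \<epsilon>: "\<epsilon> > 0"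
  have "(\<lambda>i. \<integral>x. \<bar>f x - s i x\<bar> \<partial>lborel) \<longlonglongrightarrow> (\<integral>x. 0 \<partial>(lborel :: 'a measure))"
  proof (rule integral_dominated_convergence[where w="\<lambda>x. \<bar>f x\<bar> + w x"])
    show "integrable lborel (\<lambda>x. \<bar>f x\<bar> + w x)" using f w(1) by auto
    show "(\<lambda>x. \<bar>f x - s i x\<bar>) \<in> borel_measurable lborel" for i using f s(1)[of i] by measurable
    show "AE x in lborel. (\<lambda>i. \<bar>f x - s i x\<bar>) \<longlonglongrightarrow> 0"
    proof (rule AE_I2)
      fix x
      show "(\<lambda>i. \<bar>f x - s i x\<bar>) \<longlonglongrightarrow> 0"
        using tendsto_rabs[OF tendsto_diff[OF tendsto_const[of "f x"] lim[of x]]] by simp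
    qed
    show "AE x in lborel. norm \<bar>f x - s i x\<bar> \<le> \<bar>f x\<bar> + w x" for i
      using w(2)[of i] by (intro AE_I2) (smt (verit, ccfv_SIG) real_norm_def)
  qed simp
  then have "\<forall>\<^sub>F i in sequentially. (\<integral>x. \<bar>f x - s i x\<bar> \<partial>lborel) < \<epsilon>"
    using \<epsilon> by (simp add: order_tendsto_iff)
  then obtain i where "(\<integral>x. \<bar>f x - s i x\<bar> \<partial>lborel) < \<epsilon>" by (auto simp: eventually_sequentially)
  then show "\<exists>g. integrable lborel g \<and> step_approximable g \<and> (\<integral>x. \<bar>f x - g x\<bar> \<partial>lborel) < \<epsilon>" using s by blast
qed

text \<open>The class of sets widens in stages. For finite unions of basis sets only the real factor
  has to be approximated by rationals; an open set is an increasing limit of such unions; a Borel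
  set of finite measure is approximated from outside by open sets.\<close>

lemma step_approximable_indicator:
  fixes A :: "'a::euclidean_space set"
  assumes A: "A \<in> sets borel" "emeasure lborel A < \<infinity>"
  shows "step_approximable (\<lambda>x. indicator A x * c)"
proof -
  define B where "B = (SOME B :: 'a set set. countable B \<and> topological_basis B)"
  have B: "countable B \<and> topological_basis B"
    unfolding B_def by (rule someI_ex[OF ex_countable_basis])
  have unions: "step_approximable (\<lambda>x. indicator (\<Union>(set Bs)) x * c)"
    if Bs: "Bs \<in> lists B" "emeasure lborel (\<Union>(set Bs)) < \<infinity>" for Bs and c :: real
  proof -
    have "open (\<Union>(set Bs))" using Bs(1) B topological_basis_open by (intro open_Union) auto
    then have int: "integrable lborel (\<lambda>x. indicator (\<Union>(set Bs)) x * c)" for c :: real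
      using Bs(2) by (intro integrable_mult_left integrable_real_indicator) auto
    have "\<exists>r. real_of_rat r \<in> {c - inverse (real (Suc n)) <..< c + inverse (real (Suc n))}" for n
      using of_rat_dense[of "c - inverse (real (Suc n))" "c + inverse (real (Suc n))"] by (auto simp del: of_nat_Suc)
    then obtain r where r: "\<And>n. real_of_rat (r n) \<in> {c - inverse (real (Suc n)) <..< c + inverse (real (Suc n))}" by metis
    have rc: "\<bar>real_of_rat (r n) - c\<bar> \<le> inverse (real (Suc n))" for n
      using r[of n] by (auto simp: abs_le_iff simp del: of_nat_Suc)
    have "(\<lambda>n. real_of_rat (r n) - c) \<longlonglongrightarrow> 0"
      by (rule Lim_null_comparison[OF _ LIMSEQ_inverse_real_of_nat])
         (intro always_eventually allI, simp only: real_norm_def rc)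
    then have rlim: "(\<lambda>n. real_of_rat (r n)) \<longlonglongrightarrow> c" by (simp add: LIM_zero_cancel)
    show ?thesis
    proof (rule step_approximable_lim[where s="\<lambda>n x. indicator (\<Union>(set Bs)) x * real_of_rat (r n)"
          and w="\<lambda>x. indicator (\<Union>(set Bs)) x * (\<bar>c\<bar> + 1)"])
      fix n
      have "(\<lambda>x. indicator (\<Union>(set Bs)) x * real_of_rat (r n)) \<in> step_functions"
        unfolding step_functions_def B_def[symmetric] using int[of "real_of_rat (r n)"] Bs(1)
        by (intro IntI image_eqI[of _ _ "[(r n, Bs)]"]) (auto simp: mult.commute)
      then show "step_approximable (\<lambda>x. indicator (\<Union>(set Bs)) x * real_of_rat (r n))"
        unfolding step_approximable_def by (intro allI impI bexI[of _ "\<lambda>x. indicator (\<Union>(set Bs)) x * real_of_rat (r n)"]) auto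
      have "inverse (real (Suc n)) \<le> 1" by (simp add: field_simps)
      then have "\<bar>real_of_rat (r n)\<bar> \<le> \<bar>c\<bar> + 1" using rc[of n] by linarith
      then show "\<bar>indicator (\<Union>(set Bs)) x * real_of_rat (r n)\<bar> \<le> indicator (\<Union>(set Bs)) x * (\<bar>c\<bar> + 1)" for x
        by (simp add: indicator_def)
    qed (intro int tendsto_mult_left rlim)+
  qed
  have opens: "step_approximable (\<lambda>x. indicator U x * c)" if U: "open U" "emeasure lborel U < \<infinity>" for U :: "'a set" and c :: real
  proof -
    obtain B' where B': "B' \<subseteq> B" "\<Union>B' = U" using B U(1) unfolding topological_basis_def by blast
    have cB': "countable B'" using B B'(1) countable_subset by blast
    show ?thesis
    proof (cases "B' = {}")
      case True
      then have "U = {}" using B' by auto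
      then show ?thesis using unions[of "[]" c] by simp
    next
      case False
      define V where "V n = (\<Union>i<n. from_nat_into B' i)" for n :: nat
      have VU: "V n \<subseteq> U" for n using B'(2) from_nat_into[OF False] by (auto simp: V_def)
      have V: "V n = \<Union>(set (map (from_nat_into B') [0..<n]))" for n by (auto simp: V_def)
      have oV: "open (V n)" for n
        unfolding V_def using B B'(1) from_nat_into[OF False] topological_basis_open by (intro open_UN) blast
      have eV: "emeasure lborel (V n) < \<infinity>" for n
        using emeasure_mono[OF VU[of n], of lborel] U by (auto simp: less_top[symmetric] top_unique)
      have int: "integrable lborel (\<lambda>x. indicator W x * d)" if "open W" "emeasure lborel W < \<infinity>" for W :: "'a set" and d :: real
        using that by (intro integrable_mult_left integrable_real_indicator) auto
      show ?thesis
      proof (rule step_approximable_lim[where s="\<lambda>n x. indicator (V n) x * c" and w="\<lambda>x. indicator U x * \<bar>c\<bar>"])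
        show "step_approximable (\<lambda>x. indicator (V n) x * c)" for n
          using eV[of n] subsetD[OF B'(1) from_nat_into[OF False]] unfolding V by (intro unions) auto
        show "\<bar>indicator (V n) x * c\<bar> \<le> indicator U x * \<bar>c\<bar>" for n x
          using VU[of n] by (auto simp: indicator_def)
        show "(\<lambda>n. indicator (V n) x * c) \<longlonglongrightarrow> indicator U x * c" for x
        proof (cases "x \<in> U")
          case True
          then obtain X where "X \<in> B'" "x \<in> X" using B' by blast
          then obtain i where "x \<in> from_nat_into B' i" using from_nat_into_surj[OF cB'] by metis
          then have "x \<in> V n" if "n > i" for n using that by (auto simp: V_def)
          then have "\<forall>\<^sub>F n in sequentially. indicator (V n) x * c = indicator U x * c"
            using True unfolding eventually_sequentially by (intro exI[of _ "Suc i"]) simp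
          then show ?thesis by (rule tendsto_eventually)
        next
          case False
          then have "x \<notin> V n" for n using VU by blast
          then show ?thesis using False by simp
        qed
      qed (intro int U oV eV)+
    qed
  qed
  show ?thesis
  proof (rule step_approximable_closed)
    show "integrable lborel (\<lambda>x. indicator A x * c)"
      using A by (intro integrable_mult_left integrable_real_indicator) auto
    fix \<epsilon> :: real assume \<epsilon>: "\<epsilon> > 0"
    define \<delta> where "\<delta> = \<epsilon> / (\<bar>c\<bar> + 1)"
    have \<delta>: "\<delta> > 0" using \<epsilon> by (simp add: \<delta>_def add_nonneg_pos)
    then obtain U where U: "open U" "A \<subseteq> U" "emeasure lborel (U - A) < ennreal \<delta>"
      using outer_regular_lborel[OF A(1), of \<delta>] by auto
    have UA: "U - A \<in> sets lborel" using U A by auto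
    have "emeasure lborel U \<le> emeasure lborel A + emeasure lborel (U - A)"
      using emeasure_subadditive[of A lborel "U - A"] A UA U(2) by (simp add: Un_absorb1)
    also have "\<dots> < \<infinity>" using A U(3) by (auto simp: less_top[symmetric] ennreal_add_eq_top dest: less_trans)
    finally have fU: "emeasure lborel U < \<infinity>" .
    have iU: "integrable lborel (\<lambda>x. indicator U x * c)"
      using U(1) fU by (intro integrable_mult_left integrable_real_indicator) auto
    have "(\<integral>x. \<bar>indicator A x * c - indicator U x * c\<bar> \<partial>lborel) = (\<integral>x. \<bar>c\<bar> * indicator (U - A) x \<partial>lborel)"
      using U(2) by (intro Bochner_Integration.integral_cong) (auto simp: indicator_def)
    also have "\<dots> = \<bar>c\<bar> * measure lborel (U - A)" by simp
    also have "\<dots> \<le> \<bar>c\<bar> * \<delta>"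
    proof (rule mult_left_mono)
      show "measure lborel (U - A) \<le> \<delta>"
        using U(3) \<delta> unfolding measure_def by (intro enn2real_leI) auto
    qed simp
    also have "\<dots> < \<epsilon>" using \<epsilon> by (simp add: \<delta>_def field_simps)
    finally show "\<exists>g. integrable lborel g \<and> step_approximable g \<and> (\<integral>x. \<bar>indicator A x * c - g x\<bar> \<partial>lborel) < \<epsilon>"
      using iU opens[OF U(1) fU, of c] by blast
  qed
qed

text \<open>Induction over integrable functions. Sums are handled by concatenating the lists that
  define two step functions, limits by domination.\<close>

lemma step_approximable_integrable:
  fixes f :: "'a::euclidean_space \<Rightarrow> real"
  assumes "integrable lborel f" shows "step_approximable f"
  using assms
proof (induction rule: integrable_induct)
  case (base A c)
  then show ?case using step_approximable_indicator[of A c] by simp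
next
  case (add f g)
  show ?case unfolding step_approximable_def
  proof (intro allI impI)
    fix \<epsilon> :: real assume \<epsilon>: "\<epsilon> > 0"
    obtain p where p: "p \<in> step_functions" "(\<integral>x. \<bar>f x - p x\<bar> \<partial>lborel) < \<epsilon> / 2"
      using add \<epsilon> unfolding step_approximable_def by (meson half_gt_zero)
    obtain q where q: "q \<in> step_functions" "(\<integral>x. \<bar>g x - q x\<bar> \<partial>lborel) < \<epsilon> / 2"
      using add \<epsilon> unfolding step_approximable_def by (meson half_gt_zero)
    note int = step_functions_integrable[OF p(1)] step_functions_integrable[OF q(1)] add(1,2)
    have "(\<lambda>x. p x + q x) \<in> step_functions"
    proof -
      obtain xs where xs: "xs \<in> lists (UNIV \<times> lists (SOME B :: 'a set set. countable B \<and> topological_basis B))"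
        "p = (\<lambda>z. \<Sum>(c, Bs)\<leftarrow>xs. real_of_rat c * indicator (\<Union>(set Bs)) z)"
        using p(1) unfolding step_functions_def by blast
      obtain ys where ys: "ys \<in> lists (UNIV \<times> lists (SOME B :: 'a set set. countable B \<and> topological_basis B))"
        "q = (\<lambda>z. \<Sum>(c, Bs)\<leftarrow>ys. real_of_rat c * indicator (\<Union>(set Bs)) z)"
        using q(1) unfolding step_functions_def by blast
      have eq: "(\<lambda>x. p x + q x) = (\<lambda>z. \<Sum>(c, Bs)\<leftarrow>xs @ ys. real_of_rat c * indicator (\<Union>(set Bs)) z)"
        using xs(2) ys(2) by simp
      have "integrable lborel (\<lambda>x. p x + q x)" using int by auto
      moreover have "xs @ ys \<in> lists (UNIV \<times> lists (SOME B :: 'a set set. countable B \<and> topological_basis B))"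
        using conjI[OF xs(1) ys(1)] by (rule append_in_lists_conv[THEN iffD2])
      ultimately show ?thesis unfolding step_functions_def
        by (intro IntI CollectI) (assumption, rule image_eqI[of _ _ "xs @ ys"], rule eq, assumption)
    qed
    moreover have "(\<integral>x. \<bar>(f x + g x) - (p x + q x)\<bar> \<partial>lborel) \<le> (\<integral>x. \<bar>f x - p x\<bar> + \<bar>g x - q x\<bar> \<partial>lborel)"
      using int add by (intro integral_mono) auto
    moreover have "\<dots> = (\<integral>x. \<bar>f x - p x\<bar> \<partial>lborel) + (\<integral>x. \<bar>g x - q x\<bar> \<partial>lborel)"
      using int add by (intro Bochner_Integration.integral_add) auto
    ultimately show "\<exists>q\<in>step_functions. (\<integral>x. \<bar>f x + g x - q x\<bar> \<partial>lborel) < \<epsilon>"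
      using p(2) q(2) by (intro bexI[of _ "\<lambda>x. p x + q x"]) auto
  qed
next
  case (lim f s)
  then show ?case by - (rule step_approximable_lim[where s=s and w="\<lambda>x. 2 * \<bar>f x\<bar>"], simp_all)
qed

lemma label_separable_L1:
  "label_separable {f :: 'a::euclidean_space \<Rightarrow> real. integrable lborel f} (\<lambda>f g. \<integral>x. \<bar>f x - g x\<bar> \<partial>lborel)"
proof (rule label_separable_denseI[OF countable_step_functions])
  fix f :: "'a \<Rightarrow> real" and \<epsilon> :: real assume "f \<in> {f. integrable lborel f}" "\<epsilon> > 0"
  then show "\<exists>q\<in>step_functions. (\<integral>x. \<bar>f x - q x\<bar> \<partial>lborel) < \<epsilon>"
    using step_approximable_integrable unfolding step_approximable_def by blast
qed (auto intro!: L1_triangle step_functions_integrable)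

section \<open>Separability of the path spaces\<close>

text \<open>Heine-Cantor on the compact interval, for paths with values in an arbitrary metric
  space.\<close>

lemma cfunspace_interval_uniform:
  assumes "f \<in> mspace (cfunspace (top_of_set {0..t}) m)" "\<epsilon> > 0"
  shows "\<exists>\<delta>>0. \<forall>x\<in>{0..t}. \<forall>y\<in>{0..t::real}. dist x y < \<delta> \<longrightarrow> mdist m (f x) (f y) < \<epsilon>"
proof -
  have top: "mtopology_of (submetric euclidean_metric {0..t}) = top_of_set {0..t}"
    by (simp add: mtopology_of_submetric)
  have "continuous_map (top_of_set {0..t}) (mtopology_of m) f" using assms(1) by (simp add: mspace_cfunspace)
  then have "uniformly_continuous_map (submetric euclidean_metric {0..t}) m f"
    by (intro continuous_imp_uniformly_continuous_map) (simp add: top compact_space_subtopology)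
  then obtain \<delta> where "\<delta> > 0" "\<forall>x\<in>{0..t}. \<forall>y\<in>{0..t}. dist y x < \<delta> \<longrightarrow> mdist m (f y) (f x) < \<epsilon>"
    using assms(2) unfolding uniformly_continuous_map_def by auto
  then show ?thesis by blast
qed

lemma label_cfunspace:
  assumes Q: "label_separable (mspace m) (mdist m)" and \<epsilon>: "\<epsilon> > 0"
  shows "\<exists>\<phi>::(real \<Rightarrow> 'b) \<Rightarrow> nat. \<forall>f\<in>mspace (cfunspace (top_of_set {0..t}) m).
    \<forall>g\<in>mspace (cfunspace (top_of_set {0..t}) m). \<phi> f = \<phi> g \<longrightarrow> mdist (cfunspace (top_of_set {0..t}) m) f g < \<epsilon>"
proof -
  have "\<exists>\<phi>::(real \<Rightarrow> 'b) \<Rightarrow> nat. \<forall>f\<in>mspace (cfunspace (top_of_set {0..t}) m).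
    \<forall>g\<in>mspace (cfunspace (top_of_set {0..t}) m). \<phi> f = \<phi> g \<longrightarrow> (\<forall>x\<in>{0..t}. mdist m (f x) (g x) < \<epsilon> / 2)"
  proof (rule label_paths[OF compact_Icc Q])
    show "f x \<in> mspace m" if "f \<in> mspace (cfunspace (top_of_set {0..t}) m)" "x \<in> {0..t}" for f x
      using that by (auto simp: mspace_cfunspace)
  qed (use \<epsilon> in \<open>simp_all add: mdist_triangle mdist_commute cfunspace_interval_uniform del: mspace_cfunspace\<close>)
  then obtain \<phi> :: "(real \<Rightarrow> 'b) \<Rightarrow> nat" where \<phi>: "\<forall>f\<in>mspace (cfunspace (top_of_set {0..t}) m).
    \<forall>g\<in>mspace (cfunspace (top_of_set {0..t}) m). \<phi> f = \<phi> g \<longrightarrow> (\<forall>x\<in>{0..t}. mdist m (f x) (g x) < \<epsilon> / 2)" by blast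
  show ?thesis
  proof (intro exI[of _ \<phi>] ballI impI)
    fix f g assume fg: "f \<in> mspace (cfunspace (top_of_set {0..t}) m)" "g \<in> mspace (cfunspace (top_of_set {0..t}) m)" "\<phi> f = \<phi> g"
    \<comment> \<open>Strict bounds at all times give only a weak bound for the supremum, hence the
      labels at scale \<epsilon>/2.\<close>
    have "mdist (cfunspace (top_of_set {0..t}) m) f g \<le> \<epsilon> / 2"
      using \<phi> fg \<epsilon> by (intro mdist_cfunspace_le) (auto intro!: less_imp_le)
    then show "mdist (cfunspace (top_of_set {0..t}) m) f g < \<epsilon>" using \<epsilon> by simp
  qed
qed

lemma label_separable_XW:
  assumes "enlarged_space e (J :: 'u::{real_inner,complete_space} \<Rightarrow> 'w::banach)"
  shows "label_separable (mspace (XW t :: (real \<Rightarrow> 'w) metric)) (mdist (XW t))"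
  unfolding XW_def
proof (rule label_separableI)
  fix \<epsilon> :: real assume \<epsilon>: "\<epsilon> > 0"
  show "\<exists>\<phi>::(real \<Rightarrow> 'w) \<Rightarrow> nat. \<forall>f\<in>mspace (cfunspace (top_of_set {0..t}) euclidean_metric).
      \<forall>g\<in>mspace (cfunspace (top_of_set {0..t}) euclidean_metric).
      \<phi> f = \<phi> g \<longrightarrow> mdist (cfunspace (top_of_set {0..t}) euclidean_metric) f g < \<epsilon>"
    by (rule label_cfunspace[OF _ \<epsilon>]) (simp add: label_separable_enlarged[OF assms])
qed

text \<open>Each part of the distance has its label: a density of the path, extended by 0 to an
  integrable function on the whole space, and the path as a continuous map into the dual space.
  \<open>L1_norm_eq\<close> lets the chosen densities compute the first part.\<close>

lemma label_separable_Xu: "label_separable (Xu_set t :: (real \<Rightarrow> (real^'n \<Rightarrow> real) \<Rightarrow> real) set) (Xu_dist t)"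
proof (rule label_separableI)
  fix \<epsilon> :: real assume \<epsilon>: "\<epsilon> > 0"
  define K :: "(real \<times> (real^'n)) set" where "K = {0..t} \<times> cell"
  define r where "r u = (SOME f. L1_rep t u f)" for u :: "real \<Rightarrow> (real^'n \<Rightarrow> real) \<Rightarrow> real"
  have r: "L1_rep t u (r u)" if "u \<in> Xu_set t" for u
  proof -
    have "\<exists>f. L1_rep t u f" using that unfolding Xu_set_def by blast
    from someI_ex[OF this] show ?thesis by (simp add: r_def)
  qed
  obtain \<phi>1 :: "(real \<times> (real^'n) \<Rightarrow> real) \<Rightarrow> nat" where
    \<phi>1: "\<And>f g. integrable lborel f \<Longrightarrow> integrable lborel g \<Longrightarrow> \<phi>1 f = \<phi>1 g \<Longrightarrow> (\<integral>z. \<bar>f z - g z\<bar> \<partial>lborel) < \<epsilon> / 2"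
    using label_separableE[OF label_separable_L1, of "\<epsilon> / 2"] \<epsilon> by auto
  have "label_separable (mspace Hm1) (mdist (Hm1 :: ((real^'n \<Rightarrow> real) \<Rightarrow> real) metric))"
    using label_separable_Hm1 by simp
  from label_cfunspace[OF this, of "\<epsilon> / 2" t]
  obtain \<phi>2 :: "(real \<Rightarrow> (real^'n \<Rightarrow> real) \<Rightarrow> real) \<Rightarrow> nat" where
    \<phi>2: "\<forall>f\<in>mspace (cfunspace (top_of_set {0..t}) Hm1). \<forall>g\<in>mspace (cfunspace (top_of_set {0..t}) Hm1).
      \<phi>2 f = \<phi>2 g \<longrightarrow> mdist (cfunspace (top_of_set {0..t}) Hm1) f g < \<epsilon> / 2"
    using \<epsilon> by auto
  show "\<exists>\<phi>::(real \<Rightarrow> (real^'n \<Rightarrow> real) \<Rightarrow> real) \<Rightarrow> nat \<times> nat.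
      \<forall>u\<in>Xu_set t. \<forall>v\<in>Xu_set t. \<phi> u = \<phi> v \<longrightarrow> Xu_dist t u v < \<epsilon>"
  proof (intro exI[of _ "\<lambda>u. (\<phi>1 (\<lambda>z. indicator K z *\<^sub>R r u z), \<phi>2 u)"] ballI impI)
    fix u v :: "real \<Rightarrow> (real^'n \<Rightarrow> real) \<Rightarrow> real"
    assume uv: "u \<in> Xu_set t" "v \<in> Xu_set t"
      and eq: "(\<phi>1 (\<lambda>z. indicator K z *\<^sub>R r u z), \<phi>2 u) = (\<phi>1 (\<lambda>z. indicator K z *\<^sub>R r v z), \<phi>2 v)"
    have "integrable lborel (\<lambda>z. indicator K z *\<^sub>R r u z)" "integrable lborel (\<lambda>z. indicator K z *\<^sub>R r v z)"
      using r[OF uv(1)] r[OF uv(2)] by (auto simp: L1_rep_def set_integrable_def K_def)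
    with eq have "(\<integral>z. \<bar>indicator K z *\<^sub>R r u z - indicator K z *\<^sub>R r v z\<bar> \<partial>lborel) < \<epsilon> / 2"
      by (intro \<phi>1) auto
    moreover have "(\<integral>z. \<bar>indicator K z *\<^sub>R r u z - indicator K z *\<^sub>R r v z\<bar> \<partial>lborel) = (LINT z:K|lborel. \<bar>r u z - r v z\<bar>)"
      unfolding set_lebesgue_integral_def by (intro Bochner_Integration.integral_cong) (auto simp: indicator_def)
    moreover have "L1_norm t (\<lambda>s g. u s g - v s g) = (LINT z:K|lborel. \<bar>r u z - r v z\<bar>)"
      unfolding K_def by (rule L1_norm_eq[OF L1_rep_diff[OF r[OF uv(1)] r[OF uv(2)]]])
    moreover have "mdist (cfunspace (top_of_set {0..t}) Hm1) u v < \<epsilon> / 2"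
      using \<phi>2 uv eq unfolding Xu_set_def by blast
    ultimately show "Xu_dist t u v < \<epsilon>" using uv by (simp add: Xu_dist_def)
  qed
qed

section \<open>Restriction of paths\<close>

lemma time_cell_borel: "{0..s::real} \<times> (cell :: (real^'n) set) \<in> sets borel"
  by (intro borel_closed closed_Times closed_atLeastAtMost closed_cbox)

lemma cfunspace_restrict:
  assumes f: "f \<in> mspace (cfunspace (top_of_set {0..t}) m)" and s: "s \<le> (t::real)"
  shows "restrict f {0..s} \<in> mspace (cfunspace (top_of_set {0..s}) m)"
proof -
  have sub: "{0..s} \<subseteq> {0..t}" using s by auto
  have "continuous_map (top_of_set {0..s}) (mtopology_of m) f"
    using f sub by (auto simp: mspace_cfunspace intro: continuous_map_from_subtopology_mono)
  then have "continuous_map (top_of_set {0..s}) (mtopology_of m) (restrict f {0..s})"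
    by (rule continuous_map_eq) simp
  moreover have "f x \<in> mspace m" if "x \<in> {0..s}" for x
    using f sub that by (auto simp: mspace_cfunspace)
  moreover have "Metric_space.mbounded (mspace m) (mdist m) (restrict f {0..s} ` {0..s})"
  proof (rule Metric_space.mbounded_subset[OF Metric_space_mspace_mdist])
    show "Metric_space.mbounded (mspace m) (mdist m) (f ` {0..t})"
      using f by (simp add: mspace_cfunspace)
    show "restrict f {0..s} ` {0..s} \<subseteq> f ` {0..t}" using sub by auto
  qed
  ultimately show ?thesis by (simp add: mspace_cfunspace Pi_iff)
qed

lemma mdist_cfunspace_restrict:
  assumes "f \<in> mspace (cfunspace (top_of_set {0..t}) m)" "g \<in> mspace (cfunspace (top_of_set {0..t}) m)" "s \<le> (t::real)"
  shows "mdist (cfunspace (top_of_set {0..s}) m) (restrict f {0..s}) (restrict g {0..s})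
    \<le> mdist (cfunspace (top_of_set {0..t}) m) f g"
proof (rule mdist_cfunspace_le)
  fix x assume "x \<in> topspace (top_of_set {0..s})"
  then have "mdist m (f x) (g x) \<le> mdist (cfunspace (top_of_set {0..t}) m) f g"
    using assms(3) by (intro mdist_cfunspace_imp_mdist_le[OF assms(1,2) order_refl]) auto
  then show "mdist m (restrict f {0..s} x) (restrict g {0..s} x) \<le> mdist (cfunspace (top_of_set {0..t}) m) f g"
    using \<open>x \<in> topspace (top_of_set {0..s})\<close> by simp
qed simp

lemma L1_rep_restrict:
  assumes f: "L1_rep t u f" and s: "s \<le> t"
  shows "L1_rep s (restrict u {0..s}) f"
proof -
  have "set_integrable lborel ({0..s} \<times> cell) f"
  proof (rule set_integrable_subset)
    show "set_integrable lborel ({0..t} \<times> cell) f" using f by (simp add: L1_rep_def)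
    show "{0..s} \<times> cell \<in> sets lborel" by (simp only: sets_lborel time_cell_borel)
    show "{0..s} \<times> cell \<subseteq> {0..t} \<times> cell" using s by auto
  qed
  moreover have "AE r in lborel. r \<in> {0..s} \<longrightarrow> (\<forall>g\<in>Cinf. restrict u {0..s} r g = distr_of (\<lambda>x. f (r, x)) g)"
    using f[unfolded L1_rep_def, THEN conjunct2] by eventually_elim (use s in auto)
  ultimately show ?thesis by (simp add: L1_rep_def)
qed

lemma Xu_restrict:
  assumes "u \<in> Xu_set t" "s \<le> t" shows "restrict u {0..s} \<in> Xu_set s"
  using assms unfolding Xu_set_def by (blast intro: cfunspace_restrict L1_rep_restrict)

text \<open>The same densities represent the restricted paths, so both the integral and the supremum
  can only decrease.\<close>

lemma Xu_dist_restrict: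
  fixes u v :: "real \<Rightarrow> (real^'n \<Rightarrow> real) \<Rightarrow> real"
  assumes uv: "u \<in> Xu_set t" "v \<in> Xu_set t" and s: "s \<le> t"
  shows "Xu_dist s (restrict u {0..s}) (restrict v {0..s}) \<le> Xu_dist t u v"
proof -
  obtain f h where f: "L1_rep t u f" and h: "L1_rep t v h" using uv unfolding Xu_set_def by blast
  let ?d = "\<lambda>z. \<bar>f z - h z\<bar>"
  have eqT: "L1_norm t (\<lambda>s g. u s g - v s g) = (LINT z:{0..t} \<times> cell|lborel. ?d z)"
    by (rule L1_norm_eq[OF L1_rep_diff[OF f h]])
  have eqs: "L1_norm s (\<lambda>r g. restrict u {0..s} r g - restrict v {0..s} r g) = (LINT z:{0..s} \<times> cell|lborel. ?d z)"
    by (rule L1_norm_eq[OF L1_rep_diff[OF L1_rep_restrict[OF f s] L1_rep_restrict[OF h s]]])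
  have I: "set_integrable lborel ({0..t} \<times> cell) ?d"
    using L1_rep_diff[OF f h] by (auto simp: L1_rep_def intro!: set_integrable_abs)
  have Is: "set_integrable lborel ({0..s} \<times> cell) ?d"
    using L1_rep_diff[OF L1_rep_restrict[OF f s] L1_rep_restrict[OF h s]] by (auto simp: L1_rep_def intro!: set_integrable_abs)
  have "(LINT z:{0..s} \<times> cell|lborel. ?d z) \<le> (LINT z:{0..t} \<times> cell|lborel. ?d z)"
    unfolding set_lebesgue_integral_def
    using I Is s by (intro integral_mono) (auto simp: set_integrable_def split: split_indicator)
  moreover have "mdist (cfunspace (top_of_set {0..s}) Hm1) (restrict u {0..s}) (restrict v {0..s})
    \<le> mdist (cfunspace (top_of_set {0..t}) Hm1) u v"
    using uv s unfolding Xu_set_def by (intro mdist_cfunspace_restrict) auto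
  ultimately show ?thesis
    using uv Xu_restrict[OF uv(1) s] Xu_restrict[OF uv(2) s] by (simp add: Xu_dist_def eqT eqs del: restrict_apply)
qed

lemma continuous_map_Xu_restrict:
  assumes "s \<le> t"
  shows "continuous_map (mtopology_of (Xu t)) (mtopology_of (Xu s)) (\<lambda>u. restrict u {0..s})"
  by (rule Lipschitz_continuous_imp_continuous_map)
    (use assms in \<open>auto simp: Lipschitz_continuous_map_def Xu_restrict intro!: exI[of _ 1] Xu_dist_restrict\<close>)

lemma continuous_map_XW_restrict:
  assumes "s \<le> t"
  shows "continuous_map (mtopology_of (XW t)) (mtopology_of (XW s)) (\<lambda>w. restrict w {0..s})"
  unfolding XW_def
  by (rule Lipschitz_continuous_imp_continuous_map)
    (use assms in \<open>auto simp: Lipschitz_continuous_map_def simp del: mspace_cfunspace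
      intro!: exI[of _ 1] mdist_cfunspace_restrict cfunspace_restrict\<close>)

definition restrict_paths ::
  "real \<Rightarrow> (real \<Rightarrow> (real^'n \<Rightarrow> real) \<Rightarrow> real) \<times> (real \<Rightarrow> 'w::banach) \<Rightarrow> (real \<Rightarrow> (real^'n \<Rightarrow> real) \<Rightarrow> real) \<times> (real \<Rightarrow> 'w)" where
  "restrict_paths s = (\<lambda>(u, w). (restrict u {0..s}, restrict w {0..s}))"

lemma continuous_map_restrict_paths:
  "s \<le> t \<Longrightarrow> continuous_map (X_topology t) (X_topology s) (restrict_paths s)"
  unfolding X_topology_def restrict_paths_def continuous_map_prod_top
  by (auto intro: continuous_map_Xu_restrict continuous_map_XW_restrict)

text \<open>Evaluation at a time is 1-Lipschitz in the supremum distance and the k-th coordinate is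
  k-Lipschitz in the norm.\<close>

lemma continuous_map_XW_coord:
  assumes J: "enlarged_space e (J :: 'u::{real_inner,complete_space} \<Rightarrow> 'w::banach)" and k: "1 \<le> k" and s: "s \<in> {0..t}"
  shows "continuous_map (mtopology_of (XW t)) euclideanreal (\<lambda>w. coord e J (w s) k)"
proof -
  have "Lipschitz_continuous_map (XW t :: (real \<Rightarrow> 'w) metric) euclidean_metric (\<lambda>w. coord e J (w s) k)"
    unfolding Lipschitz_continuous_map_def
  proof (intro conjI exI[of _ "real k"] ballI)
    fix v w :: "real \<Rightarrow> 'w" assume vw: "v \<in> mspace (XW t)" "w \<in> mspace (XW t)"
    have "mdist euclidean_metric (v s) (w s) \<le> mdist (XW t) v w"
      using vw s unfolding XW_def by (intro mdist_cfunspace_imp_mdist_le[OF _ _ order_refl]) auto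
    then have "real k * dist (v s) (w s) \<le> real k * mdist (XW t) v w" by (intro mult_left_mono) auto
    then show "mdist euclidean_metric (coord e J (v s) k) (coord e J (w s) k) \<le> real k * mdist (XW t) v w"
      using coord_Lipschitz[OF J k, of "v s" "w s"] by (simp add: dist_real_def)
  qed auto
  from Lipschitz_continuous_imp_continuous_map[OF this] show ?thesis by simp
qed

lemma metrizable_mtopology_of: "metrizable_space (mtopology_of m)"
  unfolding mtopology_of_def by (rule Metric_space.metrizable_space_mtopology[OF Metric_space_mspace_mdist])

lemma metrizable_X_topology: "metrizable_space (X_topology t)"
  unfolding X_topology_def by (simp add: metrizable_space_prod_topology metrizable_mtopology_of)

section \<open>Measurability through closed balls\<close>

lemma openin_mtopology_of_ball:
  assumes "openin (mtopology_of m) V" "x \<in> V"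
  shows "\<exists>r>0. \<forall>y\<in>mspace m. mdist m x y < r \<longrightarrow> y \<in> V"
proof -
  interpret Metric_space "mspace m" "mdist m" by (rule Metric_space_mspace_mdist)
  obtain r where r: "r > 0" "mball x r \<subseteq> V" "V \<subseteq> mspace m"
    using assms unfolding mtopology_of_def openin_mtopology by blast
  show ?thesis
  proof (intro exI conjI ballI impI)
    fix y assume "y \<in> mspace m" "mdist m x y < r"
    then have "y \<in> mball x r" using r(3) assms(2) by auto
    then show "y \<in> V" using r(2) by blast
  qed (rule r(1))
qed

text \<open>An open set of the product is covered by countably many products of closed balls
  contained in it, with centres in countable dense sets and radii 1/(n+1). The maps are considered
  on a set \<open>\<Omega>\<close> only, since the paths are known to lie in the path spaces only
  off a null set.\<close>

lemma sets_preimage_prod: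
  assumes sep: "label_separable (mspace m1) (mdist m1)" "label_separable (mspace m2) (mdist m2)"
    and Z: "\<And>\<omega>. \<omega> \<in> \<Omega> \<Longrightarrow> Z1 \<omega> \<in> mspace m1" "\<And>\<omega>. \<omega> \<in> \<Omega> \<Longrightarrow> Z2 \<omega> \<in> mspace m2"
    and balls1: "\<And>v r. v \<in> mspace m1 \<Longrightarrow> {\<omega>\<in>\<Omega>. mdist m1 (Z1 \<omega>) v \<le> r} \<in> sets N"
    and balls2: "\<And>v r. v \<in> mspace m2 \<Longrightarrow> {\<omega>\<in>\<Omega>. mdist m2 (Z2 \<omega>) v \<le> r} \<in> sets N"
    and U: "openin (prod_topology (mtopology_of m1) (mtopology_of m2)) U"
  shows "{\<omega>\<in>\<Omega>. (Z1 \<omega>, Z2 \<omega>) \<in> U} \<in> sets N"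
proof -
  obtain D1 where D1: "countable D1" "D1 \<subseteq> mspace m1"
    "\<And>x \<epsilon>. x \<in> mspace m1 \<Longrightarrow> \<epsilon> > 0 \<Longrightarrow> \<exists>y\<in>D1. mdist m1 x y < \<epsilon>"
    by (rule label_separable_dense[OF sep(1)]) (rule that)
  obtain D2 where D2: "countable D2" "D2 \<subseteq> mspace m2"
    "\<And>x \<epsilon>. x \<in> mspace m2 \<Longrightarrow> \<epsilon> > 0 \<Longrightarrow> \<exists>y\<in>D2. mdist m2 x y < \<epsilon>"
    by (rule label_separable_dense[OF sep(2)]) (rule that)
  define good where "good = (\<lambda>(v, w, n::nat). \<forall>x\<in>mspace m1. \<forall>y\<in>mspace m2.
      mdist m1 x v \<le> inverse (real (Suc n)) \<and> mdist m2 y w \<le> inverse (real (Suc n)) \<longrightarrow> (x, y) \<in> U)"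
  define I where "I = {p \<in> D1 \<times> D2 \<times> UNIV. good p}"
  have cI: "countable I" unfolding I_def using D1(1) D2(1) by (intro countable_Collect countable_SIGMA) auto
  define S where "S = (\<lambda>(v, w, n::nat). {\<omega>\<in>\<Omega>. mdist m1 (Z1 \<omega>) v \<le> inverse (real (Suc n))} \<inter>
      {\<omega>\<in>\<Omega>. mdist m2 (Z2 \<omega>) w \<le> inverse (real (Suc n))})"
  have "{\<omega>\<in>\<Omega>. (Z1 \<omega>, Z2 \<omega>) \<in> U} = (\<Union>p\<in>I. S p)"
  proof (intro equalityI subsetI)
    fix \<omega> assume "\<omega> \<in> {\<omega>\<in>\<Omega>. (Z1 \<omega>, Z2 \<omega>) \<in> U}"
    then have \<omega>: "\<omega> \<in> \<Omega>" "(Z1 \<omega>, Z2 \<omega>) \<in> U" by auto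
    obtain V1 V2 where V: "openin (mtopology_of m1) V1" "openin (mtopology_of m2) V2"
      "Z1 \<omega> \<in> V1" "Z2 \<omega> \<in> V2" "V1 \<times> V2 \<subseteq> U"
      using U[unfolded openin_prod_topology_alt, rule_format, OF \<omega>(2)] by blast
    obtain r1 where r1: "r1 > 0" "\<And>x. x \<in> mspace m1 \<Longrightarrow> mdist m1 (Z1 \<omega>) x < r1 \<Longrightarrow> x \<in> V1"
      using openin_mtopology_of_ball[OF V(1,3)] by blast
    obtain r2 where r2: "r2 > 0" "\<And>y. y \<in> mspace m2 \<Longrightarrow> mdist m2 (Z2 \<omega>) y < r2 \<Longrightarrow> y \<in> V2"
      using openin_mtopology_of_ball[OF V(2,4)] by blast
    \<comment> \<open>Half the radius suffices: every point of a ball around a nearby centre is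
      within two such radii of the given point.\<close>
    obtain n where n: "inverse (real (Suc n)) < min r1 r2 / 2"
      using reals_Archimedean[of "min r1 r2 / 2"] r1 r2 by auto
    have pos: "inverse (real (Suc n)) > 0" by simp
    obtain v where v: "v \<in> D1" "mdist m1 (Z1 \<omega>) v < inverse (real (Suc n))" using D1(3)[OF Z(1)[OF \<omega>(1)] pos] by blast
    obtain w where w: "w \<in> D2" "mdist m2 (Z2 \<omega>) w < inverse (real (Suc n))" using D2(3)[OF Z(2)[OF \<omega>(1)] pos] by blast
    have vw: "v \<in> mspace m1" "w \<in> mspace m2" using v w D1(2) D2(2) by auto
    have "good (v, w, n)" unfolding good_def
    proof (clarify)
      fix x y assume x: "x \<in> mspace m1" "mdist m1 x v \<le> inverse (real (Suc n))"
        and y: "y \<in> mspace m2" "mdist m2 y w \<le> inverse (real (Suc n))"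
      have "mdist m1 (Z1 \<omega>) x \<le> mdist m1 (Z1 \<omega>) v + mdist m1 v x" using Z(1)[OF \<omega>(1)] vw x by (intro mdist_triangle) auto
      then have "mdist m1 (Z1 \<omega>) x < r1" using v(2) x(2) n by (simp add: mdist_commute[of _ v x])
      then have "x \<in> V1" by (rule r1(2)[OF x(1)])
      have "mdist m2 (Z2 \<omega>) y \<le> mdist m2 (Z2 \<omega>) w + mdist m2 w y" using Z(2)[OF \<omega>(1)] vw y by (intro mdist_triangle) auto
      then have "mdist m2 (Z2 \<omega>) y < r2" using w(2) y(2) n by (simp add: mdist_commute[of _ w y])
      then have "y \<in> V2" by (rule r2(2)[OF y(1)])
      with \<open>x \<in> V1\<close> V(5) show "(x, y) \<in> U" by blast
    qed
    then have "(v, w, n) \<in> I" using v w by (simp add: I_def)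
    moreover have "\<omega> \<in> S (v, w, n)" using \<omega> v w by (simp add: S_def)
    ultimately show "\<omega> \<in> (\<Union>p\<in>I. S p)" by blast
  next
    fix \<omega> assume "\<omega> \<in> (\<Union>p\<in>I. S p)"
    then obtain v w n where "(v, w, n) \<in> I" "\<omega> \<in> S (v, w, n)" by auto
    then have "\<omega> \<in> \<Omega>" "good (v, w, n)" "mdist m1 (Z1 \<omega>) v \<le> inverse (real (Suc n))" "mdist m2 (Z2 \<omega>) w \<le> inverse (real (Suc n))"
      unfolding I_def S_def by auto
    then show "\<omega> \<in> {\<omega>\<in>\<Omega>. (Z1 \<omega>, Z2 \<omega>) \<in> U}" using Z unfolding good_def by blast
  qed
  also have "\<dots> \<in> sets N"
  proof (rule sets.countable_UN''[OF cI])
    fix p assume "p \<in> I"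
    obtain v w n where p: "p = (v, w, n)" by (cases p) auto
    then have "v \<in> mspace m1" "w \<in> mspace m2" using \<open>p \<in> I\<close> D1(2) D2(2) by (auto simp: I_def)
    then show "S p \<in> sets N" unfolding S_def p by (auto intro!: sets.Int balls1 balls2)
  qed
  finally show ?thesis .
qed

text \<open>Uniform continuity lets a countable dense set of times determine the supremum distance.
  The set \<open>D\<close> is chosen before the paths; 0 \<le> s makes the interval nonempty, so
  that the distance is a supremum over times.\<close>

lemma cfunspace_countable_times:
  fixes s :: real
  obtains D where "countable D" "D \<subseteq> {0..s}"
    "\<And>m f g c. f \<in> mspace (cfunspace (top_of_set {0..s}) m) \<Longrightarrow> g \<in> mspace (cfunspace (top_of_set {0..s}) m) \<Longrightarrow> 0 \<le> s \<Longrightarrow>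
      mdist (cfunspace (top_of_set {0..s}) m) f g \<le> c \<longleftrightarrow> (\<forall>t\<in>D. mdist (m :: 'b metric) (f t) (g t) \<le> c)"
proof -
  have "label_separable {0..s} dist"
    using label_separable_euclidean unfolding label_separable_def by blast
  then obtain D where D: "countable D" "D \<subseteq> {0..s}" "\<And>x \<epsilon>. x \<in> {0..s} \<Longrightarrow> \<epsilon> > 0 \<Longrightarrow> \<exists>y\<in>D. dist x y < \<epsilon>"
    by (rule label_separable_dense) (rule that)
  show thesis
  proof (rule that[OF D(1,2)])
    fix m :: "'b metric" and f g c
    assume fg: "f \<in> mspace (cfunspace (top_of_set {0..s}) m)" "g \<in> mspace (cfunspace (top_of_set {0..s}) m)" and s: "0 \<le> s"
    have in_m: "f t \<in> mspace m" "g t \<in> mspace m" if "t \<in> {0..s}" for t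
      using fg that by (auto simp: mspace_cfunspace)
    have ne: "topspace (top_of_set {0..s}) \<noteq> {}" using s by auto
    show "mdist (cfunspace (top_of_set {0..s}) m) f g \<le> c \<longleftrightarrow> (\<forall>t\<in>D. mdist m (f t) (g t) \<le> c)"
      unfolding cfunspace_mdist_le[OF fg ne]
    proof
      assume le: "\<forall>t\<in>D. mdist m (f t) (g t) \<le> c"
      show "\<forall>t\<in>topspace (top_of_set {0..s}). mdist m (f t) (g t) \<le> c"
      proof
        fix t assume "t \<in> topspace (top_of_set {0..s})"
        then have t: "t \<in> {0..s}" by simp
        show "mdist m (f t) (g t) \<le> c"
        proof (rule field_le_epsilon)
          fix \<epsilon> :: real assume \<epsilon>: "\<epsilon> > 0"
          obtain \<delta>1 where \<delta>1: "\<delta>1 > 0" "\<forall>x\<in>{0..s}. \<forall>y\<in>{0..s}. dist x y < \<delta>1 \<longrightarrow> mdist m (f x) (f y) < \<epsilon> / 2"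
            using cfunspace_interval_uniform[OF fg(1), of "\<epsilon> / 2"] \<epsilon> by auto
          obtain \<delta>2 where \<delta>2: "\<delta>2 > 0" "\<forall>x\<in>{0..s}. \<forall>y\<in>{0..s}. dist x y < \<delta>2 \<longrightarrow> mdist m (g x) (g y) < \<epsilon> / 2"
            using cfunspace_interval_uniform[OF fg(2), of "\<epsilon> / 2"] \<epsilon> by auto
          obtain r where r: "r \<in> D" "dist t r < min \<delta>1 \<delta>2" using D(3)[OF t, of "min \<delta>1 \<delta>2"] \<delta>1 \<delta>2 by auto
          then have rs: "r \<in> {0..s}" using D(2) by blast
          have "mdist m (f t) (g t) \<le> mdist m (f t) (f r) + mdist m (f r) (g t)"
            using in_m t rs by (intro mdist_triangle) auto
          also have "mdist m (f r) (g t) \<le> mdist m (f r) (g r) + mdist m (g r) (g t)"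
            using in_m t rs by (intro mdist_triangle) auto
          finally have 1: "mdist m (f t) (g t) \<le> mdist m (f t) (f r) + mdist m (f r) (g r) + mdist m (g r) (g t)" by simp
          have "mdist m (f t) (f r) < \<epsilon> / 2" using \<delta>1(2) t rs r(2) by auto
          moreover have "mdist m (g r) (g t) < \<epsilon> / 2" using \<delta>2(2) t rs r(2) by (auto simp: dist_commute)
          moreover have "mdist m (f r) (g r) \<le> c" using le r(1) by blast
          ultimately show "mdist m (f t) (g t) \<le> c + \<epsilon>" using 1 by simp
        qed
      qed
    qed (use D(2) in auto)
  qed
qed

text \<open>The second argument is replaced by simple functions converging to it. With finitely many
  values of that argument joint measurability is clear, and continuity in it gives the
  limit.\<close>

lemma caratheodory_measurable:
  fixes \<phi> :: "'z \<Rightarrow> 'b::{metric_space, second_countable_topology} \<Rightarrow> real"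
  assumes m: "\<And>x. (\<lambda>z. \<phi> z x) \<in> borel_measurable N" and c: "\<And>z. z \<in> space N \<Longrightarrow> continuous_on UNIV (\<phi> z)"
  shows "(\<lambda>(z, x). \<phi> z x) \<in> borel_measurable (N \<Otimes>\<^sub>M borel)"
proof -
  obtain r :: "nat \<Rightarrow> 'b \<Rightarrow> 'b" where r: "\<And>i. simple_function borel (r i)" "\<And>x. (\<lambda>i. r i x) \<longlonglongrightarrow> x"
    using borel_measurable_implies_sequence_metric[of "\<lambda>x::'b. x" borel undefined] by auto
  show ?thesis
  proof (rule borel_measurable_LIMSEQ_real[where u="\<lambda>i (z, x). \<phi> z (r i x)"])
    fix p assume "p \<in> space (N \<Otimes>\<^sub>M (borel :: 'b measure))"
    then have "fst p \<in> space N" by (auto simp: space_pair_measure)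
    from continuous_on_tendsto_compose[OF c[OF this] r(2)[of "snd p"]]
    show "(\<lambda>i. case p of (z, x) \<Rightarrow> \<phi> z (r i x)) \<longlonglongrightarrow> (case p of (z, x) \<Rightarrow> \<phi> z x)"
      by (simp add: case_prod_beta)
  next
    fix i
    have fin: "finite (range (r i))" using simple_functionD(1)[OF r(1)[of i]] by simp
    have ri: "r i \<in> measurable borel (count_space (range (r i)))"
      using fin simple_functionD(2)[OF r(1)[of i]]
      by (subst measurable_count_space_eq2) auto
    have "(\<lambda>p. (\<lambda>y p. \<phi> (fst p) y) (r i (snd p)) p) \<in> borel_measurable (N \<Otimes>\<^sub>M borel)"
    proof (rule measurable_compose_countable'[where I="range (r i)"])
      show "(\<lambda>p. r i (snd p)) \<in> measurable (N \<Otimes>\<^sub>M borel) (count_space (range (r i)))"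
        by (rule measurable_compose[OF measurable_snd ri])
      show "(\<lambda>p. \<phi> (fst p) y) \<in> borel_measurable (N \<Otimes>\<^sub>M borel)" for y
        by (rule measurable_compose[OF measurable_fst m])
    qed (use fin in \<open>simp add: countable_finite\<close>)
    then show "(\<lambda>(z, x). \<phi> z (r i x)) \<in> borel_measurable (N \<Otimes>\<^sub>M borel)" by (simp add: case_prod_beta)
  qed
qed

section \<open>Adaptedness of the approximate solutions as random paths\<close>

lemma openin_Cinf_ball:
  "f \<in> Cinf \<Longrightarrow> openin Cinf_topology {g \<in> Cinf. Cinf_seminorm [] (\<lambda>x. g x - f x) < r}"
  unfolding Cinf_topology_def
  by (intro topology_generated_by_Basis CollectI exI[of _ "[]"] exI[of _ f] exI[of _ r]) auto

lemma topspace_Cinf [simp]: "topspace Cinf_topology = Cinf"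
proof -
  have "f \<in> topspace Cinf_topology" if f: "f \<in> Cinf" for f :: "real^'n \<Rightarrow> real"
  proof -
    have "Cinf_seminorm [] (\<lambda>x. f x - f x) < 1" by (simp add: Cinf_seminorm_def)
    then have "f \<in> {g \<in> Cinf. Cinf_seminorm [] (\<lambda>x. g x - f x) < 1}" using f by simp
    then show ?thesis using openin_subset[OF openin_Cinf_ball[OF f]] by blast
  qed
  moreover have "topspace Cinf_topology \<subseteq> (Cinf :: (real^'n \<Rightarrow> real) set)"
    unfolding Cinf_topology_def topology_generated_by_topspace by auto
  ultimately show ?thesis by blast
qed

section \<open>Periodicity and evaluation at a point\<close>

lemma periodic_int_shift:
  fixes f :: "real^'n \<Rightarrow> 'b"
  assumes "periodic f" shows "f (x + axis i (of_int n)) = f x"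
proof -
  have nat: "f (x + axis i (real n)) = f x" for n x
  proof (induction n arbitrary: x)
    case 0
    have "axis i (real 0) = (0 :: real^'n)" by (simp add: axis_def vec_eq_iff)
    then show ?case by (simp only: add_0_right)
  next
    case (Suc n)
    have "x + axis i (real (Suc n)) = (x + axis i 1) + axis i (real n)" by (simp add: axis_def vec_eq_iff)
    then have "f (x + axis i (real (Suc n))) = f (x + axis i 1)" by (simp only: Suc)
    then show ?case using assms by (simp only: periodic_def)
  qed
  show ?thesis
  proof (cases n rule: int_cases)
    case (nonneg m)
    then show ?thesis using nat[of x m] by simp
  next
    case (neg m)
    have "x = (x + axis i (of_int n)) + axis i (real (Suc m))" by (simp add: neg axis_def vec_eq_iff)
    then show ?thesis using nat[of "x + axis i (of_int n)" "Suc m"] by metis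
  qed
qed

text \<open>Fractional parts in all coordinates. Consequently continuous periodic functions are
  bounded, so that the supremum in \<open>Cinf_seminorm\<close> really dominates the values.\<close>

lemma periodic_in_cell:
  fixes f :: "real^'n \<Rightarrow> 'b"
  assumes "periodic f" shows "\<exists>y\<in>cell. f x = f y"
proof -
  have "f (y + (\<Sum>i\<in>I. axis i (of_int (m i)))) = f y" if "finite I" for I and m :: "'n \<Rightarrow> int" and y
    using that
  proof (induction I arbitrary: y)
    case (insert j I)
    have "f (y + (\<Sum>i\<in>insert j I. axis i (of_int (m i)))) = f ((y + axis j (of_int (m j))) + (\<Sum>i\<in>I. axis i (of_int (m i))))"
      using insert by (simp add: add.assoc)
    then show ?case by (simp only: insert(3) periodic_int_shift[OF assms])
  qed simp
  then have *: "f (y + (\<Sum>i\<in>UNIV. axis i (of_int (m i)))) = f y" for y and m :: "'n \<Rightarrow> int" by simp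
  define y :: "real^'n" where "y = (\<chi> i. frac (x $ i))"
  have "(\<Sum>i\<in>UNIV. axis i (of_int \<lfloor>x $ i\<rfloor>)) $ j = real_of_int \<lfloor>x $ j\<rfloor>" for j
    by (simp add: axis_def if_distrib cong: if_cong)
  then have "x = y + (\<Sum>i\<in>UNIV. axis i (of_int \<lfloor>x $ i\<rfloor>))"
    by (simp add: vec_eq_iff y_def frac_def)
  then have "f x = f y" using *[of y "\<lambda>i. \<lfloor>x $ i\<rfloor>"] by simp
  moreover have "y \<in> cell" by (auto simp: y_def mem_box_cart frac_lt_1 less_imp_le)
  ultimately show ?thesis by blast
qed

text \<open>The seminorm of order 0 is the uniform norm and controls the value at \<open>x\<close>.
  This passes measurability from a process of smooth functions to its values at points.\<close>

lemma continuous_map_eval: "continuous_map Cinf_topology euclideanreal (\<lambda>f :: real^'n \<Rightarrow> real. f x)"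
  unfolding continuous_map_def
proof (intro conjI allI impI)
  fix V :: "real set" assume "openin euclideanreal V"
  then have V: "open V" by simp
  show "openin Cinf_topology {f \<in> topspace Cinf_topology. (f :: real^'n \<Rightarrow> real) x \<in> V}"
  proof (subst openin_subopen, intro ballI)
    fix f :: "real^'n \<Rightarrow> real" assume f: "f \<in> {f \<in> topspace Cinf_topology. f x \<in> V}"
    then obtain r where r: "r > 0" "ball (f x) r \<subseteq> V" using V openE by blast
    let ?B = "{g \<in> Cinf. Cinf_seminorm [] (\<lambda>x. g x - f x) < r}"
    have "openin Cinf_topology ?B" using f by (intro openin_Cinf_ball) simp
    moreover have "f \<in> ?B" using f r by (simp add: Cinf_seminorm_def)
    moreover have "?B \<subseteq> {f \<in> topspace Cinf_topology. f x \<in> V}"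
    proof
      fix g assume g: "g \<in> ?B"
      have d: "(\<lambda>x. 1 * g x + (-1) * f x) \<in> Cinf" using f g by (intro Cinf_lin) auto
      then have d': "periodic (\<lambda>x. g x - f x)" "continuous_on cell (\<lambda>x. g x - f x)"
        using Cinf_continuous[OF d] by (auto simp: Cinf_def)
      have "bounded ((\<lambda>x. g x - f x) ` cell)"
        by (intro compact_imp_bounded compact_continuous_image d' compact_cbox)
      then obtain K where K: "\<And>y. y \<in> cell \<Longrightarrow> \<bar>g y - f y\<bar> \<le> K" by (auto simp: bounded_iff)
      have "\<bar>g y - f y\<bar> \<le> K" for y using periodic_in_cell[OF d'(1), of y] K by auto
      then have "\<bar>g x - f x\<bar> \<le> Cinf_seminorm [] (\<lambda>x. g x - f x)"
        unfolding Cinf_seminorm_def by (auto intro!: cSUP_upper bdd_aboveI2)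
      then have "g x \<in> ball (f x) r" using g by (auto simp: dist_real_def)
      then show "g \<in> {f \<in> topspace Cinf_topology. f x \<in> V}" using g r(2) by auto
    qed
    ultimately show "\<exists>T. openin Cinf_topology T \<and> f \<in> T \<and> T \<subseteq> {f \<in> topspace Cinf_topology. f x \<in> V}" by blast
  qed
qed auto

text \<open>For 0 \<le> s this projects the real line onto [0,s]. Composing with it gives functions
  of all real times, so that products with the full Borel sigma-algebra can be used in place of
  subspaces of the time axis.\<close>

definition clamp_time :: "real \<Rightarrow> real \<Rightarrow> real" where "clamp_time s t = max 0 (min s t)"

lemma clamp_time_id [simp]: "0 \<le> t \<Longrightarrow> t \<le> s \<Longrightarrow> clamp_time s t = t"
  by (simp add: clamp_time_def)

lemma clamp_time_measurable [measurable]: "clamp_time s \<in> borel_measurable borel"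
  unfolding clamp_time_def[abs_def] by measurable

lemma stochastic_basisD:
  assumes "stochastic_basis M F"
  shows "prob_space M" "complete_measure M" "\<forall>t\<ge>0. subalgebra M (F t)"
    "\<forall>s t. 0 \<le> s \<and> s \<le> t \<longrightarrow> sets (F s) \<subseteq> sets (F t)" "null_sets M \<subseteq> sets (F 0)"
  using assms unfolding stochastic_basis_def by - (elim conjE, assumption)+

lemma basis_subalgebra:
  assumes "stochastic_basis M F" "0 \<le> t"
  shows "space (F t) = space M" "sets (F t) \<subseteq> sets M"
proof -
  have "subalgebra M (F t)" using stochastic_basisD(3)[OF assms(1)] assms(2) by blast
  then show "space (F t) = space M" "sets (F t) \<subseteq> sets M" by (simp_all add: subalgebra_def)
qed

lemma basis_mono: "stochastic_basis M F \<Longrightarrow> 0 \<le> s \<Longrightarrow> s \<le> t \<Longrightarrow> sets (F s) \<subseteq> sets (F t)"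
  using stochastic_basisD(4) by blast

lemma basis_null:
  assumes "stochastic_basis M F" "0 \<le> s" shows "null_sets M \<subseteq> sets (F s)"
proof -
  show ?thesis
    using stochastic_basisD(5)[OF assms(1)] basis_mono[OF assms(1) order_refl assms(2)] by blast
qed

text \<open>Predictable processes are progressively measurable. For a generator (a,b] x E with a < s
  the set \<open>E\<close> belongs to \<open>F s\<close> by monotonicity; for a \<ge> s the clamped
  time never enters the interval.\<close>

lemma predictable_clamp:
  assumes F: "stochastic_basis M F" and s: "0 \<le> s" "s \<le> T"
  shows "(\<lambda>(\<omega>, t). (clamp_time s t, \<omega>)) \<in> measurable (F s \<Otimes>\<^sub>M borel) (predictable_algebra M F T)"
  unfolding predictable_algebra_def
proof (rule measurable_measure_of)
  have sp: "space (F s \<Otimes>\<^sub>M borel) = space M \<times> (UNIV :: real set)"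
    using basis_subalgebra[OF F s(1)] by (simp add: space_pair_measure)
  show "{{0} \<times> E |E. E \<in> sets (F 0)} \<union> {{a<..b} \<times> E |a b E. 0 \<le> a \<and> a \<le> b \<and> b \<le> T \<and> E \<in> sets (F a)}
      \<subseteq> Pow ({0..T} \<times> space M)"
  proof -
    have "E \<subseteq> space M" if "E \<in> sets (F a)" "0 \<le> a" for E a
      using sets.sets_into_space[OF that(1)] basis_subalgebra[OF F that(2)] by simp
    then show ?thesis using s by fastforce
  qed
  show "(\<lambda>(\<omega>, t). (clamp_time s t, \<omega>)) \<in> space (F s \<Otimes>\<^sub>M borel) \<rightarrow> {0..T} \<times> space M"
    using s by (auto simp: sp clamp_time_def)
  fix P assume P: "P \<in> {{0} \<times> E |E. E \<in> sets (F 0)} \<union> {{a<..b} \<times> E |a b E. 0 \<le> a \<and> a \<le> b \<and> b \<le> T \<and> E \<in> sets (F a)}"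
  then consider E where "P = {0} \<times> E" "E \<in> sets (F 0)"
    | a b E where "P = {a<..b} \<times> E" "0 \<le> a" "E \<in> sets (F a)" by blast
  then show "(\<lambda>(\<omega>, t). (clamp_time s t, \<omega>)) -` P \<inter> space (F s \<Otimes>\<^sub>M borel) \<in> sets (F s \<Otimes>\<^sub>M borel)"
  proof cases
    case 1
    have E: "E \<in> sets (F s)" using 1 basis_mono[OF F _ s(1)] by auto
    have "(\<lambda>(\<omega>, t). (clamp_time s t, \<omega>)) -` P \<inter> space (F s \<Otimes>\<^sub>M borel) = E \<times> (clamp_time s -` {0} \<inter> space borel)"
      using sets.sets_into_space[OF E] basis_subalgebra[OF F s(1)] by (auto simp: 1 sp)
    also have "\<dots> \<in> sets (F s \<Otimes>\<^sub>M borel)"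
      using E measurable_sets[OF clamp_time_measurable, of "{0}" s] by (intro pair_measureI) auto
    finally show ?thesis .
  next
    case 2
    show ?thesis
    proof (cases "a < s")
      case True
      have E: "E \<in> sets (F s)" using 2 True basis_mono[OF F, of a s] by auto
      have "(\<lambda>(\<omega>, t). (clamp_time s t, \<omega>)) -` P \<inter> space (F s \<Otimes>\<^sub>M borel) = E \<times> (clamp_time s -` {a<..b} \<inter> space borel)"
        using sets.sets_into_space[OF E] basis_subalgebra[OF F s(1)] by (auto simp: 2 sp)
      also have "\<dots> \<in> sets (F s \<Otimes>\<^sub>M borel)"
        using E measurable_sets[OF clamp_time_measurable, of "{a<..b}" s] by (intro pair_measureI) auto
      finally show ?thesis .
    next
      case False
      then have "(\<lambda>(\<omega>, t). (clamp_time s t, \<omega>)) -` P \<inter> space (F s \<Otimes>\<^sub>M borel) = {}"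
        using s by (auto simp: 2 clamp_time_def)
      then show ?thesis by simp
    qed
  qed
qed

context
  fixes M :: "'a measure" and F :: "real \<Rightarrow> 'a measure" and T s :: real
    and u :: "real \<Rightarrow> 'a \<Rightarrow> real^'n \<Rightarrow> real"
  assumes F: "stochastic_basis M F" and s: "0 \<le> s" "s \<le> T"
    and u: "(\<lambda>(t, \<omega>). u t \<omega>) \<in> measurable (predictable_algebra M F T) (borel_of Cinf_topology)"
begin

lemma clamped_measurable: "(\<lambda>(\<omega>, t). u (clamp_time s t) \<omega>) \<in> measurable (F s \<Otimes>\<^sub>M borel) (borel_of Cinf_topology)"
  using measurable_compose[OF predictable_clamp[OF F s] u] by (simp add: case_prod_beta)

lemma clamped_Cinf: "\<omega> \<in> space M \<Longrightarrow> u (clamp_time s t) \<omega> \<in> Cinf"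
  using measurable_space[OF clamped_measurable, of "(\<omega>, t)"] basis_subalgebra[OF F s(1)]
  by (simp add: space_pair_measure)

text \<open>Measurable in (\<omega>, t) for every fixed point of space, and continuous in space
  because the values are smooth.\<close>

lemma clamped_joint: "(\<lambda>((\<omega>, t), x). u (clamp_time s t) \<omega> x) \<in> borel_measurable ((F s \<Otimes>\<^sub>M borel) \<Otimes>\<^sub>M borel)"
proof -
  have "(\<lambda>(z, x). (\<lambda>(\<omega>, t). u (clamp_time s t) \<omega>) z x) \<in> borel_measurable ((F s \<Otimes>\<^sub>M borel) \<Otimes>\<^sub>M borel)"
  proof (rule caratheodory_measurable)
    show "(\<lambda>z. (\<lambda>(\<omega>, t). u (clamp_time s t) \<omega>) z x) \<in> borel_measurable (F s \<Otimes>\<^sub>M borel)" for x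
      using measurable_compose[OF clamped_measurable continuous_map_measurable[OF continuous_map_eval]] by simp
    show "continuous_on UNIV ((\<lambda>(\<omega>, t). u (clamp_time s t) \<omega>) z)" if "z \<in> space (F s \<Otimes>\<^sub>M borel)" for z
      using that basis_subalgebra[OF F s(1)]
      by (auto simp: space_pair_measure intro!: Cinf_continuous clamped_Cinf)
  qed
  then show ?thesis by (simp add: case_prod_unfold)
qed

lemma clamped_joint_pair:
  "(\<lambda>(\<omega>, z). u (clamp_time s (fst z)) \<omega> (snd z)) \<in> borel_measurable (F s \<Otimes>\<^sub>M borel)"
proof -
  have "(\<lambda>p. ((fst p, fst (snd p)), snd (snd p))) \<in> measurable (F s \<Otimes>\<^sub>M (borel \<Otimes>\<^sub>M borel)) ((F s \<Otimes>\<^sub>M borel) \<Otimes>\<^sub>M borel)"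
    by measurable
  from measurable_compose[OF this clamped_joint] show ?thesis by (simp add: case_prod_unfold borel_prod)
qed

text \<open>The solution itself is a density of its path. Membership of the path in
  \<open>Xu_set\<close> yields some integrable density; slicewise uniqueness identifies it with the
  jointly measurable solution, which thereby inherits integrability.\<close>

lemma clamped_rep:
  assumes \<omega>: "\<omega> \<in> space M" and p: "restrict (\<lambda>t. distr_of (u t \<omega>)) {0..s} \<in> Xu_set s"
  shows "L1_rep s (restrict (\<lambda>t. distr_of (u t \<omega>)) {0..s}) (\<lambda>z. u (clamp_time s (fst z)) \<omega> (snd z))"
    (is "L1_rep s ?p ?U")
proof -
  obtain f where f: "L1_rep s ?p f" using p unfolding Xu_set_def by blast
  have K: "{0..s} \<times> (cell :: (real^'n) set) \<in> sets borel" by (rule time_cell_borel)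
  have U: "?U \<in> borel_measurable borel"
    using measurable_compose[OF measurable_Pair1' clamped_joint_pair, of \<omega>] \<omega> basis_subalgebra[OF F s(1)] by simp
  have Um: "set_borel_measurable lborel ({0..s} \<times> cell) ?U"
    unfolding set_borel_measurable_def using U K by simp
  have fi: "set_integrable lborel ({0..s} \<times> cell) f" using f by (simp add: L1_rep_def)
  have fm: "set_borel_measurable lborel ({0..s} \<times> cell) f"
    using fi by (auto simp: set_integrable_def set_borel_measurable_def)
  have "AE z in lborel. z \<in> {0..s} \<times> cell \<longrightarrow> ?U z = f z"
  proof (rule AE_eq_if_slices_eq[OF Um fm])
    show "AE r in lborel. r \<in> {0..s} \<longrightarrow> set_integrable lborel cell (\<lambda>x. ?U (r, x)) \<and>
      set_integrable lborel cell (\<lambda>x. f (r, x)) \<and>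
      (\<forall>g\<in>Cinf. distr_of (\<lambda>x. ?U (r, x)) g = distr_of (\<lambda>x. f (r, x)) g)"
      using f[unfolded L1_rep_def, THEN conjunct2] L1_rep_integrable_slice[OF fi]
    proof eventually_elim
      case (elim r)
      have "set_integrable lborel cell (\<lambda>x. ?U (r, x))"
        using set_integrable_cell[OF Cinf_continuous[OF clamped_Cinf[OF \<omega>, of r]]] by simp
      then show ?case using elim by (cases "r \<in> {0..s}") auto
    qed
  qed
  then have "set_integrable lborel ({0..s} \<times> cell) ?U"
    unfolding set_integrable_def
    by (subst integrable_cong_AE[where g="\<lambda>z. indicator ({0..s} \<times> cell) z *\<^sub>R f z"])
      (use fi Um in \<open>auto simp: set_integrable_def set_borel_measurable_def indicator_def elim!: eventually_mono\<close>)
  then show ?thesis by (simp add: L1_rep_def)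
qed

lemma distr_test_measurable:
  assumes h: "h \<in> Cinf" and t: "t \<in> {0..s}"
  shows "(\<lambda>\<omega>. distr_of (u t \<omega>) h) \<in> borel_measurable (F s)"
proof -
  have [measurable]: "h \<in> borel_measurable borel" using Cinf_continuous[OF h] by (rule borel_measurable_continuous_onI)
  have "(\<lambda>p. ((fst p, t), snd p)) \<in> measurable (F s \<Otimes>\<^sub>M borel) ((F s \<Otimes>\<^sub>M borel) \<Otimes>\<^sub>M borel)" by measurable
  from measurable_compose[OF this clamped_joint]
  have [measurable]: "(\<lambda>p. u t (fst p) (snd p)) \<in> borel_measurable (F s \<Otimes>\<^sub>M borel)" using t by (simp add: case_prod_unfold)
  have "(\<lambda>(\<omega>, x). indicator cell x *\<^sub>R (u t \<omega> x * h x)) \<in> borel_measurable (F s \<Otimes>\<^sub>M lborel)"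
    unfolding case_prod_unfold by measurable
  from sigma_finite_measure.borel_measurable_lebesgue_integral[OF sigma_finite_lborel this]
  show ?thesis using h by (simp add: distr_of_def set_lebesgue_integral_def)
qed

text \<open>The L^1 part of the distance is a double integral of the solution, measurable by Fubini;
  the other part is a supremum over countable sets of times and test functions. The ball is
  therefore a countable intersection of sets in \<open>F s\<close>.\<close>

lemma Xu_ball_adapted:
  assumes \<Omega>: "\<Omega> \<in> sets (F s)"
    and in_Xu: "\<And>\<omega>. \<omega> \<in> \<Omega> \<Longrightarrow> restrict (\<lambda>t. distr_of (u t \<omega>)) {0..s} \<in> Xu_set s" and v: "v \<in> Xu_set s"
  shows "{\<omega>\<in>\<Omega>. Xu_dist s (restrict (\<lambda>t. distr_of (u t \<omega>)) {0..s}) v \<le> r} \<in> sets (F s)"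
proof -
  have \<Omega>M: "\<omega> \<in> space M" if "\<omega> \<in> \<Omega>" for \<omega>
    using sets.sets_into_space[OF \<Omega>] basis_subalgebra[OF F s(1)] that by auto
  obtain D where D: "countable D" "D \<subseteq> {0..s}"
    "\<And>f g c. f \<in> mspace (cfunspace (top_of_set {0..s}) (Hm1 :: ((real^'n \<Rightarrow> real) \<Rightarrow> real) metric)) \<Longrightarrow>
      g \<in> mspace (cfunspace (top_of_set {0..s}) Hm1) \<Longrightarrow> 0 \<le> s \<Longrightarrow>
      mdist (cfunspace (top_of_set {0..s}) Hm1) f g \<le> c \<longleftrightarrow> (\<forall>t\<in>D. mdist Hm1 (f t) (g t) \<le> c)"
    by (rule cfunspace_countable_times) (rule that)
  obtain Q :: "(real^'n \<Rightarrow> real) set" where Q: "countable Q" "Q \<subseteq> Cinf"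
    "\<And>l m c. l \<in> Hm1_set \<Longrightarrow> m \<in> Hm1_set \<Longrightarrow> Hm1_dist l m \<le> c \<longleftrightarrow> (\<forall>h\<in>Q. \<bar>l h - m h\<bar> \<le> c)"
    by (rule Hm1_countable_norming) (rule that)
  define K :: "(real \<times> (real^'n)) set" where "K = {0..s} \<times> cell"
  have K: "K \<in> sets borel" unfolding K_def by (rule time_cell_borel)
  obtain f where f: "L1_rep s v f" using v unfolding Xu_set_def by blast
  have fm [measurable]: "(\<lambda>z. indicator K z *\<^sub>R f z) \<in> borel_measurable borel"
    using f by (auto simp: L1_rep_def set_integrable_def K_def)
  define A where "A \<omega> = (\<integral>z. \<bar>indicator K z *\<^sub>R u (clamp_time s (fst z)) \<omega> (snd z) - indicator K z *\<^sub>R f z\<bar> \<partial>lborel)" for \<omega>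
  have A: "A \<in> borel_measurable (F s)"
  proof -
    note clamped_joint_pair[unfolded case_prod_unfold, measurable] K[measurable]
    have "(\<lambda>(\<omega>, z). \<bar>indicator K z *\<^sub>R u (clamp_time s (fst z)) \<omega> (snd z) - indicator K z *\<^sub>R f z\<bar>) \<in> borel_measurable (F s \<Otimes>\<^sub>M lborel)"
      unfolding case_prod_unfold by measurable
    from sigma_finite_measure.borel_measurable_lebesgue_integral[OF sigma_finite_lborel this]
    show ?thesis by (simp add: A_def[abs_def])
  qed
  let ?p = "\<lambda>\<omega>. restrict (\<lambda>t. distr_of (u t \<omega>)) {0..s}"
  \<comment> \<open>The L^1 part \<open>A \<omega>\<close> depends on neither t nor h and can be
    moved under the quantifiers.\<close>
  have iff: "Xu_dist s (?p \<omega>) v \<le> r \<longleftrightarrow> (\<forall>t\<in>D. \<forall>h\<in>Q. A \<omega> + \<bar>distr_of (u t \<omega>) h - v t h\<bar> \<le> r)" if \<omega>: "\<omega> \<in> \<Omega>" for \<omega>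
  proof -
    have p: "?p \<omega> \<in> Xu_set s" using in_Xu \<omega> .
    have "L1_norm s (\<lambda>r g. ?p \<omega> r g - v r g) = (LINT z:{0..s} \<times> cell|lborel. \<bar>u (clamp_time s (fst z)) \<omega> (snd z) - f z\<bar>)"
      by (rule L1_norm_eq[OF L1_rep_diff[OF clamped_rep[OF \<Omega>M[OF \<omega>] p] f]])
    also have "\<dots> = A \<omega>" unfolding A_def set_lebesgue_integral_def K_def
      by (intro Bochner_Integration.integral_cong) (auto simp: indicator_def)
    finally have L1: "L1_norm s (\<lambda>r g. ?p \<omega> r g - v r g) = A \<omega>" .
    have sp: "?p \<omega> \<in> mspace (cfunspace (top_of_set {0..s}) Hm1)" "v \<in> mspace (cfunspace (top_of_set {0..s}) Hm1)"
      using p v unfolding Xu_set_def by blast+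
    have Hm: "?p \<omega> t \<in> Hm1_set" "v t \<in> Hm1_set" if "t \<in> D" for t
      using sp that D(2) by (auto simp: mspace_cfunspace Pi_iff)
    have "Xu_dist s (?p \<omega>) v \<le> r \<longleftrightarrow> mdist (cfunspace (top_of_set {0..s}) Hm1) (?p \<omega>) v \<le> r - A \<omega>"
      using p v by (simp add: Xu_dist_def L1 algebra_simps del: restrict_apply)
    also have "\<dots> \<longleftrightarrow> (\<forall>t\<in>D. Hm1_dist (?p \<omega> t) (v t) \<le> r - A \<omega>)"
      unfolding D(3)[OF sp s(1)] by simp
    also have "\<dots> \<longleftrightarrow> (\<forall>t\<in>D. \<forall>h\<in>Q. \<bar>?p \<omega> t h - v t h\<bar> \<le> r - A \<omega>)"
      by (intro ball_cong refl Q(3) Hm)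
    also have "\<dots> \<longleftrightarrow> (\<forall>t\<in>D. \<forall>h\<in>Q. A \<omega> + \<bar>distr_of (u t \<omega>) h - v t h\<bar> \<le> r)"
      using D(2) by (intro ball_cong refl) (auto simp: algebra_simps subset_iff)
    finally show ?thesis .
  qed
  have "{\<omega>\<in>\<Omega>. Xu_dist s (?p \<omega>) v \<le> r} = \<Omega> \<inter> {\<omega>\<in>space (F s). \<forall>t\<in>D. \<forall>h\<in>Q. A \<omega> + \<bar>distr_of (u t \<omega>) h - v t h\<bar> \<le> r}"
    using iff \<Omega>M basis_subalgebra[OF F s(1)] by auto
  also have "\<dots> \<in> sets (F s)"
  proof (intro sets.Int[OF \<Omega>] sets.sets_Collect_countable_All')
    fix t h assume th: "t \<in> D" "h \<in> Q"
    have [measurable]: "(\<lambda>\<omega>. distr_of (u t \<omega>) h) \<in> borel_measurable (F s)"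
      using th D(2) Q(2) by (intro distr_test_measurable) auto
    note A[measurable]
    show "{\<omega>\<in>space (F s). A \<omega> + \<bar>distr_of (u t \<omega>) h - v t h\<bar> \<le> r} \<in> sets (F s)" by measurable
  qed (use D Q in auto)
  finally show ?thesis .
qed

end

text \<open>The coefficients of \<open>W\<close> are the adapted real processes
  \<open>\<beta> k\<close>, and by \<open>norm_le_iff_coord\<close> the ball is described by
  countably many inequalities between finite sums of their squares.\<close>

lemma XW_ball_adapted:
  fixes J :: "'u::{real_inner,complete_space} \<Rightarrow> 'w::banach"
  assumes J: "enlarged_space e J" and s: "0 \<le> s"
    and \<beta>: "\<And>k t. 1 \<le> k \<Longrightarrow> t \<in> {0..s} \<Longrightarrow> \<beta> k t \<in> borel_measurable N"
    and \<Omega>: "\<Omega> \<in> sets N" and in_XW: "\<And>\<omega>. \<omega> \<in> \<Omega> \<Longrightarrow> restrict (\<lambda>t. W t \<omega>) {0..s} \<in> mspace (XW s)"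
    and conv: "\<And>\<omega> t. \<omega> \<in> \<Omega> \<Longrightarrow> t \<in> {0..s} \<Longrightarrow> (\<lambda>n. \<Sum>k=1..n. \<beta> k t \<omega> *\<^sub>R J (e k)) \<longlonglongrightarrow> W t \<omega>"
    and w: "w \<in> mspace (XW s)"
  shows "{\<omega>\<in>\<Omega>. mdist (XW s) (restrict (\<lambda>t. W t \<omega>) {0..s}) w \<le> r} \<in> sets N"
proof (cases "0 \<le> r")
  \<comment> \<open>A negative radius needs its own case, as the sign is lost in the squared
    inequalities.\<close>
  case False
  have "{\<omega>\<in>\<Omega>. mdist (XW s) (restrict (\<lambda>t. W t \<omega>) {0..s}) w \<le> r} = {}"
    using False mdist_nonneg[of "XW s"] by (metis (no_types, lifting) Collect_empty_eq order_trans)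
  then show ?thesis by (simp only: sets.empty_sets)
next
  case True
  obtain D where D: "countable D" "D \<subseteq> {0..s}"
    "\<And>f g c. f \<in> mspace (cfunspace (top_of_set {0..s}) (euclidean_metric :: 'w metric)) \<Longrightarrow>
      g \<in> mspace (cfunspace (top_of_set {0..s}) euclidean_metric) \<Longrightarrow> 0 \<le> s \<Longrightarrow>
      mdist (cfunspace (top_of_set {0..s}) euclidean_metric) f g \<le> c \<longleftrightarrow> (\<forall>t\<in>D. mdist euclidean_metric (f t) (g t) \<le> c)"
    by (rule cfunspace_countable_times) (rule that)
  let ?p = "\<lambda>\<omega>. restrict (\<lambda>t. W t \<omega>) {0..s}"
  have iff: "mdist (XW s) (?p \<omega>) w \<le> r \<longleftrightarrow>
      (\<forall>t\<in>D. \<forall>n. (\<Sum>k=1..n. (\<beta> k t \<omega> - coord e J (w t) k)\<^sup>2 / (real k)\<^sup>2) \<le> r\<^sup>2)" if \<omega>: "\<omega> \<in> \<Omega>" for \<omega>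
  proof -
    have "mdist (XW s) (?p \<omega>) w \<le> r \<longleftrightarrow> (\<forall>t\<in>D. dist (?p \<omega> t) (w t) \<le> r)"
      using D(3)[of "?p \<omega>" w r] in_XW[OF \<omega>] w s unfolding XW_def by simp
    also have "\<dots> \<longleftrightarrow> (\<forall>t\<in>D. norm (W t \<omega> - w t) \<le> r)"
      using D(2) by (intro ball_cong refl) (auto simp: dist_norm subset_iff)
    also have "\<dots> \<longleftrightarrow> (\<forall>t\<in>D. \<forall>n. (\<Sum>k=1..n. (\<beta> k t \<omega> - coord e J (w t) k)\<^sup>2 / (real k)\<^sup>2) \<le> r\<^sup>2)"
    proof (intro ball_cong refl)
      fix t assume "t \<in> D"
      then have "(\<lambda>n. \<Sum>k=1..n. \<beta> k t \<omega> *\<^sub>R J (e k)) \<longlonglongrightarrow> W t \<omega>" using D(2) conv[OF \<omega>] by auto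
      from norm_le_iff_coord[OF J series_diff[OF J this coord_sums[OF J]] True]
      show "norm (W t \<omega> - w t) \<le> r \<longleftrightarrow> (\<forall>n. (\<Sum>k=1..n. (\<beta> k t \<omega> - coord e J (w t) k)\<^sup>2 / (real k)\<^sup>2) \<le> r\<^sup>2)" .
    qed
    finally show ?thesis .
  qed
  have "{\<omega>\<in>\<Omega>. mdist (XW s) (?p \<omega>) w \<le> r} = \<Omega> \<inter> {\<omega>\<in>space N. \<forall>t\<in>D. \<forall>n\<in>UNIV. (\<Sum>k=1..n. (\<beta> k t \<omega> - coord e J (w t) k)\<^sup>2 / (real k)\<^sup>2) \<le> r\<^sup>2}"
    using iff sets.sets_into_space[OF \<Omega>] by auto
  also have "\<dots> \<in> sets N"
  proof (intro sets.Int[OF \<Omega>] sets.sets_Collect_countable_All')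
    fix t and n :: nat assume "t \<in> D"
    then have "\<beta> k t \<in> borel_measurable N" if "1 \<le> k" for k using \<beta> D(2) that by auto
    then have [measurable]: "(\<lambda>\<omega>. \<Sum>k=1..n. (\<beta> k t \<omega> - coord e J (w t) k)\<^sup>2 / (real k)\<^sup>2) \<in> borel_measurable N"
      by (intro borel_measurable_sum borel_measurable_divide borel_measurable_power borel_measurable_diff borel_measurable_const) auto
    show "{\<omega>\<in>space N. (\<Sum>k=1..n. (\<beta> k t \<omega> - coord e J (w t) k)\<^sup>2 / (real k)\<^sup>2) \<le> r\<^sup>2} \<in> sets N" by measurable
  qed (use D in auto)
  finally show ?thesis .
qed

text \<open>Off a null set the path lies in the path space and the series for \<open>W\<close>
  converges at all times, so preimages of balls are adapted there. The part of the preimage inside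
  the null set is measurable by completeness and belongs to \<open>F s\<close> as a null
  set.\<close>

lemma restricted_paths_adapted:
  fixes u :: "real \<Rightarrow> 'a \<Rightarrow> real^'n \<Rightarrow> real" and J :: "'u::{real_inner,complete_space} \<Rightarrow> 'w::banach"
  assumes F: "stochastic_basis M F" and s: "0 \<le> s" "s \<le> T" and J: "enlarged_space e J"
    and u: "(\<lambda>(t, \<omega>). u t \<omega>) \<in> measurable (predictable_algebra M F T) (borel_of Cinf_topology)"
    and W: "cylindrical_wiener_process M {0..} F e J \<beta> W"
    and Z: "AE \<omega> in M. (distr_path T u \<omega>, \<lambda>t\<in>{0..T}. W t \<omega>) \<in> topspace (X_topology T)"
    and U: "openin (X_topology s) U"
  shows "{\<omega>\<in>space M. restrict_paths s (distr_path T u \<omega>, \<lambda>t\<in>{0..T}. W t \<omega>) \<in> U} \<in> sets (F s)"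
proof -
  have conv: "AE \<omega> in M. \<forall>t\<in>{0..}. (\<lambda>n. \<Sum>k=1..n. \<beta> k t \<omega> *\<^sub>R J (e k)) \<longlonglongrightarrow> W t \<omega>"
    using W by (simp add: cylindrical_wiener_process_def)
  have "AE \<omega> in M. (distr_path T u \<omega>, \<lambda>t\<in>{0..T}. W t \<omega>) \<in> topspace (X_topology T) \<and>
      (\<forall>t\<in>{0..}. (\<lambda>n. \<Sum>k=1..n. \<beta> k t \<omega> *\<^sub>R J (e k)) \<longlonglongrightarrow> W t \<omega>)"
    using Z conv by eventually_elim auto
  then obtain N where N: "N \<in> null_sets M"
    "{\<omega>\<in>space M. \<not> ((distr_path T u \<omega>, \<lambda>t\<in>{0..T}. W t \<omega>) \<in> topspace (X_topology T) \<and>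
      (\<forall>t\<in>{0..}. (\<lambda>n. \<Sum>k=1..n. \<beta> k t \<omega> *\<^sub>R J (e k)) \<longlonglongrightarrow> W t \<omega>))} \<subseteq> N"
    by (auto simp: eventually_ae_filter)
  have nullF: "null_sets M \<subseteq> sets (F s)"
    by (rule basis_null[OF F s(1)])
  define \<Omega> where "\<Omega> = space M - N"
  have \<Omega>: "\<Omega> \<in> sets (F s)"
    using N(1) nullF sets.top[of "F s"] basis_subalgebra[OF F s(1)] by (auto simp: \<Omega>_def)
  have top: "distr_path T u \<omega> \<in> Xu_set T" "(\<lambda>t\<in>{0..T}. W t \<omega>) \<in> mspace (XW T)"
    and conv': "\<And>t. 0 \<le> t \<Longrightarrow> (\<lambda>n. \<Sum>k=1..n. \<beta> k t \<omega> *\<^sub>R J (e k)) \<longlonglongrightarrow> W t \<omega>" if "\<omega> \<in> \<Omega>" for \<omega>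
    using N(2) that by (auto simp: \<Omega>_def X_topology_def)
  have sub: "min T s = s" using s by simp
  let ?Z1 = "\<lambda>\<omega>. restrict (\<lambda>t. distr_of (u t \<omega>)) {0..s}" and ?Z2 = "\<lambda>\<omega>. restrict (\<lambda>t. W t \<omega>) {0..s}"
  have Zeq: "restrict_paths s (distr_path T u \<omega>, \<lambda>t\<in>{0..T}. W t \<omega>) = (?Z1 \<omega>, ?Z2 \<omega>)" for \<omega>
    by (simp add: restrict_paths_def distr_path_def restrict_restrict sub)
  have in1: "?Z1 \<omega> \<in> Xu_set s" if "\<omega> \<in> \<Omega>" for \<omega>
    using Xu_restrict[OF top(1)[OF that] s(2)] by (simp add: distr_path_def restrict_restrict sub)
  have in2: "?Z2 \<omega> \<in> mspace (XW s)" if "\<omega> \<in> \<Omega>" for \<omega>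
    using cfunspace_restrict[OF top(2)[OF that, unfolded XW_def] s(2)]
    by (simp add: XW_def restrict_restrict sub del: mspace_cfunspace)
  have "{\<omega>\<in>\<Omega>. (?Z1 \<omega>, ?Z2 \<omega>) \<in> U} \<in> sets (F s)"
  proof (rule sets_preimage_prod)
    show "label_separable (mspace (Xu s)) (mdist (Xu s :: (real \<Rightarrow> (real^'n \<Rightarrow> real) \<Rightarrow> real) metric))"
      using label_separable_Xu by simp
    show "label_separable (mspace (XW s)) (mdist (XW s :: (real \<Rightarrow> 'w) metric))" by (rule label_separable_XW[OF J])
    show "openin (prod_topology (mtopology_of (Xu s)) (mtopology_of (XW s))) U" using U by (simp add: X_topology_def)
    show "{\<omega>\<in>\<Omega>. mdist (Xu s) (?Z1 \<omega>) v \<le> r} \<in> sets (F s)" if "v \<in> mspace (Xu s)" for v r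
      using Xu_ball_adapted[OF F s u \<Omega> in1, of v r] that by simp
    show "{\<omega>\<in>\<Omega>. mdist (XW s) (?Z2 \<omega>) w \<le> r} \<in> sets (F s)" if w: "w \<in> mspace (XW s)" for w r
    proof (rule XW_ball_adapted[OF J s(1) _ \<Omega> in2 _ w])
      fix k :: nat and t assume k: "1 \<le> k" and t: "t \<in> {0..s}"
      then have "\<beta> k t \<in> borel_measurable (F t)"
        using W by (auto simp: cylindrical_wiener_process_def wiener_process_def)
      then show "\<beta> k t \<in> borel_measurable (F s)"
        using t basis_mono[OF F, of t s] basis_subalgebra[OF F, of t] basis_subalgebra[OF F s(1)]
        by (auto simp: measurable_def)
    qed (use conv' in auto)
  qed (use in1 in2 in auto)
  moreover have "{\<omega>\<in>N. (?Z1 \<omega>, ?Z2 \<omega>) \<in> U} \<in> sets (F s)"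
  proof -
    have "complete_measure M" by (rule stochastic_basisD(2)[OF F])
    then have "{\<omega>\<in>N. (?Z1 \<omega>, ?Z2 \<omega>) \<in> U} \<in> sets M"
      using N(1) by (intro complete_measure.complete[of M _ N]) auto
    then have "{\<omega>\<in>N. (?Z1 \<omega>, ?Z2 \<omega>) \<in> U} \<in> null_sets M"
      by (rule null_sets_subset[OF N(1)]) auto
    then show ?thesis using nullF by blast
  qed
  moreover have "{\<omega>\<in>space M. (?Z1 \<omega>, ?Z2 \<omega>) \<in> U} = {\<omega>\<in>\<Omega>. (?Z1 \<omega>, ?Z2 \<omega>) \<in> U} \<union> {\<omega>\<in>N. (?Z1 \<omega>, ?Z2 \<omega>) \<in> U}"
    using null_setsD2[OF N(1), THEN sets.sets_into_space] by (auto simp: \<Omega>_def)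
  ultimately show ?thesis unfolding Zeq by auto
qed

section \<open>Transfer of laws\<close>

text \<open>\<open>has_law\<close> allows values outside the space on a null set. Redirecting these
  to a fixed point gives a genuine random element whose image measure is the law.\<close>

lemma has_law_modification:
  assumes M: "prob_space M" and law: "has_law M S Y \<mu>"
  obtains Y' where "Y' \<in> measurable M (borel_of S)" "AE \<omega> in M. Y' \<omega> = Y \<omega>" "AE \<omega> in M. Y \<omega> \<in> topspace S"
    "distr M (borel_of S) Y' = \<mu>"
proof -
  interpret M: prob_space M by fact
  have \<mu>: "prob_space \<mu>" "sets \<mu> = sets (borel_of S)" using law by (auto simp: has_law_def)
  have E: "{\<omega>\<in>space M. Y \<omega> \<in> E} \<in> sets M" "emeasure M {\<omega>\<in>space M. Y \<omega> \<in> E} = emeasure \<mu> E"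
    if "E \<in> sets (borel_of S)" for E
    using law that by (auto simp: has_law_def)
  have sp: "space \<mu> = topspace S" using sets_eq_imp_space_eq[OF \<mu>(2)] by simp
  have top: "topspace S \<in> sets (borel_of S)" using sets.top[of "borel_of S"] by simp
  have "topspace S \<noteq> {}" using prob_space.not_empty[OF \<mu>(1)] sp by simp
  \<comment> \<open>A default value; the space is nonempty because it carries a probability
    measure.\<close>
  then obtain y0 where y0: "y0 \<in> topspace S" by blast
  have "emeasure M {\<omega>\<in>space M. Y \<omega> \<in> topspace S} = 1"
    using E(2)[OF top] prob_space.emeasure_space_1[OF \<mu>(1)] sp by simp
  then have "M.prob {\<omega>\<in>space M. Y \<omega> \<in> topspace S} = 1" by (simp add: measure_def)
  then have AEtop: "AE \<omega> in M. Y \<omega> \<in> topspace S" using M.AE_prob_1 by fastforce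
  define Y' where "Y' \<omega> = (if Y \<omega> \<in> topspace S then Y \<omega> else y0)" for \<omega>
  have eq: "AE \<omega> in M. Y' \<omega> = Y \<omega>" using AEtop by eventually_elim (simp add: Y'_def)
  have Y': "Y' \<in> measurable M (borel_of S)"
  proof (rule measurableI)
    show "Y' \<omega> \<in> space (borel_of S)" for \<omega> using y0 by (simp add: Y'_def)
    fix E' assume E': "E' \<in> sets (borel_of S)"
    then have sub: "E' \<subseteq> topspace S" using sets.sets_into_space[OF E'] by simp
    have "Y' -` E' \<inter> space M = {\<omega>\<in>space M. Y \<omega> \<in> E'} \<union> (if y0 \<in> E' then space M - {\<omega>\<in>space M. Y \<omega> \<in> topspace S} else {})"
      using sub by (auto simp: Y'_def split: if_splits)
    then show "Y' -` E' \<inter> space M \<in> sets M" using E(1)[OF E'] E(1)[OF top] by auto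
  qed
  have "distr M (borel_of S) Y' = \<mu>"
  proof (rule measure_eqI)
    fix E' assume "E' \<in> sets (distr M (borel_of S) Y')"
    then have E': "E' \<in> sets (borel_of S)" by simp
    have "emeasure (distr M (borel_of S) Y') E' = emeasure M (Y' -` E' \<inter> space M)"
      by (rule emeasure_distr[OF Y' E'])
    also have "\<dots> = emeasure M {\<omega>\<in>space M. Y \<omega> \<in> E'}"
      using eq measurable_sets[OF Y' E'] E(1)[OF E'] by (intro emeasure_eq_AE) (auto elim!: eventually_mono)
    finally show "emeasure (distr M (borel_of S) Y') E' = emeasure \<mu> E'" using E(2)[OF E'] by simp
  qed (simp add: \<mu>)
  then show thesis using that Y' eq AEtop by blast
qed

text \<open>The two differences are null sets of \<open>M\<close> and hence lie in
  \<open>F s\<close>, so \<open>B\<close> is recovered from \<open>A\<close> by removing one and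
  adding the other.\<close>

lemma sets_AE_eq:
  assumes F: "stochastic_basis M F" and s: "0 \<le> s" and A: "A \<in> sets (F s)" and B: "B \<in> sets M"
    and eq: "AE \<omega> in M. \<omega> \<in> A \<longleftrightarrow> \<omega> \<in> B"
  shows "B \<in> sets (F s)"
proof -
  have AM: "A \<in> sets M" using A basis_subalgebra[OF F s] by blast
  have null: "C \<in> null_sets M" if "C \<in> sets M" "AE \<omega> in M. \<omega> \<notin> C" for C
    using that by (simp add: AE_iff_null_sets)
  have "A - B \<in> null_sets M" "B - A \<in> null_sets M"
    using A B AM eq by (auto intro!: null elim!: eventually_mono)
  then have "A - B \<in> sets (F s)" "B - A \<in> sets (F s)" using basis_null[OF F s] by auto
  then have "(A - (A - B)) \<union> (B - A) \<in> sets (F s)" using A by blast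
  moreover have "(A - (A - B)) \<union> (B - A) = B" by blast
  ultimately show ?thesis by simp
qed

lemma (in prob_space) indep_set_mono:
  assumes ind: "indep_set A B" and sub: "A' \<subseteq> A" "B' \<subseteq> B"
  shows "indep_set A' B'"
  unfolding indep_sets2_eq
proof (intro conjI ballI)
  note i = ind[unfolded indep_sets2_eq]
  show "A' \<subseteq> events" "B' \<subseteq> events" using i sub by blast+
  fix a b assume "a \<in> A'" "b \<in> B'"
  then have "a \<in> A" "b \<in> B" using sub by auto
  then show "prob (a \<inter> b) = prob a * prob b" using i by blast
qed

text \<open>Two limits in this order: for fixed continuous approximations of the indicators the
  product formula passes along the weakly convergent measures; then, under the limit measure, the
  approximations tend to the indicators by domination.\<close>

lemma closed_factorization:
  fixes \<Delta> :: "'y \<Rightarrow> real" and \<rho> :: "'y \<Rightarrow> 'z"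
  assumes wc: "weakly_converges S \<mu>n \<mu>" and \<mu>: "prob_space \<mu>" "sets \<mu> = sets (borel_of S)"
    and \<rho>: "continuous_map S S1 \<rho>" and \<Delta>: "continuous_map S euclideanreal \<Delta>" and S1: "metrizable_space S1"
    and fact: "\<And>n G H. continuous_map S1 euclideanreal G \<Longrightarrow> continuous_map euclideanreal euclideanreal H \<Longrightarrow>
      (\<And>x. 0 \<le> G x \<and> G x \<le> 1) \<Longrightarrow> (\<And>x. 0 \<le> H x \<and> H x \<le> 1) \<Longrightarrow>
      (\<integral>y. G (\<rho> y) * H (\<Delta> y) \<partial>\<mu>n n) = (\<integral>y. G (\<rho> y) \<partial>\<mu>n n) * (\<integral>y. H (\<Delta> y) \<partial>\<mu>n n)"
    and C: "closedin S1 C" and D: "closed D"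
  shows "measure \<mu> {y\<in>topspace S. \<rho> y \<in> C \<and> \<Delta> y \<in> D} =
    measure \<mu> {y\<in>topspace S. \<rho> y \<in> C} * measure \<mu> {y\<in>topspace S. \<Delta> y \<in> D}"
proof -
  interpret \<mu>: prob_space \<mu> by fact
  have sp: "space \<mu> = topspace S" using sets_eq_imp_space_eq[OF \<mu>(2)] by simp
  obtain \<gamma> :: "nat \<Rightarrow> 'z \<Rightarrow> real" where \<gamma>: "\<And>m. continuous_map S1 euclideanreal (\<gamma> m)"
    "\<And>m x. 0 \<le> \<gamma> m x" "\<And>m x. \<gamma> m x \<le> 1" "\<And>x. x \<in> topspace S1 \<Longrightarrow> (\<lambda>m. \<gamma> m x) \<longlonglongrightarrow> indicator C x"
    by (rule closedin_indicator_limit[OF S1 C]) (rule that)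
  have "metrizable_space (euclideanreal)" by (rule metrizable_space_euclidean)
  moreover have "closedin euclideanreal D" using D by simp
  ultimately obtain \<psi> :: "nat \<Rightarrow> real \<Rightarrow> real" where \<psi>: "\<And>m. continuous_map euclideanreal euclideanreal (\<psi> m)"
    "\<And>m x. 0 \<le> \<psi> m x" "\<And>m x. \<psi> m x \<le> 1" "\<And>x. x \<in> topspace euclideanreal \<Longrightarrow> (\<lambda>m. \<psi> m x) \<longlonglongrightarrow> indicator D x"
    by (rule closedin_indicator_limit) (rule that)
  define G where "G m y = \<gamma> m (\<rho> y)" for m y
  define H where "H m y = \<psi> m (\<Delta> y)" for m y
  have Gc: "continuous_map S euclideanreal (G m)" for m
    using continuous_map_compose[OF \<rho> \<gamma>(1)] by (simp add: o_def G_def[abs_def])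
  have Hc: "continuous_map S euclideanreal (H m)" for m
    using continuous_map_compose[OF \<Delta> \<psi>(1)] by (simp add: o_def H_def[abs_def])
  have GHc: "continuous_map S euclideanreal (\<lambda>y. G m y * H m y)" for m
    by (intro continuous_map_real_mult Gc Hc)
  have G01: "0 \<le> G m y" "G m y \<le> 1" and H01: "0 \<le> H m y" "H m y \<le> 1" for m y
    using \<gamma>(2,3) \<psi>(2,3) by (auto simp: G_def H_def)
  have GH01: "0 \<le> G m y * H m y" "G m y * H m y \<le> 1" for m y
    using G01 H01 by (auto intro!: mult_le_one)
  have wlim: "(\<lambda>n. integral\<^sup>L (\<mu>n n) f) \<longlonglongrightarrow> integral\<^sup>L \<mu> f"
    if "continuous_map S euclideanreal f" "\<And>y. 0 \<le> f y" "\<And>y. f y \<le> 1" for f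
    using wc that unfolding weakly_converges_def by (auto simp: bounded_iff intro!: exI[of _ 1])
  \<comment> \<open>The product is itself bounded and continuous, so weak convergence applies to
    both sides of the formula for the n-th measure.\<close>
  have prod: "(\<integral>y. G m y * H m y \<partial>\<mu>) = (\<integral>y. G m y \<partial>\<mu>) * (\<integral>y. H m y \<partial>\<mu>)" for m
  proof (rule LIMSEQ_unique)
    show "(\<lambda>n. \<integral>y. G m y * H m y \<partial>\<mu>n n) \<longlonglongrightarrow> (\<integral>y. G m y * H m y \<partial>\<mu>)"
      by (rule wlim[OF GHc GH01])
    have "(\<integral>y. G m y * H m y \<partial>\<mu>n n) = (\<integral>y. G m y \<partial>\<mu>n n) * (\<integral>y. H m y \<partial>\<mu>n n)" for n
      unfolding G_def H_def using \<gamma> \<psi> by (intro fact) auto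
    then show "(\<lambda>n. \<integral>y. G m y * H m y \<partial>\<mu>n n) \<longlonglongrightarrow> (\<integral>y. G m y \<partial>\<mu>) * (\<integral>y. H m y \<partial>\<mu>)"
      using tendsto_mult[OF wlim[OF Gc G01] wlim[OF Hc H01]] by simp
  qed
  have mlim: "(\<lambda>m. integral\<^sup>L \<mu> (f m)) \<longlonglongrightarrow> measure \<mu> E"
    if f: "\<And>m. continuous_map S euclideanreal (f m)" "\<And>m y. 0 \<le> f m y" "\<And>m y. f m y \<le> 1"
      and lim: "\<And>y. y \<in> topspace S \<Longrightarrow> (\<lambda>m. f m y) \<longlonglongrightarrow> indicator E y" and E: "E \<subseteq> topspace S" for f and E
  proof -
    have fm: "f m \<in> borel_measurable \<mu>" for m by (rule continuous_map_borel_measurable[OF f(1) \<mu>(2)])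
    have Em: "indicat_real E \<in> borel_measurable \<mu>"
      by (rule borel_measurable_LIMSEQ_real[where u=f, OF _ fm]) (simp add: sp lim)
    have "(\<lambda>m. integral\<^sup>L \<mu> (f m)) \<longlonglongrightarrow> integral\<^sup>L \<mu> (indicator E)"
      by (rule integral_dominated_convergence[where w="\<lambda>_. 1"])
        (use f(2,3) lim sp fm Em in \<open>auto intro!: AE_I2\<close>)
    then show ?thesis using E sp by (simp add: Int_absorb2)
  qed
  have top: "\<rho> y \<in> topspace S1" if "y \<in> topspace S" for y
    using \<rho> that by (auto simp: continuous_map_def)
  have limG: "(\<lambda>m. G m y) \<longlonglongrightarrow> indicator {y\<in>topspace S. \<rho> y \<in> C} y" if "y \<in> topspace S" for y
    using \<gamma>(4)[OF top[OF that]] that by (simp add: G_def indicator_def)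
  have limH: "(\<lambda>m. H m y) \<longlonglongrightarrow> indicator {y\<in>topspace S. \<Delta> y \<in> D} y" if "y \<in> topspace S" for y
    using \<psi>(4)[of "\<Delta> y"] that by (simp add: H_def indicator_def)
  have limGH: "(\<lambda>m. G m y * H m y) \<longlonglongrightarrow> indicator {y\<in>topspace S. \<rho> y \<in> C \<and> \<Delta> y \<in> D} y" if y: "y \<in> topspace S" for y
    using tendsto_mult[OF limG[OF y] limH[OF y]] y by (auto simp: indicator_def split: if_splits)
  have "(\<lambda>m. \<integral>y. G m y * H m y \<partial>\<mu>) \<longlonglongrightarrow> measure \<mu> {y\<in>topspace S. \<rho> y \<in> C \<and> \<Delta> y \<in> D}"
    by (rule mlim[OF GHc GH01 limGH]) auto
  moreover have "(\<lambda>m. \<integral>y. G m y * H m y \<partial>\<mu>) \<longlonglongrightarrow>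
      measure \<mu> {y\<in>topspace S. \<rho> y \<in> C} * measure \<mu> {y\<in>topspace S. \<Delta> y \<in> D}"
    unfolding prod by (intro tendsto_mult mlim[OF Gc G01 limG] mlim[OF Hc H01 limH]) auto
  ultimately show ?thesis by (rule LIMSEQ_unique)
qed

lemma coord_path_measurable:
  assumes "enlarged_space e (J :: 'u::{real_inner,complete_space} \<Rightarrow> 'w::banach)" "1 \<le> k" "t \<in> {0..T}"
  shows "(\<lambda>w. coord e J (w t) k) \<in> borel_measurable (borel_of (mtopology_of (XW T :: (real \<Rightarrow> 'w) metric)))"
  by (rule continuous_map_borel_measurable[OF continuous_map_XW_coord[OF assms]]) simp

text \<open>Everything in the definition of a cylindrical Wiener process except adaptedness and the
  independence of the past depends on the law of the process only.\<close>

context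
  fixes M :: "'a measure" and M' :: "'b measure" and e :: "nat \<Rightarrow> 'u::{real_inner,complete_space}" and J :: "'u \<Rightarrow> 'w::banach"
    and T :: real and \<beta> :: "nat \<Rightarrow> real \<Rightarrow> 'a \<Rightarrow> real" and W :: "real \<Rightarrow> 'a \<Rightarrow> 'w" and F
    and V :: "'a \<Rightarrow> real \<Rightarrow> 'w" and V' :: "'b \<Rightarrow> real \<Rightarrow> 'w"
  assumes M: "prob_space M" and M': "prob_space M'" and J: "enlarged_space e J" and T: "0 < T"
    and W: "cylindrical_wiener_process M {0..} F e J \<beta> W"
    and V: "V \<in> measurable M (borel_of (mtopology_of (XW T)))" and V': "V' \<in> measurable M' (borel_of (mtopology_of (XW T)))"
    and law: "distr M' (borel_of (mtopology_of (XW T))) V' = distr M (borel_of (mtopology_of (XW T))) V"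
    and VW: "AE \<omega> in M. V \<omega> = (\<lambda>t\<in>{0..T}. W t \<omega>)"
begin

text \<open>By uniqueness the coordinates of the noise are the given Wiener processes; a single null
  set serves all indices and all times.\<close>

lemma coord_V: "AE \<omega> in M. \<forall>k\<ge>1. \<forall>t\<in>{0..T}. coord e J (V \<omega> t) k = \<beta> k t \<omega>"
proof -
  have "AE \<omega> in M. \<forall>t\<in>{0..}. (\<lambda>n. \<Sum>k=1..n. \<beta> k t \<omega> *\<^sub>R J (e k)) \<longlonglongrightarrow> W t \<omega>"
    using W by (simp add: cylindrical_wiener_process_def)
  with VW show ?thesis
  proof eventually_elim
    case (elim \<omega>)
    then show ?case by (auto intro!: coord_unique[OF J])
  qed
qed

lemma wiener_\<beta>: "1 \<le> k \<Longrightarrow> wiener_process M {0..} F (\<beta> k)"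
  using W by (simp add: cylindrical_wiener_process_def)

lemma increment_distributed:
  assumes "1 \<le> k" "0 \<le> s" "s < t"
  shows "distributed M lborel (\<lambda>\<omega>. \<beta> k t \<omega> - \<beta> k s \<omega>) (normal_density 0 (sqrt (t - s)))"
  using wiener_\<beta>[OF assms(1)] assms unfolding wiener_process_def by auto

lemma transfer_start:
  assumes k: "1 \<le> k" shows "AE \<omega> in M'. coord e J (V' \<omega> 0) k = 0"
proof -
  let ?B = "borel_of (mtopology_of (XW T))"
  have m: "(\<lambda>w. coord e J (w 0) k) \<in> borel_measurable ?B"
    using T by (intro coord_path_measurable[OF J k]) auto
  then have P: "{w \<in> space ?B. coord e J (w 0) k = 0} \<in> sets ?B" by measurable
  have "AE \<omega> in M. \<beta> k 0 \<omega> = 0" using wiener_\<beta>[OF k] by (simp add: wiener_process_def)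
  with coord_V have "AE \<omega> in M. coord e J (V \<omega> 0) k = 0"
    by eventually_elim (use k T in auto)
  then have "AE w in distr M ?B V. coord e J (w 0) k = 0" by (simp add: AE_distr_iff[OF V P])
  then show ?thesis unfolding law[symmetric] by (simp add: AE_distr_iff[OF V' P])
qed

lemma transfer_increment:
  assumes k: "1 \<le> k" and s: "0 \<le> s" "s < t" "t \<le> T"
  shows "distributed M' lborel (\<lambda>\<omega>. coord e J (V' \<omega> t) k - coord e J (V' \<omega> s) k) (normal_density 0 (sqrt (t - s)))"
proof -
  let ?B = "borel_of (mtopology_of (XW T))"
  let ?d = "\<lambda>w. coord e J (w t) k - coord e J (w s) k"
  have d: "?d \<in> measurable ?B lborel"
    using coord_path_measurable[OF J k, of t T] coord_path_measurable[OF J k, of s T] s by simp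
  have \<beta>: "distributed M lborel (\<lambda>\<omega>. \<beta> k t \<omega> - \<beta> k s \<omega>) (normal_density 0 (sqrt (t - s)))"
    by (rule increment_distributed[OF k s(1,2)])
  have "distr M' lborel (\<lambda>\<omega>. ?d (V' \<omega>)) = distr (distr M' ?B V') lborel ?d"
    using distr_distr[OF d V'] by (simp add: o_def)
  also have "\<dots> = distr M lborel (\<lambda>\<omega>. ?d (V \<omega>))"
    unfolding law using distr_distr[OF d V] by (simp add: o_def)
  also have "\<dots> = distr M lborel (\<lambda>\<omega>. \<beta> k t \<omega> - \<beta> k s \<omega>)"
  proof (rule distr_cong_AE)
    show "AE \<omega> in M. ?d (V \<omega>) = \<beta> k t \<omega> - \<beta> k s \<omega>"
      using coord_V by eventually_elim (use k s in auto)
    show "(\<lambda>\<omega>. ?d (V \<omega>)) \<in> measurable M lborel" by (rule measurable_compose[OF V d])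
    show "(\<lambda>\<omega>. \<beta> k t \<omega> - \<beta> k s \<omega>) \<in> measurable M lborel" using \<beta> by (simp add: distributed_def)
  qed auto
  finally show ?thesis using \<beta> measurable_compose[OF V' d] by (simp add: distributed_def)
qed

text \<open>Mutual independence means that the joint law on the product space is the product of the
  marginals. The joint law and the marginals are images of the law of the noise under measurable
  maps, so both carry over. The given independence on [0,\<infinity>) is first restricted to
  [0,T].\<close>

lemma transfer_indep:
  "prob_space.indep_vars M' (\<lambda>_. PiM {0..T} (\<lambda>_. borel)) (\<lambda>k \<omega>. \<lambda>t\<in>{0..T}. coord e J (V' \<omega> t) k) {1..}"
proof -
  interpret M: prob_space M by (rule M)
  interpret M': prob_space M' by (rule M')
  let ?B = "borel_of (mtopology_of (XW T))"
  let ?P = "PiM {0..T} (\<lambda>_. borel :: real measure)"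
  let ?PP = "PiM {1::nat..} (\<lambda>_. ?P)"
  define \<theta> where "\<theta> k w = (\<lambda>t\<in>{0..T}. coord e J (w t) k)" for k and w :: "real \<Rightarrow> 'w"
  define \<Theta> where "\<Theta> w = (\<lambda>k\<in>{1..}. \<theta> k w)" for w :: "real \<Rightarrow> 'w"
  have \<theta>: "\<theta> k \<in> measurable ?B ?P" if "k \<in> {1..}" for k
    unfolding \<theta>_def[abs_def] using that by (intro measurable_restrict coord_path_measurable[OF J]) auto
  have \<Theta>: "\<Theta> \<in> measurable ?B ?PP"
    unfolding \<Theta>_def[abs_def] by (intro measurable_restrict \<theta>)
  define b where "b k \<omega> = (\<lambda>t\<in>{0..T}. \<beta> k t \<omega>)" for k \<omega>
  have "M.indep_vars (\<lambda>_. PiM {0..} (\<lambda>_. borel)) (\<lambda>k \<omega>. \<lambda>t\<in>{0..}. \<beta> k t \<omega>) {1..}"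
    using W by (simp add: cylindrical_wiener_process_def)
  from M.indep_vars_compose2[OF this, where Y="\<lambda>_ x. restrict x {0..T}" and N="\<lambda>_. ?P"]
  have "M.indep_vars (\<lambda>_. ?P) (\<lambda>k \<omega>. restrict (\<lambda>t\<in>{0..}. \<beta> k t \<omega>) {0..T}) {1..}"
    by (simp add: measurable_restrict_subset)
  moreover have "restrict (\<lambda>t\<in>{0..}. \<beta> k t \<omega>) {0..T} = b k \<omega>" for k \<omega>
    by (auto simp: b_def restrict_def fun_eq_iff)
  ultimately have ind: "M.indep_vars (\<lambda>_. ?P) b {1..}" by simp
  then have bm: "b k \<in> measurable M ?P" if "k \<in> {1..}" for k
    using that by (auto simp: M.indep_vars_def)
  have eq: "AE \<omega> in M. \<forall>k\<ge>1. \<theta> k (V \<omega>) = b k \<omega>"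
    using coord_V by eventually_elim (auto simp: \<theta>_def b_def restrict_def fun_eq_iff)
  have marg: "distr M' ?P (\<lambda>\<omega>. \<theta> k (V' \<omega>)) = distr M ?P (b k)" if k: "k \<in> {1..}" for k
  proof -
    have "distr M' ?P (\<lambda>\<omega>. \<theta> k (V' \<omega>)) = distr M ?P (\<lambda>\<omega>. \<theta> k (V \<omega>))"
      using distr_distr[OF \<theta>[OF k] V'] distr_distr[OF \<theta>[OF k] V] law by (simp add: o_def)
    also have "\<dots> = distr M ?P (b k)"
      using eq k by (intro distr_cong_AE measurable_compose[OF V \<theta>[OF k]] bm) (auto elim!: eventually_mono)
    finally show ?thesis .
  qed
  have "distr M' ?PP (\<lambda>\<omega>. \<Theta> (V' \<omega>)) = distr M ?PP (\<lambda>\<omega>. \<Theta> (V \<omega>))"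
    using distr_distr[OF \<Theta> V'] distr_distr[OF \<Theta> V] law by (simp add: o_def)
  also have "\<dots> = distr M ?PP (\<lambda>\<omega>. \<lambda>k\<in>{1..}. b k \<omega>)"
  proof (rule distr_cong_AE)
    show "AE \<omega> in M. \<Theta> (V \<omega>) = (\<lambda>k\<in>{1..}. b k \<omega>)"
      using eq by eventually_elim (auto simp: \<Theta>_def)
    show "(\<lambda>\<omega>. \<lambda>k\<in>{1..}. b k \<omega>) \<in> measurable M ?PP" by (intro measurable_restrict bm)
    show "(\<lambda>\<omega>. \<Theta> (V \<omega>)) \<in> measurable M ?PP" by (rule measurable_compose[OF V \<Theta>])
  qed auto
  also have "\<dots> = PiM {1..} (\<lambda>k. distr M ?P (b k))"
    using ind by (subst (asm) M.indep_vars_iff_distr_eq_PiM'[OF _ bm]) auto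
  also have "\<dots> = PiM {1..} (\<lambda>k. distr M' ?P (\<lambda>\<omega>. \<theta> k (V' \<omega>)))"
    using marg by (intro PiM_cong) auto
  finally have "M'.indep_vars (\<lambda>_. ?P) (\<lambda>k \<omega>. \<theta> k (V' \<omega>)) {1..}"
    by (subst M'.indep_vars_iff_distr_eq_PiM') (auto simp: \<Theta>_def intro: measurable_compose[OF V' \<theta>])
  then show ?thesis by (simp add: \<theta>_def)
qed

end

section \<open>The augmented filtration\<close>

lemma sets_augmented:
  fixes u :: "'b \<Rightarrow> real \<Rightarrow> (real^'n \<Rightarrow> real) \<Rightarrow> real" and W :: "'b \<Rightarrow> real \<Rightarrow> 'w::banach"
  shows "sets (augmented_filtration M u W t) = sigma_sets (space M)
     ({(\<lambda>\<omega>. restrict_paths t (u \<omega>, W \<omega>)) -` E \<inter> space M | E. E \<in> sets (borel_of (X_topology t))} \<union> null_sets M)"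
  and space_augmented [simp]: "space (augmented_filtration M u W t) = space M"
proof -
  have sub: "{(\<lambda>\<omega>. (restrict (u \<omega>) {0..t}, restrict (W \<omega>) {0..t})) -` E \<inter> space M | E. E \<in> sets (borel_of (X_topology t))}
      \<union> null_sets M \<subseteq> Pow (space M)"
    using sets.sets_into_space by (auto dest: null_setsD2)
  show "sets (augmented_filtration M u W t) = sigma_sets (space M)
     ({(\<lambda>\<omega>. restrict_paths t (u \<omega>, W \<omega>)) -` E \<inter> space M | E. E \<in> sets (borel_of (X_topology t))} \<union> null_sets M)"
    unfolding augmented_filtration_def by (simp add: sets_measure_of[OF sub] restrict_paths_def)
  show "space (augmented_filtration M u W t) = space M"
    unfolding augmented_filtration_def by (rule space_measure_of[OF sub])
qed

lemma augmented_path_measurable: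
  fixes u :: "'b \<Rightarrow> real \<Rightarrow> (real^'n \<Rightarrow> real) \<Rightarrow> real" and W :: "'b \<Rightarrow> real \<Rightarrow> 'w::banach"
  assumes Y: "(\<lambda>\<omega>. (u \<omega>, W \<omega>)) \<in> measurable M (borel_of (X_topology T))" and t: "t \<le> T"
  shows "(\<lambda>\<omega>. restrict_paths t (u \<omega>, W \<omega>)) \<in> measurable (augmented_filtration M u W t) (borel_of (X_topology t))"
proof (rule measurableI)
  have "(\<lambda>\<omega>. restrict_paths t (u \<omega>, W \<omega>)) \<in> measurable M (borel_of (X_topology t))"
    by (rule measurable_compose[OF Y continuous_map_measurable[OF continuous_map_restrict_paths[OF t]]])
  then show "restrict_paths t (u \<omega>, W \<omega>) \<in> space (borel_of (X_topology t))" if "\<omega> \<in> space (augmented_filtration M u W t)" for \<omega>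
    using that by (auto dest: measurable_space)
  fix E :: "((real \<Rightarrow> (real^'n \<Rightarrow> real) \<Rightarrow> real) \<times> (real \<Rightarrow> 'w)) set" assume "E \<in> sets (borel_of (X_topology t))"
  then show "(\<lambda>\<omega>. restrict_paths t (u \<omega>, W \<omega>)) -` E \<inter> space (augmented_filtration M u W t) \<in> sets (augmented_filtration M u W t)"
    unfolding sets_augmented by (auto intro!: sigma_sets.Basic)
qed

text \<open>Independence is checked on intersection-stable generators: preimages of closed sets and
  null sets on one side, preimages of closed sets of reals on the other.\<close>

lemma indep_augmented:
  fixes u :: "'b \<Rightarrow> real \<Rightarrow> (real^'n \<Rightarrow> real) \<Rightarrow> real" and W :: "'b \<Rightarrow> real \<Rightarrow> 'w::banach" and X :: "'b \<Rightarrow> real"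
  assumes M: "prob_space M" and Y: "(\<lambda>\<omega>. restrict_paths s (u \<omega>, W \<omega>)) \<in> measurable M (borel_of (X_topology s))"
    and X: "X \<in> borel_measurable M"
    and prod: "\<And>C D. closedin (X_topology s) C \<Longrightarrow> closed D \<Longrightarrow>
      measure M {\<omega>\<in>space M. restrict_paths s (u \<omega>, W \<omega>) \<in> C \<and> X \<omega> \<in> D} =
      measure M {\<omega>\<in>space M. restrict_paths s (u \<omega>, W \<omega>) \<in> C} * measure M {\<omega>\<in>space M. X \<omega> \<in> D}"
  shows "prob_space.indep_set M (sets (augmented_filtration M u W s)) {X -` E \<inter> space M | E. E \<in> sets borel}"
proof -
  interpret prob_space M by fact
  let ?Y = "\<lambda>\<omega>. restrict_paths s (u \<omega>, W \<omega>)"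
  \<comment> \<open>Null sets may be put into the generator itself: intersecting one with any member
    gives a null set again, and the product formula holds trivially for them.\<close>
  define A where "A = {?Y -` C \<inter> space M | C. closedin (X_topology s) C} \<union> null_sets M"
  define B where "B = {X -` D \<inter> space M | D. closed D}"
  have Am: "A \<subseteq> events" unfolding A_def
    using measurable_sets[OF Y closedin_sets_borel_of] by auto
  have Bm: "B \<subseteq> events" unfolding B_def
    using measurable_sets[OF X borel_closed] by auto
  have "indep_set A B"
    unfolding indep_sets2_eq
  proof (intro conjI Am Bm ballI)
    fix a b assume a: "a \<in> A" and b: "b \<in> B"
    obtain D where D: "closed D" "b = X -` D \<inter> space M" using b by (auto simp: B_def)
    from a consider C where "closedin (X_topology s) C" "a = ?Y -` C \<inter> space M" | "a \<in> null_sets M"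
      by (auto simp: A_def)
    then show "prob (a \<inter> b) = prob a * prob b"
    proof cases
      case 1
      have "a \<inter> b = {\<omega>\<in>space M. ?Y \<omega> \<in> C \<and> X \<omega> \<in> D}" "a = {\<omega>\<in>space M. ?Y \<omega> \<in> C}" "b = {\<omega>\<in>space M. X \<omega> \<in> D}"
        using 1 D by auto
      then show ?thesis using prod[OF 1(1) D(1)] by simp
    next
      case 2
      then have "a \<inter> b \<in> null_sets M" using b Bm by (intro null_set_Int2) auto
      then show ?thesis using 2 by (simp add: measure_eq_0_null_sets)
    qed
  qed
  moreover have "Int_stable A"
  proof (rule Int_stableI)
    fix a b assume a: "a \<in> A" and b: "b \<in> A"
    show "a \<inter> b \<in> A"
    proof (cases "a \<in> null_sets M \<or> b \<in> null_sets M")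
      case True
      then have "a \<inter> b \<in> null_sets M" using a b Am by (auto intro: null_set_Int1 null_set_Int2)
      then show ?thesis by (simp add: A_def)
    next
      case False
      then obtain C C' where "closedin (X_topology s) C" "a = ?Y -` C \<inter> space M"
        "closedin (X_topology s) C'" "b = ?Y -` C' \<inter> space M" using a b by (auto simp: A_def)
      then have "closedin (X_topology s) (C \<inter> C')" "a \<inter> b = ?Y -` (C \<inter> C') \<inter> space M" by auto
      then show ?thesis unfolding A_def by blast
    qed
  qed
  moreover have "Int_stable B"
  proof (rule Int_stableI)
    fix a b assume "a \<in> B" "b \<in> B"
    then obtain D D' where "closed D" "a = X -` D \<inter> space M" "closed D'" "b = X -` D' \<inter> space M"
      by (auto simp: B_def)
    then have "closed (D \<inter> D')" "a \<inter> b = X -` (D \<inter> D') \<inter> space M" by auto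
    then show "a \<inter> b \<in> B" unfolding B_def by blast
  qed
  ultimately have ind: "indep_set (sigma_sets (space M) A) (sigma_sets (space M) B)"
    by (rule indep_set_sigma_sets)
  have Ysp: "?Y \<in> space M \<rightarrow> topspace (X_topology s)" using measurable_space[OF Y] by auto
  have "{?Y -` E \<inter> space M | E. E \<in> sets (borel_of (X_topology s))} \<subseteq> sigma_sets (space M) A"
    unfolding sets_borel_of_closed sigma_sets_vimage_commute[OF Ysp]
    by (rule sigma_sets_mono') (auto simp: A_def)
  moreover have "null_sets M \<subseteq> sigma_sets (space M) A" by (auto simp: A_def)
  ultimately have 1: "sets (augmented_filtration M u W s) \<subseteq> sigma_sets (space M) A"
    unfolding sets_augmented by (intro sigma_sets_mono) auto
  have "sets (borel :: real measure) = sigma_sets UNIV {D. closed D}"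
    by (simp add: borel_eq_closed)
  moreover have "X \<in> space M \<rightarrow> UNIV" by simp
  ultimately have "{X -` E \<inter> space M | E. E \<in> sets borel} = sigma_sets (space M) {X -` D \<inter> space M | D. D \<in> {D. closed D}}"
    by (simp only: sigma_sets_vimage_commute)
  then have 2: "{X -` E \<inter> space M | E. E \<in> sets borel} \<subseteq> sigma_sets (space M) B" by (simp add: B_def)
  show ?thesis by (rule indep_set_mono[OF ind 1 2])
qed

section \<open>The limit process\<close>

text \<open>The integrals are pulled back to \<open>M\<close>. There the restricted pair is a
  function of the past up to null sets and the increment of \<open>\<beta> k\<close> is independent
  of \<open>F s\<close>, so expectations of products split.\<close>

lemma approximate_factorization:
  fixes u :: "real \<Rightarrow> 'a \<Rightarrow> real^'n \<Rightarrow> real" and J :: "'u::{real_inner,complete_space} \<Rightarrow> 'w::banach"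
  assumes F: "stochastic_basis M F" and J: "enlarged_space e J"
    and u: "(\<lambda>(t, \<omega>). u t \<omega>) \<in> measurable (predictable_algebra M F T) (borel_of Cinf_topology)"
    and W: "cylindrical_wiener_process M {0..} F e J \<beta> W"
    and law: "has_law M (X_topology T) (\<lambda>\<omega>. (distr_path T u \<omega>, \<lambda>t\<in>{0..T}. W t \<omega>)) \<mu>"
    and st: "0 \<le> s" "s < t" "t \<le> T" and k: "1 \<le> k"
    and G: "continuous_map (X_topology s) euclideanreal G" "\<And>x. 0 \<le> G x \<and> G x \<le> 1"
    and H: "continuous_map euclideanreal euclideanreal H" "\<And>x. 0 \<le> H x \<and> H x \<le> 1"
  defines "\<Delta> \<equiv> \<lambda>y. coord e J (snd y t) k - coord e J (snd y s) k"
  shows "(\<integral>y. G (restrict_paths s y) * H (\<Delta> y) \<partial>\<mu>) = (\<integral>y. G (restrict_paths s y) \<partial>\<mu>) * (\<integral>y. H (\<Delta> y) \<partial>\<mu>)"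
proof -
  interpret M: prob_space M using stochastic_basisD(1)[OF F] .
  let ?S = "X_topology T :: ((real \<Rightarrow> (real^'n \<Rightarrow> real) \<Rightarrow> real) \<times> (real \<Rightarrow> 'w)) topology"
  let ?Z = "\<lambda>\<omega>. (distr_path T u \<omega>, \<lambda>t\<in>{0..T}. W t \<omega>)"
  obtain Z where Z: "Z \<in> measurable M (borel_of ?S)" "AE \<omega> in M. Z \<omega> = ?Z \<omega>"
    "AE \<omega> in M. ?Z \<omega> \<in> topspace ?S" "distr M (borel_of ?S) Z = \<mu>"
    by (rule has_law_modification[OF M.prob_space_axioms law]) (rule that)
  have sT: "s \<le> T" using st by simp
  have \<rho>: "continuous_map ?S (X_topology s) (restrict_paths s)" by (rule continuous_map_restrict_paths[OF sT])
  have Gm: "(\<lambda>y. G (restrict_paths s y)) \<in> borel_measurable (borel_of ?S)"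
    using continuous_map_compose[OF \<rho> G(1)] by (intro continuous_map_borel_measurable) (simp_all add: o_def)
  have snd: "snd \<in> measurable (borel_of ?S) (borel_of (mtopology_of (XW T)))"
    unfolding X_topology_def by (rule continuous_map_measurable[OF continuous_map_snd])
  have \<Delta>m: "\<Delta> \<in> borel_measurable (borel_of ?S)"
    unfolding \<Delta>_def using measurable_compose[OF snd coord_path_measurable[OF J k, of t T]]
      measurable_compose[OF snd coord_path_measurable[OF J k, of s T]] st by (intro borel_measurable_diff) auto
  have Hm: "H \<in> borel_measurable borel" using H(1) by (intro continuous_map_borel_measurable[of euclideanreal]) auto
  define d where "d \<omega> = \<beta> k t \<omega> - \<beta> k s \<omega>" for \<omega>
  have conv: "AE \<omega> in M. \<forall>t\<in>{0..}. (\<lambda>n. \<Sum>k=1..n. \<beta> k t \<omega> *\<^sub>R J (e k)) \<longlonglongrightarrow> W t \<omega>"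
    using W by (simp add: cylindrical_wiener_process_def)
  have \<Delta>d: "AE \<omega> in M. \<Delta> (Z \<omega>) = d \<omega>"
    using Z(2) conv
  proof eventually_elim
    case (elim \<omega>)
    have "coord e J (W r \<omega>) k = \<beta> k r \<omega>" if "0 \<le> r" for r
      using elim(2) that by (intro coord_unique[OF J _ k]) auto
    then show ?case using elim(1) st by (simp add: \<Delta>_def d_def)
  qed
  have wp: "wiener_process M {0..} F (\<beta> k)" using W k by (simp add: cylindrical_wiener_process_def)
  then have dm: "d \<in> borel_measurable M" and
    ind: "M.indep_set (sets (F s)) {d -` E \<inter> space M | E. E \<in> sets borel}"
    using st unfolding wiener_process_def d_def by (auto simp: distributed_def)
  let ?X = "\<lambda>\<omega>. G (restrict_paths s (Z \<omega>))"
  have Xm: "?X \<in> borel_measurable M" by (rule measurable_compose[OF Z(1) Gm])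
  have XF: "?X -` E \<inter> space M \<in> sets (F s)" if E: "E \<in> sets borel" for E
  proof -
    have "?X \<in> borel_measurable (F s)"
    proof (rule borel_measurableI)
      fix O' :: "real set" assume O': "open O'"
      have U: "openin (X_topology s) {x \<in> topspace (X_topology s). G x \<in> O'}"
        using G(1) O' by (simp add: continuous_map_def)
      \<comment> \<open>The set formed with the original paths lies in \<open>F s\<close>, the one
        formed with the version \<open>Z\<close> is so far known only to lie in \<open>M\<close>.
        They differ by a null set, which \<open>sets_AE_eq\<close> allows.\<close>
      have "{\<omega>\<in>space M. restrict_paths s (?Z \<omega>) \<in> {x \<in> topspace (X_topology s). G x \<in> O'}} \<in> sets (F s)"
        by (rule restricted_paths_adapted[OF F st(1) sT J u W Z(3) U])
      moreover have "?X -` O' \<inter> space M \<in> sets M" using measurable_sets[OF Xm, of O'] O' by simp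
      moreover have "AE \<omega> in M. \<omega> \<in> {\<omega>\<in>space M. restrict_paths s (?Z \<omega>) \<in> {x \<in> topspace (X_topology s). G x \<in> O'}} \<longleftrightarrow>
          \<omega> \<in> ?X -` O' \<inter> space M"
        using Z(2,3)
      proof eventually_elim
        case (elim \<omega>)
        have "restrict_paths s (?Z \<omega>) \<in> topspace (X_topology s)"
          using \<rho> elim(2) by (auto simp: continuous_map_def)
        then show ?case by (auto simp: elim(1))
      qed
      ultimately have "?X -` O' \<inter> space M \<in> sets (F s)" by (rule sets_AE_eq[OF F st(1)])
      then show "?X -` O' \<inter> space (F s) \<in> sets (F s)" using basis_subalgebra[OF F st(1)] by simp
    qed
    from measurable_sets[OF this E] show ?thesis using basis_subalgebra[OF F st(1)] by simp
  qed
  have Hd: "(\<lambda>\<omega>. H (d \<omega>)) \<in> borel_measurable M" by (rule measurable_compose[OF dm Hm])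
  have "M.indep_set (sigma_sets (space M) {?X -` E \<inter> space M | E. E \<in> sets borel})
      (sigma_sets (space M) {(\<lambda>\<omega>. H (d \<omega>)) -` E \<inter> space M | E. E \<in> sets borel})"
  proof (rule M.indep_set_sigma_sets)
    \<comment> \<open>Preimages under the composition are preimages under the increment, so
      independence passes to the smaller families.\<close>
    have "(\<lambda>\<omega>. H (d \<omega>)) -` E \<inter> space M = d -` (H -` E) \<inter> space M \<and> H -` E \<in> sets borel" if "E \<in> sets borel" for E
      using measurable_sets[OF Hm that] by auto
    then have "{(\<lambda>\<omega>. H (d \<omega>)) -` E \<inter> space M | E. E \<in> sets borel} \<subseteq> {d -` E \<inter> space M | E. E \<in> sets borel}" by blast
    moreover have "{?X -` E \<inter> space M | E. E \<in> sets borel} \<subseteq> sets (F s)" using XF by blast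
    ultimately show "M.indep_set {?X -` E \<inter> space M | E. E \<in> sets borel} {(\<lambda>\<omega>. H (d \<omega>)) -` E \<inter> space M | E. E \<in> sets borel}"
      using M.indep_set_mono[OF ind] by blast
    have st: "Int_stable {f -` E \<inter> space M | E. E \<in> sets borel}" for f :: "'a \<Rightarrow> real"
    proof (rule Int_stableI)
      fix a b assume "a \<in> {f -` E \<inter> space M | E. E \<in> sets borel}" "b \<in> {f -` E \<inter> space M | E. E \<in> sets borel}"
      then obtain E E' where "E \<in> sets borel" "a = f -` E \<inter> space M" "E' \<in> sets borel" "b = f -` E' \<inter> space M" by blast
      then have "E \<inter> E' \<in> sets borel" "a \<inter> b = f -` (E \<inter> E') \<inter> space M" by auto
      then show "a \<inter> b \<in> {f -` E \<inter> space M | E. E \<in> sets borel}" by blast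
    qed
    show "Int_stable {?X -` E \<inter> space M | E. E \<in> sets borel}" by (rule st)
    show "Int_stable {(\<lambda>\<omega>. H (d \<omega>)) -` E \<inter> space M | E. E \<in> sets borel}" by (rule st)
  qed
  then have iv: "M.indep_var borel ?X borel (\<lambda>\<omega>. H (d \<omega>))" using Xm Hd by (simp add: M.indep_var_eq)
  have int: "integrable M ?X" "integrable M (\<lambda>\<omega>. H (d \<omega>))"
    by (rule M.integrable_const_bound[where B=1, OF AE_I2 Xm], simp add: G(2))
      (rule M.integrable_const_bound[where B=1, OF AE_I2 Hd], simp add: H(2))
  have "(\<integral>y. G (restrict_paths s y) * H (\<Delta> y) \<partial>\<mu>) = (\<integral>\<omega>. ?X \<omega> * H (\<Delta> (Z \<omega>)) \<partial>M)"
    unfolding Z(4)[symmetric] using Gm measurable_compose[OF \<Delta>m Hm]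
    by (intro integral_distr[OF Z(1)] borel_measurable_times) auto
  also have "\<dots> = (\<integral>\<omega>. ?X \<omega> * H (d \<omega>) \<partial>M)"
    using \<Delta>d Xm Hd measurable_compose[OF Z(1) measurable_compose[OF \<Delta>m Hm]]
    by (intro integral_cong_AE borel_measurable_times) (auto elim!: eventually_mono)
  also have "\<dots> = (\<integral>\<omega>. ?X \<omega> \<partial>M) * (\<integral>\<omega>. H (d \<omega>) \<partial>M)"
    by (rule M.indep_var_lebesgue_integral[OF iv int])
  also have "(\<integral>\<omega>. H (d \<omega>) \<partial>M) = (\<integral>\<omega>. H (\<Delta> (Z \<omega>)) \<partial>M)"
    using \<Delta>d Hd measurable_compose[OF Z(1) measurable_compose[OF \<Delta>m Hm]]
    by (intro integral_cong_AE) (auto elim!: eventually_mono)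
  also have "\<dots> = (\<integral>y. H (\<Delta> y) \<partial>\<mu>)"
    unfolding Z(4)[symmetric] by (rule integral_distr[OF Z(1) measurable_compose[OF \<Delta>m Hm], symmetric])
  also have "(\<integral>\<omega>. ?X \<omega> \<partial>M) = (\<integral>y. G (restrict_paths s y) \<partial>\<mu>)"
    unfolding Z(4)[symmetric] by (rule integral_distr[OF Z(1) Gm, symmetric])
  finally show ?thesis .
qed

theorem proposition4p14:
  fixes T :: real
    and B b :: "real \<Rightarrow> real^'n"
    and A :: "real^'n \<Rightarrow> real^'n^'n"
    and M :: "'a measure" and F :: "real \<Rightarrow> 'a measure"
    and e :: "nat \<Rightarrow> 'u::{real_inner,complete_space}"
    and J :: "'u \<Rightarrow> 'w::banach"
    and \<beta> :: "nat \<Rightarrow> real \<Rightarrow> 'a \<Rightarrow> real" and W :: "real \<Rightarrow> 'a \<Rightarrow> 'w"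
    and g :: "nat \<Rightarrow> real^'n \<Rightarrow> real \<Rightarrow> real" and L :: real and h :: "real \<Rightarrow> real"
    and u0 :: "'a \<Rightarrow> real^'n \<Rightarrow> real"
    and \<phi> :: "real \<Rightarrow> (real^'n) \<times> real \<Rightarrow> real" and \<psi> :: "real \<Rightarrow> real \<Rightarrow> real"
    and \<kappa> :: "real \<Rightarrow> real"
    and u :: "real \<Rightarrow> real \<Rightarrow> 'a \<Rightarrow> real^'n \<Rightarrow> real"
    and \<mu> :: "real \<Rightarrow> ((real \<Rightarrow> (real^'n \<Rightarrow> real) \<Rightarrow> real) \<times> (real \<Rightarrow> 'w)) measure"
    and \<mu>lim :: "((real \<Rightarrow> (real^'n \<Rightarrow> real) \<Rightarrow> real) \<times> (real \<Rightarrow> 'w)) measure"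
    and \<epsilon> :: "nat \<Rightarrow> real"
    and M' :: "'b measure"
    and un' :: "nat \<Rightarrow> 'b \<Rightarrow> real \<Rightarrow> (real^'n \<Rightarrow> real) \<Rightarrow> real"
    and Wn' :: "nat \<Rightarrow> 'b \<Rightarrow> real \<Rightarrow> 'w"
    and u' :: "'b \<Rightarrow> real \<Rightarrow> (real^'n \<Rightarrow> real) \<Rightarrow> real"
    and W' :: "'b \<Rightarrow> real \<Rightarrow> 'w"
  assumes T: "0 < T"
    and B: "\<And>\<xi>. (B has_vector_derivative b \<xi>) (at \<xi>)" "continuous_on UNIV b" "polynomial_growth b"
    and A: "\<And>i j. (\<lambda>x. A x $ i $ j) \<in> Cinf" "\<And>x. transpose (A x) = A x"
      "\<And>x v. 0 \<le> v \<bullet> (A x *v v)"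
    and basis: "stochastic_basis M F"
    and e: "complete_orthonormal_system e"
    and J: "enlarged_space e J"
    and W: "cylindrical_wiener_process M {0..} F e J \<beta> W"
      "AE \<omega> in M. continuous_on {0..T} (\<lambda>t. W t \<omega>)"
    and g: "noise_coefficients g L h"
    and u0: "u0 \<in> measurable (F 0) (borel_of Cinf_topology)"
      "\<And>p bs. 1 \<le> p \<Longrightarrow> set bs \<subseteq> Basis \<Longrightarrow>
         integrable M (\<lambda>\<omega>. Cinf_seminorm bs (u0 \<omega>) powr p)"
    and \<phi>: "approx_identity_torus \<phi>"
    and \<psi>: "approx_identity_real \<psi>"
    and \<kappa>: "smooth \<kappa>" "\<And>\<xi>. 0 \<le> \<kappa> \<xi> \<and> \<kappa> \<xi> \<le> 1" "\<And>\<xi>. \<bar>\<xi>\<bar> \<le> 1 / 2 \<Longrightarrow> \<kappa> \<xi> = 1"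
      "\<And>\<xi>. 1 \<le> \<bar>\<xi>\<bar> \<Longrightarrow> \<kappa> \<xi> = 0"
    and u: "\<And>\<delta>. 0 < \<delta> \<Longrightarrow> \<delta> < 1 \<Longrightarrow>
         smooth_solution M F T e \<beta> (B_approx \<kappa> \<psi> B \<delta>) (A_approx A \<delta>)
           (noise_operator e (g_approx \<kappa> \<phi> g \<delta>)) u0 (u \<delta>)"
    and \<mu>: "\<And>\<delta>. 0 < \<delta> \<Longrightarrow> \<delta> < 1 \<Longrightarrow>
         has_law M (X_topology T) (\<lambda>\<omega>. (distr_path T (u \<delta>) \<omega>, \<lambda>t\<in>{0..T}. W t \<omega>)) (\<mu> \<delta>)"
    and \<epsilon>: "\<And>n. 0 < \<epsilon> n \<and> \<epsilon> n < 1" "\<epsilon> \<longlonglongrightarrow> 0"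
    and \<mu>lim: "prob_space \<mu>lim" "sets \<mu>lim = sets (borel_of (X_topology T))"
      "weakly_converges (X_topology T) (\<lambda>n. \<mu> (\<epsilon> n)) \<mu>lim"
    and M': "prob_space M'"
    and un': "\<And>n. (\<lambda>\<omega>. (un' n \<omega>, Wn' n \<omega>)) \<in> measurable M' (borel_of (X_topology T))"
      "\<And>n. distr M' (borel_of (X_topology T)) (\<lambda>\<omega>. (un' n \<omega>, Wn' n \<omega>)) = \<mu> (\<epsilon> n)"
    and u': "(\<lambda>\<omega>. (u' \<omega>, W' \<omega>)) \<in> measurable M' (borel_of (X_topology T))"
      "distr M' (borel_of (X_topology T)) (\<lambda>\<omega>. (u' \<omega>, W' \<omega>)) = \<mu>lim"
    and conv: "AE \<omega> in M'. limitin (X_topology T) (\<lambda>n. (un' n \<omega>, Wn' n \<omega>)) (u' \<omega>, W' \<omega>) sequentially"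
  shows "\<exists>\<beta>'. cylindrical_wiener_process M' {0..T} (augmented_filtration M' u' W') e J \<beta>' (\<lambda>t \<omega>. W' \<omega> t)"
proof -
  let ?S = "X_topology T :: ((real \<Rightarrow> (real^'n \<Rightarrow> real) \<Rightarrow> real) \<times> (real \<Rightarrow> 'w)) topology"
  let ?BW = "borel_of (mtopology_of (XW T)) :: (real \<Rightarrow> 'w) measure"
  interpret M: prob_space M using stochastic_basisD(1)[OF basis] .
  interpret M': prob_space M' by (rule M')
  have up: "(\<lambda>(t, \<omega>). u (\<epsilon> n) t \<omega>) \<in> measurable (predictable_algebra M F T) (borel_of Cinf_topology)" for n
    using u[of "\<epsilon> n"] \<epsilon>(1)[of n] unfolding smooth_solution_def by blast
  have law: "has_law M ?S (\<lambda>\<omega>. (distr_path T (u (\<epsilon> n)) \<omega>, \<lambda>t\<in>{0..T}. W t \<omega>)) (\<mu> (\<epsilon> n))" for n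
    using \<mu>[of "\<epsilon> n"] \<epsilon>(1)[of n] by blast
  \<comment> \<open>Versions with values in the path space everywhere, so that the laws can be
    written with \<open>distr\<close>.\<close>
  have "\<exists>Z. Z \<in> measurable M (borel_of ?S) \<and> (AE \<omega> in M. Z \<omega> = (distr_path T (u (\<epsilon> n)) \<omega>, \<lambda>t\<in>{0..T}. W t \<omega>)) \<and>
      distr M (borel_of ?S) Z = \<mu> (\<epsilon> n)" for n
    by (rule has_law_modification[OF M.prob_space_axioms law[of n]]) blast
  from choice[OF allI[OF this]] obtain Z where *: "\<forall>n. Z n \<in> measurable M (borel_of ?S) \<and>
      (AE \<omega> in M. Z n \<omega> = (distr_path T (u (\<epsilon> n)) \<omega>, \<lambda>t\<in>{0..T}. W t \<omega>)) \<and>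
      distr M (borel_of ?S) (Z n) = \<mu> (\<epsilon> n)" by (rule exE)
  have Z: "Z n \<in> measurable M (borel_of ?S)"
    "AE \<omega> in M. Z n \<omega> = (distr_path T (u (\<epsilon> n)) \<omega>, \<lambda>t\<in>{0..T}. W t \<omega>)"
    "distr M (borel_of ?S) (Z n) = \<mu> (\<epsilon> n)" for n
    using *[rule_format, of n] by - (elim conjE, assumption)+
  have snd_cont: "continuous_map ?S (mtopology_of (XW T)) snd"
    unfolding X_topology_def by (rule continuous_map_snd)
  have snd: "snd \<in> measurable (borel_of ?S) ?BW" by (rule continuous_map_measurable[OF snd_cont])
  have snd_lim: "snd \<in> measurable \<mu>lim ?BW" using snd measurable_cong_sets[OF \<mu>lim(2) refl] by blast
  \<comment> \<open>The index 0 is an arbitrary choice: almost surely the second component of every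
    \<open>Z n\<close> is the path of the same \<open>W\<close>.\<close>
  define V where "V \<omega> = snd (Z 0 \<omega>)" for \<omega>
  have V: "V \<in> measurable M ?BW" unfolding V_def[abs_def] by (rule measurable_compose[OF Z(1) snd])
  have W': "W' \<in> measurable M' ?BW" using measurable_compose[OF u'(1) snd] by simp
  have VW: "AE \<omega> in M. V \<omega> = (\<lambda>t\<in>{0..T}. W t \<omega>)" using Z(2)[of 0] by eventually_elim (simp add: V_def)
  have lawW: "distr M' ?BW W' = distr M ?BW V"
  proof -
    have "distr M' ?BW W' = distr \<mu>lim ?BW snd"
      using distr_distr[OF snd u'(1)] by (simp add: u'(2) o_def)
    also have "\<dots> = distr M ?BW V"
    proof (rule prob_eqI_continuous[OF metrizable_mtopology_of])
      show "prob_space (distr \<mu>lim ?BW snd)" by (rule prob_space.prob_space_distr[OF \<mu>lim(1) snd_lim])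
      show "prob_space (distr M ?BW V)" by (rule M.prob_space_distr[OF V])
      fix f :: "(real \<Rightarrow> 'w) \<Rightarrow> real"
      assume f: "continuous_map (mtopology_of (XW T)) euclideanreal f" "bounded (f ` topspace (mtopology_of (XW T)))"
      have fm: "f \<in> borel_measurable ?BW" by (rule continuous_map_borel_measurable[OF f(1) refl])
      have fs: "(\<lambda>y. f (snd y)) \<in> borel_measurable (borel_of ?S)" by (rule measurable_compose[OF snd fm])
      have "continuous_map ?S euclideanreal (\<lambda>y. f (snd y))"
        using continuous_map_compose[OF snd_cont f(1)] by (simp add: o_def)
      moreover have "bounded ((\<lambda>y. f (snd y)) ` topspace ?S)"
        using snd_cont by (intro bounded_subset[OF f(2)]) (auto simp: continuous_map_def Pi_iff simp del: topspace_mtopology_of)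
      ultimately have lim: "(\<lambda>n. \<integral>y. f (snd y) \<partial>\<mu> (\<epsilon> n)) \<longlonglongrightarrow> (\<integral>y. f (snd y) \<partial>\<mu>lim)"
        using \<mu>lim(3) unfolding weakly_converges_def by blast
      \<comment> \<open>These integrals do not depend on n, so the weak limit is this
        constant.\<close>
      have "(\<integral>y. f (snd y) \<partial>\<mu> (\<epsilon> n)) = (\<integral>\<omega>. f (V \<omega>) \<partial>M)" for n
      proof -
        have "(\<integral>y. f (snd y) \<partial>\<mu> (\<epsilon> n)) = (\<integral>\<omega>. f (snd (Z n \<omega>)) \<partial>M)"
          unfolding Z(3)[symmetric] by (rule integral_distr[OF Z(1) fs])
        also have "\<dots> = (\<integral>\<omega>. f (V \<omega>) \<partial>M)"
        proof (rule integral_cong_AE)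
          show "AE \<omega> in M. f (snd (Z n \<omega>)) = f (V \<omega>)" using Z(2)[of n] VW by eventually_elim simp
          show "(\<lambda>\<omega>. f (snd (Z n \<omega>))) \<in> borel_measurable M" by (rule measurable_compose[OF Z(1) fs])
          show "(\<lambda>\<omega>. f (V \<omega>)) \<in> borel_measurable M" by (rule measurable_compose[OF V fm])
        qed
        finally show ?thesis .
      qed
      then have "(\<integral>y. f (snd y) \<partial>\<mu>lim) = (\<integral>\<omega>. f (V \<omega>) \<partial>M)" using lim by (simp add: LIMSEQ_const_iff)
      then show "integral\<^sup>L (distr \<mu>lim ?BW snd) f = integral\<^sup>L (distr M ?BW V) f"
        by (simp add: integral_distr[OF snd_lim fm] integral_distr[OF V fm])
    qed auto
    finally show ?thesis .
  qed
  note transfer = M.prob_space_axioms M' J T W(1) V W' lawW VW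
  let ?F = "augmented_filtration M' u' W'"
  \<comment> \<open>The candidates for the limit Wiener processes. With this choice the series for
    \<open>W'\<close> converges for every \<omega>, by \<open>coord_sums\<close>.\<close>
  let ?\<beta> = "\<lambda>k t \<omega>. coord e J (W' \<omega> t) k"
  have W'_path: "W' \<omega> \<in> mspace (XW T)" if "\<omega> \<in> space M'" for \<omega>
    using measurable_space[OF W' that] by simp
  have "wiener_process M' {0..T} ?F (?\<beta> k)" if k: "1 \<le> k" for k
    unfolding wiener_process_def
  proof (intro conjI ballI impI)
    fix t assume t: "t \<in> {0..T}"
    have "snd \<in> measurable (borel_of (X_topology t)) (borel_of (mtopology_of (XW t :: (real \<Rightarrow> 'w) metric)))"
      unfolding X_topology_def by (rule continuous_map_measurable[OF continuous_map_snd])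
    \<comment> \<open>Adaptedness: the coordinate at time t is read off the path restricted to
      [0,t], which still contains t.\<close>
    from measurable_compose[OF augmented_path_measurable[OF u'(1)] measurable_compose[OF this coord_path_measurable[OF J k, of t t]]]
    show "?\<beta> k t \<in> borel_measurable (?F t)" using t by (simp add: restrict_paths_def)
  next
    show "AE \<omega> in M'. ?\<beta> k 0 \<omega> = 0" by (rule transfer_start[OF transfer k])
    show "AE \<omega> in M'. continuous_on {0..T} (\<lambda>t. ?\<beta> k t \<omega>)"
    proof (rule AE_I2)
      fix \<omega> assume "\<omega> \<in> space M'"
      then have "continuous_on {0..T} (W' \<omega>)" using W'_path by (auto simp: XW_def mspace_cfunspace)
      then show "continuous_on {0..T} (\<lambda>t. ?\<beta> k t \<omega>)"
        by (rule continuous_on_compose2[OF continuous_on_coord[OF J k]]) auto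
    qed
  next
    fix s t assume st: "s \<in> {0..T}" "t \<in> {0..T}" "s < t"
    show "distributed M' lborel (\<lambda>\<omega>. ?\<beta> k t \<omega> - ?\<beta> k s \<omega>) (normal_density 0 (sqrt (t - s)))"
      using st by (intro transfer_increment[OF transfer k]) auto
    define \<Delta> where "\<Delta> = (\<lambda>y :: (real \<Rightarrow> (real^'n \<Rightarrow> real) \<Rightarrow> real) \<times> (real \<Rightarrow> 'w). coord e J (snd y t) k - coord e J (snd y s) k)"
    have \<Delta>: "continuous_map ?S euclideanreal \<Delta>"
      unfolding \<Delta>_def using continuous_map_compose[OF snd_cont continuous_map_XW_coord[OF J k st(1)]]
        continuous_map_compose[OF snd_cont continuous_map_XW_coord[OF J k st(2)]]
      by (intro continuous_map_diff) (simp_all add: o_def)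
    have \<rho>: "continuous_map ?S (X_topology s) (restrict_paths s)"
      using st by (intro continuous_map_restrict_paths) auto
    have Ym: "(\<lambda>\<omega>. restrict_paths s (u' \<omega>, W' \<omega>)) \<in> measurable M' (borel_of (X_topology s))"
      by (rule measurable_compose[OF u'(1) continuous_map_measurable[OF \<rho>]])
    have \<Delta>b: "\<Delta> \<in> borel_measurable (borel_of ?S)" by (rule continuous_map_borel_measurable[OF \<Delta> refl])
    have Xm: "(\<lambda>\<omega>. ?\<beta> k t \<omega> - ?\<beta> k s \<omega>) \<in> borel_measurable M'"
      using measurable_compose[OF u'(1) \<Delta>b] by (simp add: \<Delta>_def)
    \<comment> \<open>Only closed sets have to be tested. The required product formula is an
      identity for \<open>\<mu>lim\<close>, obtained from the approximations and carried to
      \<open>M'\<close> along the pair (u', W').\<close>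
    show "M'.indep_set (sets (?F s)) {(\<lambda>\<omega>. ?\<beta> k t \<omega> - ?\<beta> k s \<omega>) -` E \<inter> space M' | E. E \<in> sets borel}"
    proof (rule indep_augmented[OF M' Ym Xm])
      fix C :: "((real \<Rightarrow> (real^'n \<Rightarrow> real) \<Rightarrow> real) \<times> (real \<Rightarrow> 'w)) set" and D :: "real set"
      assume CD: "closedin (X_topology s) C" "closed D"
      have push: "measure \<mu>lim {y\<in>topspace ?S. P y} = measure M' {\<omega>\<in>space M'. P (u' \<omega>, W' \<omega>)}"
        if "{y\<in>topspace ?S. P y} \<in> sets (borel_of ?S)" for P
      proof -
        have "(\<lambda>\<omega>. (u' \<omega>, W' \<omega>)) -` {y\<in>topspace ?S. P y} \<inter> space M' = {\<omega>\<in>space M'. P (u' \<omega>, W' \<omega>)}"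
          using measurable_space[OF u'(1)] by auto
        then show ?thesis unfolding u'(2)[symmetric] by (simp add: measure_distr[OF u'(1) that])
      qed
      have Cm: "{y\<in>topspace ?S. restrict_paths s y \<in> C} \<in> sets (borel_of ?S)"
        using closedin_continuous_map_preimage[OF \<rho> CD(1)] by (rule closedin_sets_borel_of)
      have Dm: "{y\<in>topspace ?S. \<Delta> y \<in> D} \<in> sets (borel_of ?S)"
        using closedin_continuous_map_preimage[OF \<Delta>, of D] CD(2) by (intro closedin_sets_borel_of) auto
      have CDm: "{y\<in>topspace ?S. restrict_paths s y \<in> C \<and> \<Delta> y \<in> D} \<in> sets (borel_of ?S)"
        using sets.Int[OF Cm Dm] by (auto simp: Collect_conj_eq[symmetric] intro: back_subst[of "\<lambda>A. A \<in> sets (borel_of ?S)"])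
      have "measure \<mu>lim {y\<in>topspace ?S. restrict_paths s y \<in> C \<and> \<Delta> y \<in> D} =
        measure \<mu>lim {y\<in>topspace ?S. restrict_paths s y \<in> C} * measure \<mu>lim {y\<in>topspace ?S. \<Delta> y \<in> D}"
      proof (rule closed_factorization[OF \<mu>lim(3,1,2) \<rho> \<Delta> metrizable_X_topology _ CD])
        fix n and G :: "(real \<Rightarrow> (real^'n \<Rightarrow> real) \<Rightarrow> real) \<times> (real \<Rightarrow> 'w) \<Rightarrow> real" and H :: "real \<Rightarrow> real"
        assume "continuous_map (X_topology s) euclideanreal G" "continuous_map euclideanreal euclideanreal H"
          "\<And>x. 0 \<le> G x \<and> G x \<le> 1" "\<And>x. 0 \<le> H x \<and> H x \<le> 1"
        then show "(\<integral>y. G (restrict_paths s y) * H (\<Delta> y) \<partial>\<mu> (\<epsilon> n)) =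
            (\<integral>y. G (restrict_paths s y) \<partial>\<mu> (\<epsilon> n)) * (\<integral>y. H (\<Delta> y) \<partial>\<mu> (\<epsilon> n))"
          unfolding \<Delta>_def using st
          by (intro approximate_factorization[OF basis J up[of n] W(1) law[of n] _ _ _ k]) auto
      qed
      then show "measure M' {\<omega>\<in>space M'. restrict_paths s (u' \<omega>, W' \<omega>) \<in> C \<and> ?\<beta> k t \<omega> - ?\<beta> k s \<omega> \<in> D} =
        measure M' {\<omega>\<in>space M'. restrict_paths s (u' \<omega>, W' \<omega>) \<in> C} * measure M' {\<omega>\<in>space M'. ?\<beta> k t \<omega> - ?\<beta> k s \<omega> \<in> D}"
        unfolding push[OF CDm] push[OF Cm] push[OF Dm] by (simp add: \<Delta>_def)
    qed
  qed
  moreover have "M'.indep_vars (\<lambda>_. PiM {0..T} (\<lambda>_. borel)) (\<lambda>k \<omega>. \<lambda>t\<in>{0..T}. ?\<beta> k t \<omega>) {1..}"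
    by (rule transfer_indep[OF transfer])
  moreover have "AE \<omega> in M'. \<forall>t\<in>{0..T}. (\<lambda>n. \<Sum>k=1..n. ?\<beta> k t \<omega> *\<^sub>R J (e k)) \<longlonglongrightarrow> W' \<omega> t"
    using coord_sums[OF J] by simp
  ultimately have "cylindrical_wiener_process M' {0..T} ?F e J ?\<beta> (\<lambda>t \<omega>. W' \<omega> t)"
    unfolding cylindrical_wiener_process_def by blast
  then show ?thesis by blast
qed

end
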